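(* Let $d,d'\ge 0$ be integers and let $H$ be a graph with maximum degree at most $d$. Then there exists $c>0$ such that for all integers $n\ge 0$, there are at most $c^n$ unlabelled (that is, counted up to isomorphism) $d$-connected $n$-vertex graphs with maximum degree at most $d'$ that do not contain a subdivision of $H$.
   Context: All graphs are finite and have no loops or parallel edges. A subdivision of a graph $H$ is a graph $J$ such that $H$ can be obtained from $J$ by repeatedly contracting an edge incident with a vertex of degree two (equivalently, $J$ is obtained from $H$ by replacing edges by internally disjoint paths); $G$ contains a subdivision of $H$ if some subgraph of $G$ is a subdivision of $H$. Connectivity is vertex-connectivity. *)

theory Defs
  imports Complex_Main "Graph_Theory.Graph_Theory"
begin

text \<open>
  A finite graph without loops or parallel edges is a \<^locale>\<open>pair_graph\<close>: a finite loopless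
  symmetric digraph whose arcs are pairs of vertices, each edge being represented by its two
  orientations. The null graph is allowed.
\<close>

text \<open>By symmetry the out-degree of a vertex is its degree.\<close>

definition max_degree_le :: "'a pair_pre_digraph \<Rightarrow> nat \<Rightarrow> bool" where
  "max_degree_le G k \<longleftrightarrow> (\<forall>v \<in> pverts G. out_degree (with_proj G) v \<le> k)"

text \<open>
  The usual convention: more than \<open>k\<close> vertices, and no set of fewer than \<open>k\<close> vertices
  disconnects. In particular, the 0-connected graphs are exactly the non-null ones.
\<close>

definition vertex_connected :: "nat \<Rightarrow> 'a pair_pre_digraph \<Rightarrow> bool" where
  "vertex_connected k G \<longleftrightarrow> k < card (pverts G) \<and>
     (\<forall>X \<subseteq> pverts G. card X < k \<longrightarrow> connected (with_proj G \<restriction> (pverts G - X)))"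

text \<open>
  \<^const>\<open>subdivision_pair\<close> keeps the names of the branch vertices, so \<open>H\<close> is first replaced by an
  isomorphic copy \<open>K\<close> on vertices of \<open>G\<close>.
\<close>

definition contains_subdivision :: "'a pair_pre_digraph \<Rightarrow> 'b pair_pre_digraph \<Rightarrow> bool" where
  "contains_subdivision G H \<longleftrightarrow>
     (\<exists>J K. subgraph (with_proj J) (with_proj G) \<and> digraph_iso (with_proj H) (with_proj K) \<and>
        subdivision_pair K J)"

definition iso_rel :: "'a pair_pre_digraph set \<Rightarrow> 'a pair_pre_digraph rel" where
  "iso_rel S = {(G, G'). G \<in> S \<and> G' \<in> S \<and> digraph_iso (with_proj G) (with_proj G')}"

text \<open>
  Every \<open>n\<close>-vertex graph is isomorphic to one with vertex set \<open>{..<n}\<close>, so the unlabelled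
  \<open>n\<close>-vertex graphs with an isomorphism-invariant property \<open>P\<close> are the isomorphism classes of the
  graphs on \<open>{..<n}\<close> satisfying \<open>P\<close>.
\<close>

definition graphs_on :: "nat \<Rightarrow> (nat pair_pre_digraph \<Rightarrow> bool) \<Rightarrow> nat pair_pre_digraph set" where
  "graphs_on n P = {G. pair_graph G \<and> pverts G = {..<n} \<and> P G}"

definition unlabelled_graphs :: "nat \<Rightarrow> (nat pair_pre_digraph \<Rightarrow> bool) \<Rightarrow> nat pair_pre_digraph set set" where
  "unlabelled_graphs n P = graphs_on n P // iso_rel (graphs_on n P)"

lemma equiv_iso_rel:
  assumes "\<And>G. G \<in> S \<Longrightarrow> pair_graph G"
  shows "equiv S (iso_rel S)"
proof -
  have wf: "wf_digraph (with_proj G)" if "G \<in> S" for G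
  proof -
    interpret pair_graph G using assms that .
    show ?thesis by (rule wf_digraph)
  qed
  have refl: "digraph_iso (with_proj G) (with_proj G)" if "G \<in> S" for G
  proof -
    let ?f = "\<lparr>iso_verts = id, iso_arcs = id, iso_head = snd, iso_tail = fst\<rparr>"
    have "pre_digraph.digraph_isomorphism (with_proj G) ?f"
      using wf[OF that] by (simp add: pre_digraph.digraph_isomorphism_def)
    moreover have "with_proj G = app_iso ?f (with_proj G)"
      by (simp add: app_iso_def with_proj_def)
    ultimately show ?thesis unfolding digraph_iso_def by blast
  qed
  show ?thesis
  proof (rule equivI)
    show "iso_rel S \<subseteq> S \<times> S" by (auto simp: iso_rel_def)
    show "refl_on S (iso_rel S)" by (auto simp: iso_rel_def refl_on_def refl)
    show "sym (iso_rel S)"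
      by (auto simp: iso_rel_def sym_def intro: digraph_iso_swap wf)
    show "trans (iso_rel S)"
      by (auto simp: iso_rel_def trans_def intro: digraph_iso_trans)
  qed
qed

lemma finite_unlabelled_graphs: "finite (unlabelled_graphs n P)"
proof -
  let ?h = "\<lambda>E. \<lparr>pverts = {..<n}, parcs = E\<rparr>"
  have "graphs_on n P \<subseteq> ?h ` Pow ({..<n} \<times> {..<n})"
  proof
    fix G assume "G \<in> graphs_on n P"
    then have G: "pair_graph G" "pverts G = {..<n}" by (auto simp: graphs_on_def)
    interpret pair_graph G by (rule G)
    have "parcs G \<subseteq> {..<n} \<times> {..<n}"
      using arc_fst_in_verts arc_snd_in_verts G(2) by fastforce
    moreover have "G = ?h (parcs G)" using G(2) by simp
    ultimately show "G \<in> ?h ` Pow ({..<n} \<times> {..<n})" by blast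
  qed
  then have "finite (graphs_on n P)" by (rule finite_subset) simp
  then show ?thesis
    unfolding unlabelled_graphs_def
    by (rule finite_quotient) (auto simp: iso_rel_def)
qed

end

theory Submission
  imports Defs
begin

text \<open>
  Large clique minors force subdivisions: take a \<open>d\<close>-connected graph of bounded degree with a huge
  clique minor. Among one representative vertex per branch set, each is separated from the bulk of
  the model together with only few others by a small cut along a connected set, so \<open>card (pverts H)\<close>
  of them can be chosen that do not interact in this way. Replacing each of them by \<open>d\<close> copies,
  \<open>d\<close>-connectivity shows that the copies cannot be separated from the model by fewer vertices than
  there are copies. By an argument of Robertson and Seymour the copies are then the roots of a
  clique minor, which contains all the linkages needed for a subdivision of \<open>H\<close>.

  Hence the graphs in question exclude some clique minor, and it remains to count graphs with this
  property (Norine, Seymour, Thomas and Wollan): such a graph either has a matching of linear size,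
  whose contraction gives a smaller graph from which the original one can be recovered with linearly
  many bits, or all but a small fraction of its vertices are twins and can be identified.
\<close>

section \<open>Connected sets and clique models\<close>

text \<open>The connectivity \<open>d\<close> suffices for one branch vertex, but a subdivision of
  \<open>H\<close> may need \<open>d\<close> paths at each of \<open>card (pverts H)\<close>
  vertices simultaneously. The obstacle is a cut that is large enough for one branch vertex but too
  small for several behind it. Bounded degree removes it: two small cut-off sets whose boundaries
  share a vertex merge into one such set at the price of at most \<open>\<Delta>\<close> further
  boundary vertices. Hence branch vertices that are not \<open>close\<close> are cut off by disjoint
  boundaries, and these add up to \<open>d\<close> per vertex. In the counting half, working up to
  isomorphism allows the vertices to be numbered along the fibres of the map onto the smaller graph.
  This makes the map monotone and leaves \<open>2 ^ (n + m)\<close> instead of \<open>m ^ n\<close>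
  possibilities for it. Linearly many edges keep the number of ways to split vertices exponential.
  One step shrinks the vertex number by a factor of at most \<open>1 - 1 / q\<close> and is paid for
  by \<open>b ^ n\<close> choices; \<open>(b ^ q) ^ n\<close> solves this recursion.\<close>

definition nb :: "'a set \<Rightarrow> 'a rel \<Rightarrow> 'a set \<Rightarrow> 'a set" where
  "nb V E U = {v \<in> V - U. \<exists>u\<in>U. (u, v) \<in> E}"

text \<open>Connectedness by cuts instead of paths: unions, images, preimages and contractions then
  need only one crossing arc. Paths are extracted once, in \<open>conn_path\<close>.\<close>

definition conn :: "'a rel \<Rightarrow> 'a set \<Rightarrow> bool" where
  "conn E S \<longleftrightarrow> S \<noteq> {} \<and> (\<forall>C\<subseteq>S. C \<noteq> {} \<and> C \<noteq> S \<longrightarrow> (\<exists>u\<in>C. \<exists>v\<in>S - C. (u, v) \<in> E))"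

definition clique_model :: "'a set \<Rightarrow> 'a rel \<Rightarrow> nat \<Rightarrow> (nat \<Rightarrow> 'a set) \<Rightarrow> bool" where
  "clique_model V E t B \<longleftrightarrow> (\<forall>i<t. B i \<subseteq> V \<and> conn E (B i)) \<and>
     (\<forall>i<t. \<forall>j<t. i \<noteq> j \<longrightarrow> B i \<inter> B j = {} \<and> (\<exists>u\<in>B i. \<exists>v\<in>B j. (u, v) \<in> E))"

definition simple_graph :: "'a set \<Rightarrow> 'a rel \<Rightarrow> bool" where
  "simple_graph V E \<longleftrightarrow> finite V \<and> E \<subseteq> V \<times> V \<and> sym E \<and> irrefl E"

lemma simple_graphD:
  assumes "simple_graph V E"
  shows "finite V" "E \<subseteq> V \<times> V" "sym E" "irrefl E" "finite E"
  using assms finite_subset[of E "V \<times> V"] by (auto simp: simple_graph_def)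

lemma simple_graph_restrict:
  assumes "simple_graph V E" "W \<subseteq> V"
  shows "simple_graph W (E \<inter> W \<times> W)"
  using assms finite_subset[of W V] by (auto simp: simple_graph_def sym_def irrefl_def)

lemma finite_nb: "finite V \<Longrightarrow> finite (nb V E U)"
  by (simp add: nb_def)

lemma nb_subset: "nb V E U \<subseteq> V - U"
  by (auto simp: nb_def)

lemma conn_nonempty: "conn E S \<Longrightarrow> S \<noteq> {}"
  by (simp add: conn_def)

lemma connE:
  assumes "conn E S" "C \<subseteq> S" "C \<noteq> {}" "C \<noteq> S"
  obtains u v where "u \<in> C" "v \<in> S - C" "(u, v) \<in> E"
  using assms unfolding conn_def by blast

lemma conn_singleton: "conn E {x}"
  by (auto simp: conn_def)

lemma conn_mono: "conn E S \<Longrightarrow> E \<subseteq> F \<Longrightarrow> conn F S"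
  unfolding conn_def by blast

lemma conn_Un:
  assumes A: "conn E A" and B: "conn E B" and E: "sym E"
    and AB: "A \<inter> B \<noteq> {} \<or> (\<exists>a\<in>A. \<exists>b\<in>B. (a, b) \<in> E)"
  shows "conn E (A \<union> B)"
  unfolding conn_def
proof (intro conjI allI impI)
  show "A \<union> B \<noteq> {}" using conn_nonempty[OF A] by blast
next
  fix C assume C: "C \<subseteq> A \<union> B" "C \<noteq> {} \<and> C \<noteq> A \<union> B"
  show "\<exists>u\<in>C. \<exists>v\<in>A \<union> B - C. (u, v) \<in> E"
  proof (cases "(C \<inter> A \<noteq> {} \<and> C \<inter> A \<noteq> A) \<or> (C \<inter> B \<noteq> {} \<and> C \<inter> B \<noteq> B)")
    case True
    then show ?thesis
    proof
      assume "C \<inter> A \<noteq> {} \<and> C \<inter> A \<noteq> A"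
      then obtain u v where "u \<in> C \<inter> A" "v \<in> A - C \<inter> A" "(u, v) \<in> E"
        using connE[OF A, of "C \<inter> A"] by blast
      then show ?thesis by blast
    next
      assume "C \<inter> B \<noteq> {} \<and> C \<inter> B \<noteq> B"
      then obtain u v where "u \<in> C \<inter> B" "v \<in> B - C \<inter> B" "(u, v) \<in> E"
        using connE[OF B, of "C \<inter> B"] by blast
      then show ?thesis by blast
    qed
  next
    case False
    then have "(C = A \<and> C \<inter> B = {}) \<or> (C = B \<and> C \<inter> A = {})" using C by blast
    then show ?thesis using AB E by (blast dest: symD)
  qed
qed

lemma conn_insert:
  assumes "conn E A" "sym E" "a \<in> A" "(a, x) \<in> E"
  shows "conn E (insert x A)"
  using conn_Un[OF assms(1) conn_singleton assms(2), of x] assms(3,4) by auto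

text \<open>A proper part of the preimage either splits some fibre, which is connected, or is a
  union of fibres and then comes from a proper part of \<open>S\<close>.\<close>

lemma conn_vimage:
  assumes S: "conn E' S"
    and fib: "\<And>x. x \<in> S \<Longrightarrow> conn E {v \<in> V. \<pi> v = x}"
    and edge: "\<And>x y. x \<in> S \<Longrightarrow> y \<in> S \<Longrightarrow> x \<noteq> y \<Longrightarrow> (x, y) \<in> E' \<Longrightarrow>
      \<exists>u\<in>V. \<exists>v\<in>V. \<pi> u = x \<and> \<pi> v = y \<and> (u, v) \<in> E"
  shows "conn E {v \<in> V. \<pi> v \<in> S}"
  unfolding conn_def
proof (intro conjI allI impI)
  show "{v \<in> V. \<pi> v \<in> S} \<noteq> {}"
    using conn_nonempty[OF S] fib conn_nonempty by blast
next
  fix C assume C: "C \<subseteq> {v \<in> V. \<pi> v \<in> S}" "C \<noteq> {} \<and> C \<noteq> {v \<in> V. \<pi> v \<in> S}"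
  show "\<exists>u\<in>C. \<exists>v\<in>{v \<in> V. \<pi> v \<in> S} - C. (u, v) \<in> E"
  proof (cases "\<exists>x\<in>S. C \<inter> {v \<in> V. \<pi> v = x} \<noteq> {} \<and> C \<inter> {v \<in> V. \<pi> v = x} \<noteq> {v \<in> V. \<pi> v = x}")
    case True
    then obtain x where x: "x \<in> S" "C \<inter> {v \<in> V. \<pi> v = x} \<noteq> {}"
      "C \<inter> {v \<in> V. \<pi> v = x} \<noteq> {v \<in> V. \<pi> v = x}" by blast
    obtain u v where "u \<in> C \<inter> {v \<in> V. \<pi> v = x}"
      "v \<in> {v \<in> V. \<pi> v = x} - C \<inter> {v \<in> V. \<pi> v = x}" "(u, v) \<in> E"
      using connE[OF fib[OF x(1)] _ x(2,3)] by blast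
    then have "u \<in> C" "v \<in> {v \<in> V. \<pi> v \<in> S} - C" using x(1) by auto
    then show ?thesis using \<open>(u, v) \<in> E\<close> by blast
  next
    case False
    then have full: "v \<in> C" if "u \<in> C" "v \<in> V" "\<pi> v = \<pi> u" for u v
      using that C(1) by blast
    obtain w where w: "w \<in> V" "\<pi> w \<in> S" "w \<notin> C" using C by blast
    have "\<pi> ` C \<subseteq> S" "\<pi> ` C \<noteq> {}" using C by auto
    moreover have "\<pi> w \<notin> \<pi> ` C" using w full by force
    ultimately obtain x y where xy: "x \<in> \<pi> ` C" "y \<in> S - \<pi> ` C" "(x, y) \<in> E'"
      using connE[OF S, of "\<pi> ` C"] w(2) by blast
    then obtain u v where uv: "u \<in> V" "v \<in> V" "\<pi> u = x" "\<pi> v = y" "(u, v) \<in> E"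
      using edge[of x y] \<open>\<pi> ` C \<subseteq> S\<close> by blast
    then have "u \<in> C" "v \<notin> C" using xy full by blast+
    then show ?thesis using uv xy by blast
  qed
qed

text \<open>Used for minors: \<open>\<pi>\<close> contracts its fibres, and preimages of branch sets
  are branch sets again.\<close>

lemma clique_model_lift:
  assumes B: "clique_model V' E' t B"
    and fib: "\<And>x. x \<in> V' \<Longrightarrow> conn E {v \<in> V. \<pi> v = x}"
    and edge: "\<And>x y. x \<in> V' \<Longrightarrow> y \<in> V' \<Longrightarrow> x \<noteq> y \<Longrightarrow> (x, y) \<in> E' \<Longrightarrow>
      \<exists>u\<in>V. \<exists>v\<in>V. \<pi> u = x \<and> \<pi> v = y \<and> (u, v) \<in> E"
  shows "clique_model V E t (\<lambda>i. {v \<in> V. \<pi> v \<in> B i})"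
  unfolding clique_model_def
proof (intro conjI allI impI)
  fix i assume i: "i < t"
  have "B i \<subseteq> V'" "conn E' (B i)" using B i by (auto simp: clique_model_def)
  then show "conn E {v \<in> V. \<pi> v \<in> B i}"
    using fib edge by (intro conn_vimage[of E']) blast+
  fix j assume j: "j < t" "i \<noteq> j"
  have dj: "B i \<inter> B j = {}" and ex: "\<exists>u\<in>B i. \<exists>v\<in>B j. (u, v) \<in> E'" and "B j \<subseteq> V'"
    using B i j by (auto simp: clique_model_def)
  show "{v \<in> V. \<pi> v \<in> B i} \<inter> {v \<in> V. \<pi> v \<in> B j} = {}" using dj by blast
  obtain x y where "x \<in> B i" "y \<in> B j" "(x, y) \<in> E'" using ex by blast
  moreover then obtain u v where "u \<in> V" "v \<in> V" "\<pi> u = x" "\<pi> v = y" "(u, v) \<in> E"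
    using edge[of x y] dj \<open>B i \<subseteq> V'\<close> \<open>B j \<subseteq> V'\<close> by blast
  ultimately show "\<exists>u\<in>{v \<in> V. \<pi> v \<in> B i}. \<exists>v\<in>{v \<in> V. \<pi> v \<in> B j}. (u, v) \<in> E" by blast
qed blast

lemma clique_model_mono:
  assumes "clique_model V E t B" "V \<subseteq> V'" "E \<subseteq> E'"
  shows "clique_model V' E' t B"
  using assms conn_mono[of E _ E'] unfolding clique_model_def by (meson subset_eq)

section \<open>Dense graphs have large clique minors\<close>

lemma card_edges_sum:
  assumes "finite W" 
  shows "card (E \<inter> W \<times> W) = (\<Sum>v\<in>W. card {w \<in> W. (v, w) \<in> E})"
proof -
  have "E \<inter> W \<times> W = Sigma W (\<lambda>v. {w \<in> W. (v, w) \<in> E})" by auto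
  then show ?thesis using assms by simp
qed

lemma card_edges_remove:
  assumes G: "sym E" "irrefl E" and W: "finite W" "v \<in> W"
  shows "card (E \<inter> W \<times> W) = card (E \<inter> (W - {v}) \<times> (W - {v})) + 2 * card {w \<in> W. (v, w) \<in> E}"
proof -
  let ?N = "{w \<in> W. (v, w) \<in> E}" and ?F = "E \<inter> (W - {v}) \<times> (W - {v})"
  have nv: "v \<notin> ?N" using G by (auto simp: irrefl_def)
  have "E \<inter> W \<times> W = ?F \<union> ({v} \<times> ?N \<union> ?N \<times> {v})"
    using G W by (auto dest: symD)
  moreover have "card (?F \<union> ({v} \<times> ?N \<union> ?N \<times> {v})) = card ?F + card ({v} \<times> ?N \<union> ?N \<times> {v})"
    using W by (intro card_Un_disjoint) auto
  moreover have "card ({v} \<times> ?N \<union> ?N \<times> {v}) = card ({v} \<times> ?N) + card (?N \<times> {v})"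
    using W nv by (intro card_Un_disjoint) auto
  ultimately show ?thesis by (simp add: card_cartesian_product)
qed

text \<open>The proof grows a connected set \<open>U\<close>, to be contracted to a single vertex, as long as the
  contracted graph remains dense: \<open>card (E \<inter> (V - U) \<times> (V - U)) + 2 * card (nb V E U)\<close> is its number
  of arcs. When \<open>U\<close> is maximal, its neighbourhood induces a graph of large minimum degree.\<close>

lemma dense_imp_clique_model:
  assumes "simple_graph V E" "V \<noteq> {}" "2 ^ t * card V \<le> card E"
  shows "\<exists>B. clique_model V E t B"
  using assms
proof (induction t arbitrary: V E)
  case 0
  then show ?case by (auto simp: clique_model_def)
next
  case (Suc t)
  note IHt = Suc.IH
  from Suc.prems show ?case
  proof (induction "card V" arbitrary: V E rule: less_induct)
    case (less V E)
    let ?C = "2 ^ Suc t :: nat"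
    let ?e = "\<lambda>W. card (E \<inter> W \<times> W)"
    let ?dense = "\<lambda>U. U \<subseteq> V \<and> conn E U \<and>
      ?C * (card (V - U) + 1) \<le> ?e (V - U) + 2 * card (nb V E U)"
    note G = simple_graphD[OF less.prems(1)]
    have fin: "finite U" if "U \<subseteq> V" for U using that G(1) finite_subset by blast
    obtain v where v: "v \<in> V" using less.prems by blast
    have "E \<inter> V \<times> V = E" "nb V E {v} = {w \<in> V. (v, w) \<in> E}"
      using G(2) G(4) by (auto simp: nb_def irrefl_def)
    moreover have "card (V - {v}) + 1 = card V" using v G(1) card_Suc_Diff1 by fastforce
    ultimately have "?dense {v}"
      using v card_edges_remove[OF G(3,4,1) v] less.prems(3) conn_singleton by auto
    then obtain U where U: "?dense U" and max: "\<And>U'. ?dense U' \<Longrightarrow> card U' \<le> card U"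
      using ex_has_greatest_nat[of ?dense "{v}" card "Suc (card V)"] card_mono[OF G(1)]
      by (metis le_imp_less_Suc)
    let ?N = "nb V E U"
    show ?case
    proof (cases "?N = {}")
      case True
      \<comment> \<open>With \<open>U = V\<close> the right side of the density inequality would
        vanish, but the left side is \<open>2 ^ Suc t\<close>.\<close>
      have "V - U \<noteq> {}" using U True by auto
      have "V - U \<subset> V" using U conn_nonempty by blast
      then have "card (V - U) < card V" using G(1) by (rule psubset_card_mono[rotated])
      then obtain B where "clique_model (V - U) (E \<inter> (V - U) \<times> (V - U)) (Suc t) B"
        using less.hyps[of "V - U" "E \<inter> (V - U) \<times> (V - U)"]
          simple_graph_restrict[OF less.prems(1), of "V - U"] \<open>V - U \<noteq> {}\<close> U True by auto
      then show ?thesis using clique_model_mono[of _ _ _ B V E] by blast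
    next
      case False
      have NV: "?N \<subseteq> V" "finite ?N" using G(1) by (auto simp: nb_def)
      \<comment> \<open>Absorbing \<open>v\<close> into \<open>U\<close> costs the contracted graph
        one vertex and \<open>2 * (1 + card ?DN)\<close> arcs: the edge from \<open>v\<close> to
        \<open>U\<close> and one of two parallel edges at every common neighbour. By maximality of
        \<open>U\<close> this loss exceeds \<open>2 ^ Suc t\<close>.\<close>
      have deg: "2 ^ t \<le> card {w \<in> ?N. (v, w) \<in> E}" if v: "v \<in> ?N" for v
      proof -
        let ?U = "insert v U"
        let ?D = "{w \<in> V - U. (v, w) \<in> E}" and ?DN = "{w \<in> ?N. (v, w) \<in> E}"
        obtain u where u: "u \<in> U" "(u, v) \<in> E" "v \<in> V - U" using v by (auto simp: nb_def)
        have cU: "conn E ?U" using U u conn_insert G(3) by metis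
        have "\<not> ?dense ?U"
        proof
          assume "?dense ?U"
          then have "card ?U \<le> card U" by (rule max)
          moreover have "card ?U = Suc (card U)" using u U fin by (metis DiffD2 card_insert_disjoint)
          ultimately show False by simp
        qed
        then have a: "?e (V - ?U) + 2 * card (nb V E ?U) < ?C * (card (V - ?U) + 1)"
          using U u cU by auto
        have eq: "V - ?U = (V - U) - {v}" by blast
        have b: "card (V - ?U) + 1 = card (V - U)"
          unfolding eq using u G(1) card_Suc_Diff1[of "V - U" v] by simp
        have c: "?e (V - U) = ?e (V - ?U) + 2 * card ?D"
          unfolding eq using card_edges_remove[OF G(3,4), of "V - U" v] u G(1) by simp
        have "nb V E ?U = (?N - {v}) \<union> (?D - ?DN)"
          using u G(4) by (auto simp: nb_def irrefl_def)
        moreover have "card ((?N - {v}) \<union> (?D - ?DN)) = card (?N - {v}) + card (?D - ?DN)"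
          using G(1) NV(2) by (intro card_Un_disjoint) (auto simp: nb_def)
        ultimately have "card (nb V E ?U) = card (?N - {v}) + card (?D - ?DN)" by simp
        moreover have "card (?N - {v}) + 1 = card ?N"
          using v NV(2) card_Suc_Diff1 by fastforce
        moreover have "card (?D - ?DN) + card ?DN = card ?D"
        proof -
          have "?DN \<subseteq> ?D" using nb_subset[of V E U] by blast
          moreover have "finite ?D" using G(1) by simp
          ultimately show ?thesis
            by (metis (no_types, lifting) card_Diff_subset card_mono finite_subset le_add_diff_inverse2)
        qed
        ultimately have d: "card (nb V E ?U) + 1 + card ?DN = card ?N + card ?D" by linarith
        have "?C * (card (V - ?U) + 1) + ?C \<le> ?e (V - U) + 2 * card ?N"
          using U unfolding b by (simp add: algebra_simps)
        then show ?thesis using a c d by simp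
      qed
      have "2 ^ t * card ?N = (\<Sum>v\<in>?N. 2 ^ t)" by simp
      also have "\<dots> \<le> (\<Sum>v\<in>?N. card {w \<in> ?N. (v, w) \<in> E})" using deg by (rule sum_mono)
      also have "\<dots> = card (E \<inter> ?N \<times> ?N)" using card_edges_sum[OF NV(2)] by simp
      finally obtain B where B: "clique_model ?N (E \<inter> ?N \<times> ?N) t B"
        using IHt[OF simple_graph_restrict[OF less.prems(1) NV(1)] False] by blast
      \<comment> \<open>\<open>U\<close> is the additional branch set: all \<open>B i\<close> lie in
        its neighbourhood.\<close>
      define B' where "B' i = (if i < t then B i else U)" for i
      have BE: "clique_model ?N E t B" using clique_model_mono[OF B] by blast
      have NU: "\<exists>u\<in>U. \<exists>v\<in>B i. (u, v) \<in> E" "B i \<inter> U = {}" if "i < t" for i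
      proof -
        have "B i \<subseteq> ?N" "B i \<noteq> {}" using BE that conn_nonempty by (auto simp: clique_model_def)
        then show "\<exists>u\<in>U. \<exists>v\<in>B i. (u, v) \<in> E" "B i \<inter> U = {}" by (auto simp: nb_def)
      qed
      have "clique_model V E (Suc t) B'"
        unfolding clique_model_def
      proof (intro conjI allI impI)
        fix i assume i: "i < Suc t"
        show "B' i \<subseteq> V" using BE i U NV(1) by (auto simp: B'_def clique_model_def)
        show "conn E (B' i)" using BE i U by (auto simp: B'_def clique_model_def)
        fix j assume j: "j < Suc t" "i \<noteq> j"
        show "B' i \<inter> B' j = {}"
          using BE i j NU(2)[of i] NU(2)[of j]
          by (cases "i < t"; cases "j < t") (simp_all add: B'_def clique_model_def Int_commute)
        show "\<exists>u\<in>B' i. \<exists>v\<in>B' j. (u, v) \<in> E"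
        proof (cases "i < t \<and> j < t")
          case True
          then show ?thesis using BE j by (auto simp: B'_def clique_model_def)
        next
          case False
          then show ?thesis using i j NU(1) G(3) by (simp add: B'_def) (meson symD)
        qed
      qed
      then show ?thesis by blast
    qed
  qed
qed

section \<open>Menger's theorem\<close>

text \<open>Pigeonhole. It gives every member of a linkage a unique end in \<open>B\<close>, at
  which the next linkage can be attached.\<close>

lemma disjoint_hits_bij:
  assumes fin: "finite B" "card A = card B" "finite A"
    and hit: "\<And>a. a \<in> A \<Longrightarrow> T a \<inter> B \<noteq> {}"
    and disj: "\<And>a b. a \<in> A \<Longrightarrow> b \<in> A \<Longrightarrow> a \<noteq> b \<Longrightarrow> T a \<inter> T b = {}"
  obtains g where "bij_betw g A B" "\<And>a. a \<in> A \<Longrightarrow> T a \<inter> B = {g a}"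
proof -
  have "\<forall>a\<in>A. \<exists>b. b \<in> T a \<inter> B" using hit by blast
  then obtain g where g: "\<And>a. a \<in> A \<Longrightarrow> g a \<in> T a \<inter> B" by metis
  have inj: "inj_on g A" using g disj by (fastforce simp: inj_on_def)
  have "g ` A \<subseteq> B" using g by blast
  moreover have "card (g ` A) = card B" using inj fin by (simp add: card_image)
  ultimately have img: "g ` A = B" using fin by (simp add: card_subset_eq)
  have "T a \<inter> B = {g a}" if "a \<in> A" for a
  proof -
    have "y = g a" if y: "y \<in> T a \<inter> B" for y
    proof -
      obtain a' where "a' \<in> A" "y = g a'" using y img by blast
      then show ?thesis using disj[of a a'] g[of a'] y \<open>a \<in> A\<close> by blast
    qed
    then show ?thesis using g[OF that] by blast
  qed
  then show ?thesis using that inj img by (auto simp: bij_betw_def)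
qed

text \<open>A linkage made of disjoint connected sets instead of paths, so that linkages are
  composed by taking unions.\<close>

definition linked :: "'a set \<Rightarrow> 'a rel \<Rightarrow> 'a set \<Rightarrow> 'a set \<Rightarrow> ('a \<Rightarrow> 'a set) \<Rightarrow> bool" where
  "linked V E A B T \<longleftrightarrow> (\<forall>a\<in>A. a \<in> T a \<and> T a \<subseteq> V \<and> conn E (T a) \<and> T a \<inter> B \<noteq> {}) \<and>
     (\<forall>a\<in>A. \<forall>b\<in>A. a \<noteq> b \<longrightarrow> T a \<inter> T b = {})"

lemma linkedD:
  assumes "linked V E A B T" "a \<in> A"
  shows "a \<in> T a" "T a \<subseteq> V" "conn E (T a)" "T a \<inter> B \<noteq> {}"
    and "\<And>b. b \<in> A \<Longrightarrow> a \<noteq> b \<Longrightarrow> T a \<inter> T b = {}"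
  using assms by (auto simp: linked_def)

definition separation :: "'a set \<Rightarrow> 'a rel \<Rightarrow> 'a set \<Rightarrow> 'a set \<Rightarrow> bool" where
  "separation V E P Q \<longleftrightarrow> P \<union> Q = V \<and> (\<forall>u\<in>P - Q. \<forall>v\<in>Q - P. (u, v) \<notin> E)"

text \<open>If some separation of minimum order is proper on both sides, the linkages
  of the two sides are glued; otherwise the first edge of a path leaving \<open>A\<close> can be used up.\<close>

lemma menger:
  assumes "finite V" "sym E" "A \<subseteq> V" "B \<subseteq> V" "card A = card B"
    and "\<And>P Q. separation V E P Q \<Longrightarrow> A \<subseteq> P \<Longrightarrow> B \<subseteq> Q \<Longrightarrow> card A \<le> card (P \<inter> Q)"
  shows "\<exists>T. linked V E A B T"
  using assms
proof (induction "card V" arbitrary: V A B rule: less_induct)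
  case (less V A B)
  note sep = less.prems(6)
  have finA: "finite A" and finB: "finite B"
    using less.prems finite_subset by blast+
  show ?case
  proof (cases "\<exists>P Q. separation V E P Q \<and> A \<subseteq> P \<and> B \<subseteq> Q \<and> card (P \<inter> Q) = card A \<and> P \<noteq> V \<and> Q \<noteq> V")
    case True
    then obtain P Q where PQ: "separation V E P Q" "A \<subseteq> P" "B \<subseteq> Q" "card (P \<inter> Q) = card A"
      "P \<noteq> V" "Q \<noteq> V" by blast
    have V: "P \<union> Q = V" using PQ(1) by (simp add: separation_def)
    have lt: "card P < card V" "card Q < card V"
      using V PQ(5,6) less.prems(1) by (auto intro!: psubset_card_mono)
    have finPQ: "finite P" "finite Q" using V less.prems(1) by auto
    have "\<exists>T. linked P E A (P \<inter> Q) T"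
    proof (rule less.hyps[OF lt(1) finPQ(1) less.prems(2) PQ(2)])
      fix P1 P2 assume *: "separation P E P1 P2" "A \<subseteq> P1" "P \<inter> Q \<subseteq> P2"
      \<comment> \<open>What separates \<open>A\<close> from \<open>P \<inter> Q\<close> inside
        \<open>P\<close> separates \<open>A\<close> from \<open>B\<close> in the whole
        graph.\<close>
      have "separation V E P1 (P2 \<union> Q)" 
        using * PQ(1) unfolding separation_def by blast
      moreover have "P1 \<inter> (P2 \<union> Q) = P1 \<inter> P2"
        using * unfolding separation_def by blast
      ultimately show "card A \<le> card (P1 \<inter> P2)"
        using sep[of P1 "P2 \<union> Q"] * PQ(3) by auto
    qed (use PQ in auto)
    then obtain T1 where T1: "linked P E A (P \<inter> Q) T1" by blast
    have "\<exists>T. linked Q E (P \<inter> Q) B T"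
    proof (rule less.hyps[OF lt(2) finPQ(2) less.prems(2) _ PQ(3)])
      fix Q1 Q2 assume *: "separation Q E Q1 Q2" "P \<inter> Q \<subseteq> Q1" "B \<subseteq> Q2"
      have "separation V E (P \<union> Q1) Q2" 
        using * PQ(1) unfolding separation_def by blast
      moreover have "(P \<union> Q1) \<inter> Q2 = Q1 \<inter> Q2"
        using * unfolding separation_def by blast
      ultimately show "card (P \<inter> Q) \<le> card (Q1 \<inter> Q2)"
        using sep[of "P \<union> Q1" Q2] * PQ by auto
    qed (use PQ less.prems in auto)
    then obtain T2 where T2: "linked Q E (P \<inter> Q) B T2" by blast
    obtain g where g: "bij_betw g A (P \<inter> Q)" "\<And>a. a \<in> A \<Longrightarrow> T1 a \<inter> (P \<inter> Q) = {g a}"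
    proof (rule disjoint_hits_bij[of "P \<inter> Q" A T1])
      show "card A = card (P \<inter> Q)" using PQ by simp
    qed (use T1 finPQ finA in \<open>auto simp: linked_def\<close>)
    have gX: "g a \<in> P \<inter> Q" "g a \<in> T1 a" if "a \<in> A" for a
      using g that by blast+
    have gi: "g a \<noteq> g b" if "a \<in> A" "b \<in> A" "a \<noteq> b" for a b
      using g(1) that by (auto simp: bij_betw_def inj_on_def)
    have T2X: "T2 x \<inter> (P \<inter> Q) = {x}" if "x \<in> P \<inter> Q" for x
      using T2 that unfolding linked_def by blast
    \<comment> \<open>The two sets live on different sides, so they can meet only in
      \<open>P \<inter> Q\<close>, where each of them has a single vertex.\<close>
    have d12: "T1 a \<inter> T2 (g b) = {}" if "a \<in> A" "b \<in> A" "a \<noteq> b" for a b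
    proof -
      have "T1 a \<inter> T2 (g b) \<subseteq> (T1 a \<inter> (P \<inter> Q)) \<inter> (T2 (g b) \<inter> (P \<inter> Q))"
        using T1 T2 that gX[OF that(2)] unfolding linked_def by blast
      also have "\<dots> = {}" using g(2)[OF that(1)] T2X[OF gX(1)[OF that(2)]] gi that by simp
      finally show ?thesis by blast
    qed
    have "linked V E A B (\<lambda>a. T1 a \<union> T2 (g a))"
      unfolding linked_def
    proof (intro conjI ballI impI)
      fix a assume a: "a \<in> A"
      note x = gX[OF a]
      show "a \<in> T1 a \<union> T2 (g a)" "T1 a \<union> T2 (g a) \<subseteq> V" "(T1 a \<union> T2 (g a)) \<inter> B \<noteq> {}"
        using a T1 T2 x V unfolding linked_def by blast+
      show "conn E (T1 a \<union> T2 (g a))"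
        using a T1 T2 x less.prems(2) unfolding linked_def by (intro conn_Un) blast+
      fix b assume b: "b \<in> A" "a \<noteq> b"
      have "T1 a \<inter> T1 b = {}" "T2 (g a) \<inter> T2 (g b) = {}"
        using linkedD(5)[OF T1 a b] linkedD(5)[OF T2 x(1) gX(1)[OF b(1)] gi[OF a b]] by simp_all
      then show "(T1 a \<union> T2 (g a)) \<inter> (T1 b \<union> T2 (g b)) = {}"
        using d12[of a b] d12[of b a] a b by blast
    qed
    then show ?thesis by blast
  next
    case nontight: False
    show ?thesis
    proof (cases "A \<inter> B = {}")
      case False
      then obtain v where v: "v \<in> A" "v \<in> B" by blast
      let ?V = "V - {v}" and ?A = "A - {v}" and ?B = "B - {v}"
      have cA: "card A = Suc (card ?A)" "card B = Suc (card ?B)"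
        using v finA finB card_Suc_Diff1 by metis+
      have "\<exists>T. linked ?V E ?A ?B T"
      proof (rule less.hyps)
        show "card ?V < card V" using v less.prems by (meson card_Diff1_less subsetD)
        fix P Q assume *: "separation ?V E P Q" "?A \<subseteq> P" "?B \<subseteq> Q"
        have "separation V E (insert v P) (insert v Q)"
          using * v less.prems(3) unfolding separation_def by blast
        then have "card A \<le> card (insert v P \<inter> insert v Q)"
          using sep[of "insert v P" "insert v Q"] * v by blast
        also have "insert v P \<inter> insert v Q = insert v (P \<inter> Q)" by blast
        also have "card \<dots> \<le> Suc (card (P \<inter> Q))" by (rule card_insert_le_m1) auto
        finally show "card ?A \<le> card (P \<inter> Q)" using cA by simp
      qed (use less.prems cA in auto)
      then obtain T where T: "linked ?V E ?A ?B T" by blast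
      have "linked V E A B (T(v := {v}))"
        using T v less.prems(3) unfolding linked_def by (auto simp: conn_singleton)
      then show ?thesis by blast
    next
      case disj: True
      show ?thesis
      proof (cases "A = {}")
        case True
        then show ?thesis by (auto simp: linked_def)
      next
        case False
        then obtain a where a: "a \<in> A" by blast
        then have aB: "a \<notin> B" using disj by blast
        \<comment> \<open>If no edge led from \<open>a\<close> out of \<open>A\<close>, then
          \<open>(A, V - {a})\<close> would be a separation of order below \<open>card A\<close>.
          The edge found in this way allows its end \<open>v\<close> to replace \<open>a\<close> as
          a source.\<close>
        have "card (A \<inter> (V - {a})) < card A"
          using a finA by (intro psubset_card_mono) auto
        then have "\<not> separation V E A (V - {a})"
          using sep[of A "V - {a}"] less.prems(4) aB by fastforce
        then obtain v where v: "v \<in> V" "v \<notin> A" "(a, v) \<in> E"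
          using less.prems(3) a unfolding separation_def by blast
        let ?V = "V - {a}" and ?A = "insert v (A - {a})"
        have va: "v \<noteq> a" using v a by blast
        have cA: "card ?A = card A"
          using a v finA card_Suc_Diff1[of A a] by simp
        have "\<exists>T. linked ?V E ?A B T"
        proof (rule less.hyps)
          show "card ?V < card V" using a less.prems by (meson card_Diff1_less subsetD)
          fix P Q assume *: "separation ?V E P Q" "?A \<subseteq> P" "B \<subseteq> Q"
          have PQV: "P \<subseteq> V" "Q \<subseteq> V" "a \<notin> P" "a \<notin> Q" using * unfolding separation_def by auto
          have finPQ: "finite P" "finite Q" using PQV less.prems(1) finite_subset by blast+
          have s: "separation V E (insert a P) (insert a Q)"
            using * a less.prems(3) unfolding separation_def by blast
          show "card ?A \<le> card (P \<inter> Q)"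
          proof (rule ccontr)
            assume "\<not> ?thesis"
            then have lt: "card (P \<inter> Q) < card A" using cA by simp
            have "card A \<le> card (insert a P \<inter> insert a Q)"
              using sep[OF s] * by blast
            moreover have "insert a P \<inter> insert a Q = insert a (P \<inter> Q)" by blast
            moreover have "card (insert a (P \<inter> Q)) = Suc (card (P \<inter> Q))" using finPQ PQV by simp
            ultimately have "card (insert a P \<inter> insert a Q) = card A" using lt by simp
            \<comment> \<open>A separation of minimum order is not proper on both sides here;
              whichever side is everything, \<open>P \<inter> Q\<close> contains \<open>B\<close> or
              \<open>?A\<close>.\<close>
            then have "insert a P = V \<or> insert a Q = V"
              using nontight s * by blast
            then have "P = V - {a} \<or> Q = V - {a}" using PQV by blast
            then have "B \<subseteq> P \<inter> Q \<or> ?A \<subseteq> P \<inter> Q"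
              using * less.prems(3,4) aB v va by blast
            then have "card A \<le> card (P \<inter> Q)"
              using card_mono[of "P \<inter> Q"] finPQ cA less.prems(5) by (metis finite_Int)
            then show False using lt by simp
          qed
        qed (use less.prems cA v va aB a in auto)
        then obtain T where T: "linked ?V E ?A B T" by blast
        define T' where "T' = T(a := insert a (T v))"
        have Tv: "v \<in> T v" "T v \<subseteq> ?V" "conn E (T v)" "T v \<inter> B \<noteq> {}"
          using T by (auto simp: linked_def)
        have "linked V E A B T'"
          unfolding linked_def
        proof (intro conjI ballI impI)
          fix x assume x: "x \<in> A"
          show "x \<in> T' x" "T' x \<subseteq> V" "T' x \<inter> B \<noteq> {}"
            using T Tv x less.prems(3) by (auto simp: T'_def linked_def)
          show "conn E (T' x)"
          proof (cases "x = a")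
            case True
            then show ?thesis
              using conn_insert[OF Tv(3) less.prems(2) Tv(1)] v(3) less.prems(2)
              by (simp add: T'_def symD)
          next
            case False
            then show ?thesis using T x by (simp add: T'_def linked_def)
          qed
          fix y assume y: "y \<in> A" "x \<noteq> y"
          have *: "insert a (T v) \<inter> T z = {}" if "z \<in> A" "z \<noteq> a" for z
            using linkedD(5)[OF T, of v z] linkedD(2)[OF T, of z] that v by auto
          show "T' x \<inter> T' y = {}"
          proof (cases "x = a \<or> y = a")
            case True
            then show ?thesis using *[of x] *[of y] x y by (auto simp: T'_def)
          next
            case False
            then show ?thesis using T x y by (simp add: T'_def linked_def)
          qed
        qed
        then show ?thesis by blast
      qed
    qed
  qed
qed

section \<open>Rooted clique models\<close>

text \<open>A clique model in which a branch set may also be disconnected, provided that each of its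
  components meets \<open>Z\<close>; adjacency is required only if one of the two branch sets avoids \<open>Z\<close>. These
  are the parts of branch sets that survive cutting along \<open>Z\<close>. The last condition says that no
  branch set can be separated from \<open>Z\<close> by fewer than \<open>card Z\<close> vertices.\<close>

definition robust_model :: "'a set \<Rightarrow> 'a rel \<Rightarrow> 'a set \<Rightarrow> 'i set \<Rightarrow> ('i \<Rightarrow> 'a set) \<Rightarrow> bool" where
  "robust_model V E Z I B \<longleftrightarrow>
     (\<forall>i\<in>I. B i \<subseteq> V \<and> B i \<noteq> {} \<and>
        (\<forall>C\<subseteq>B i - Z. C \<noteq> {} \<longrightarrow> C \<noteq> B i \<longrightarrow> (\<exists>u\<in>C. \<exists>v\<in>B i - C. (u, v) \<in> E))) \<and>
     (\<forall>i\<in>I. \<forall>j\<in>I. i \<noteq> j \<longrightarrow> B i \<inter> B j = {} \<and>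
        (B i \<inter> Z = {} \<longrightarrow> (\<exists>u\<in>B i. \<exists>v\<in>B j. (u, v) \<in> E))) \<and>
     (\<forall>D\<subseteq>V - Z. (\<exists>i\<in>I. B i \<subseteq> D) \<longrightarrow> card Z \<le> card (nb V E D))"

definition rooted_clique_model :: "'a set \<Rightarrow> 'a rel \<Rightarrow> 'a set \<Rightarrow> ('a \<Rightarrow> 'a set) \<Rightarrow> bool" where
  "rooted_clique_model V E Z T \<longleftrightarrow> (\<forall>z\<in>Z. z \<in> T z \<and> T z \<subseteq> V \<and> conn E (T z)) \<and>
     (\<forall>z\<in>Z. \<forall>y\<in>Z. z \<noteq> y \<longrightarrow> T z \<inter> T y = {} \<and> (\<exists>u\<in>T z. \<exists>v\<in>T y. (u, v) \<in> E))"

lemma robust_modelD: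
  assumes "robust_model V E Z I B"
  shows "\<And>i. i \<in> I \<Longrightarrow> B i \<subseteq> V" "\<And>i. i \<in> I \<Longrightarrow> B i \<noteq> {}"
    "\<And>i C. i \<in> I \<Longrightarrow> C \<subseteq> B i - Z \<Longrightarrow> C \<noteq> {} \<Longrightarrow> C \<noteq> B i \<Longrightarrow> \<exists>u\<in>C. \<exists>v\<in>B i - C. (u, v) \<in> E"
    "\<And>i j. i \<in> I \<Longrightarrow> j \<in> I \<Longrightarrow> i \<noteq> j \<Longrightarrow> B i \<inter> B j = {}"
    "\<And>i j. i \<in> I \<Longrightarrow> j \<in> I \<Longrightarrow> i \<noteq> j \<Longrightarrow> B i \<inter> Z = {} \<Longrightarrow> \<exists>u\<in>B i. \<exists>v\<in>B j. (u, v) \<in> E"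
    "\<And>D i. D \<subseteq> V - Z \<Longrightarrow> i \<in> I \<Longrightarrow> B i \<subseteq> D \<Longrightarrow> card Z \<le> card (nb V E D)"
  using assms unfolding robust_model_def by simp_all blast

lemma rooted_clique_modelD:
  assumes "rooted_clique_model V E Z T" "z \<in> Z"
  shows "z \<in> T z" "T z \<subseteq> V" "conn E (T z)"
    and "\<And>y. y \<in> Z \<Longrightarrow> z \<noteq> y \<Longrightarrow> T z \<inter> T y = {}"
    and "\<And>y. y \<in> Z \<Longrightarrow> z \<noteq> y \<Longrightarrow> \<exists>u\<in>T z. \<exists>v\<in>T y. (u, v) \<in> E"
  using assms by (auto simp: rooted_clique_model_def)

text \<open>The key is \<open>inside\<close>: a trace avoiding the new roots \<open>nb V E D\<close>
  is a whole branch set within \<open>D\<close>, because a branch set can leave \<open>D\<close>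
  only through the boundary. Hence adjacency and the boundary condition are inherited, the latter
  because there are as many new roots as old ones. No trace is empty, since \<open>B i\<close> lies
  in \<open>D\<close>, avoids \<open>Z\<close> and is thus adjacent to every other branch
  set.\<close>

lemma robust_model_cut:
  assumes V: "finite V" "sym E" and Z: "Z \<subseteq> V" and R: "robust_model V E Z I B"
    and D: "D \<subseteq> V - Z" "i \<in> I" "B i \<subseteq> D" and tight: "card (nb V E D) = card Z"
  shows "robust_model (D \<union> nb V E D) E (nb V E D) I (\<lambda>j. B j \<inter> (D \<union> nb V E D))"
    (is "robust_model ?V E ?Z I ?B")
proof -
  note R = robust_modelD[OF R]
  have VV: "?V \<subseteq> V" using D by (auto simp: nb_def)
  have edge: "v \<in> ?V" if "u \<in> D" "(u, v) \<in> E" "v \<in> V" for u v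
    using that D by (auto simp: nb_def)
  have inside: "B j \<subseteq> D" if j: "j \<in> I" and e: "?B j \<inter> ?Z = {}" and ne: "?B j \<noteq> {}" for j
  proof (rule ccontr)
    assume *: "\<not> B j \<subseteq> D"
    have "B j \<inter> D \<noteq> {}" using e ne by blast
    moreover have "B j \<inter> D \<subseteq> B j - Z" "B j \<inter> D \<noteq> B j" using D * by blast+
    ultimately obtain u v where "u \<in> B j \<inter> D" "v \<in> B j - B j \<inter> D" "(u, v) \<in> E"
      using R(3)[OF j, of "B j \<inter> D"] by blast
    then have "v \<in> ?B j \<inter> ?Z" using edge[of u v] R(1)[OF j] by blast
    then show False using e by blast
  qed
  have ne: "?B j \<noteq> {}" if j: "j \<in> I" for j
  proof (cases "j = i")
    case True
    then show ?thesis using D(3) R(2)[OF D(2)] by blast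
  next
    case False
    then obtain u v where "u \<in> B i" "v \<in> B j" "(u, v) \<in> E"
      using R(5)[OF D(2) j] D by blast
    then show ?thesis using edge[of u v] D(3) R(1)[OF j] by blast
  qed
  show ?thesis
    unfolding robust_model_def
  proof (intro conjI ballI allI impI)
    fix j assume j: "j \<in> I"
    show "?B j \<subseteq> ?V" by blast
    show "?B j \<noteq> {}" by (rule ne[OF j])
    fix C assume C: "C \<subseteq> ?B j - ?Z" "C \<noteq> {}" "C \<noteq> ?B j"
    then have "C \<subseteq> D" by blast
    then have "C \<subseteq> B j - Z" "C \<noteq> B j" using C D by blast+
    then obtain u v where uv: "u \<in> C" "v \<in> B j - C" "(u, v) \<in> E" using R(3)[OF j] C(2) by blast
    then have "v \<in> ?V" using edge[of u v] \<open>C \<subseteq> D\<close> R(1)[OF j] by blast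
    then show "\<exists>u\<in>C. \<exists>v\<in>?B j - C. (u, v) \<in> E" using uv by blast
  next
    fix j l assume j: "j \<in> I" and l: "l \<in> I" "j \<noteq> l"
    show "?B j \<inter> ?B l = {}" using R(4)[OF j l] by blast
    assume e: "?B j \<inter> ?Z = {}"
    have BD: "B j \<subseteq> D" using inside[OF j e ne[OF j]] .
    then obtain u v where uv: "u \<in> B j" "v \<in> B l" "(u, v) \<in> E" using R(5)[OF j l] D(1) by blast
    then have "v \<in> ?V" using edge[of u v] BD R(1)[OF l(1)] by blast
    then show "\<exists>u\<in>?B j. \<exists>v\<in>?B l. (u, v) \<in> E" using uv BD by blast
  next
    fix D' assume D': "D' \<subseteq> ?V - ?Z" "\<exists>j\<in>I. ?B j \<subseteq> D'"
    then obtain j where j: "j \<in> I" "?B j \<subseteq> D'" by blast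
    have DD: "D' \<subseteq> D" using D' by blast
    then have "?B j \<inter> ?Z = {}" using j D'(1) by blast
    then have "B j \<subseteq> D" using inside[OF j(1)] ne[OF j(1)] by blast
    then have "B j \<subseteq> D'" using j(2) by blast
    then have "card Z \<le> card (nb V E D')" using R(6)[OF _ j(1)] DD D(1) by blast
    moreover have "nb V E D' = nb ?V E D'"
      using DD VV edge by (auto simp: nb_def)
    ultimately show "card ?Z \<le> card (nb ?V E D')" using tight by simp
  qed
qed

text \<open>For a separation \<open>(P, Q)\<close> of \<open>V - D\<close> the set
  \<open>D \<union> (Q - P)\<close> contains \<open>B i\<close>, avoids \<open>Z\<close> and has its
  boundary in \<open>P \<inter> Q\<close>, so robustness yields the condition of Menger's
  theorem.\<close>

lemma robust_model_link:
  assumes V: "finite V" "sym E" and Z: "Z \<subseteq> V" and R: "robust_model V E Z I B"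
    and D: "D \<subseteq> V - Z" "i \<in> I" "B i \<subseteq> D" and tight: "card (nb V E D) = card Z"
  shows "\<exists>T. linked (V - D) E Z (nb V E D) T"
proof (rule menger)
  note R = robust_modelD[OF R]
  fix P Q assume s: "separation (V - D) E P Q" and P: "Z \<subseteq> P" and Q: "nb V E D \<subseteq> Q"
  have PQ: "P \<union> Q = V - D" "\<And>u v. u \<in> P - Q \<Longrightarrow> v \<in> Q - P \<Longrightarrow> (u, v) \<notin> E"
    using s by (auto simp: separation_def)
  let ?D = "D \<union> (Q - P)"
  have "nb V E ?D \<subseteq> P \<inter> Q"
  proof
    fix v assume "v \<in> nb V E ?D"
    then obtain u where v: "v \<in> V" "v \<notin> ?D" and u: "u \<in> ?D" "(u, v) \<in> E" by (auto simp: nb_def)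
    have vP: "v \<in> P" using v PQ(1) by blast
    have "v \<in> Q"
    proof (cases "u \<in> D")
      case True
      then show ?thesis using u v Q by (auto simp: nb_def)
    next
      case False
      then have "u \<in> Q - P" using u by blast
      then show ?thesis using PQ(2)[of v u] vP u(2) V(2) by (blast dest: symD)
    qed
    then show "v \<in> P \<inter> Q" using vP by blast
  qed
  moreover have "finite (P \<inter> Q)" using PQ(1) V(1) finite_subset by (metis finite_Diff finite_Int finite_Un)
  ultimately have "card (nb V E ?D) \<le> card (P \<inter> Q)" by (rule card_mono[rotated])
  moreover have "card Z \<le> card (nb V E ?D)"
    using R(6)[of ?D i] D P PQ(1) by blast
  ultimately show "card Z \<le> card (P \<inter> Q)" by simp
qed (use V Z D tight in \<open>auto simp: nb_def\<close>)

text \<open>The linkage moves the roots from \<open>Z'\<close> to \<open>Z\<close>. Its members meet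
  the sets of the model only in \<open>Z'\<close>, where the bijection \<open>g\<close> tells which
  two belong together.\<close>

lemma rooted_clique_model_glue:
  assumes fin: "finite Z'" "finite Z" "card Z = card Z'" and E: "sym E"
    and T1: "linked V1 E Z Z' T1" and T2: "rooted_clique_model V2 E Z' T2" and V: "V1 \<inter> V2 \<subseteq> Z'"
  shows "\<exists>T. rooted_clique_model (V1 \<union> V2) E Z T"
proof -
  obtain g where g: "bij_betw g Z Z'" "\<And>z. z \<in> Z \<Longrightarrow> T1 z \<inter> Z' = {g z}"
    using disjoint_hits_bij[OF fin(1,3,2), of T1] linkedD[OF T1] by blast
  have gZ: "g z \<in> Z'" "g z \<in> T1 z" if "z \<in> Z" for z using g that by blast+
  have gi: "g z \<noteq> g y" if "z \<in> Z" "y \<in> Z" "z \<noteq> y" for z y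
    using g(1) that by (auto simp: bij_betw_def inj_on_def)
  have T2Z: "T2 x \<inter> Z' = {x}" if "x \<in> Z'" for x
  proof -
    have "y = x" if y: "y \<in> T2 x" "y \<in> Z'" for y
      using rooted_clique_modelD(4)[OF T2 \<open>x \<in> Z'\<close> y(2)] rooted_clique_modelD(1)[OF T2 y(2)] y(1)
      by blast
    then show ?thesis using rooted_clique_modelD(1)[OF T2 that] that by blast
  qed
  have d12: "T1 z \<inter> T2 (g y) = {}" if "z \<in> Z" "y \<in> Z" "z \<noteq> y" for z y
  proof -
    have "T1 z \<inter> T2 (g y) \<subseteq> (T1 z \<inter> Z') \<inter> (T2 (g y) \<inter> Z')"
      using linkedD(2)[OF T1 that(1)] rooted_clique_modelD(2)[OF T2 gZ(1)[OF that(2)]] V by blast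
    also have "\<dots> = {}" using g(2)[OF that(1)] T2Z[OF gZ(1)[OF that(2)]] gi[OF that] by simp
    finally show ?thesis by blast
  qed
  have "rooted_clique_model (V1 \<union> V2) E Z (\<lambda>z. T1 z \<union> T2 (g z))"
    unfolding rooted_clique_model_def
  proof (intro conjI ballI impI)
    fix z assume z: "z \<in> Z"
    note a = linkedD[OF T1 z] and b = rooted_clique_modelD[OF T2 gZ(1)[OF z]]
    show "z \<in> T1 z \<union> T2 (g z)" "T1 z \<union> T2 (g z) \<subseteq> V1 \<union> V2" using a b by blast+
    show "conn E (T1 z \<union> T2 (g z))"
      using a(3) b(3) E b(1) gZ(2)[OF z] by (intro conn_Un) blast+
    fix y assume y: "y \<in> Z" "z \<noteq> y"
    show "(T1 z \<union> T2 (g z)) \<inter> (T1 y \<union> T2 (g y)) = {}"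
      using a(5)[OF y] b(4)[OF gZ(1)[OF y(1)] gi[OF z y]] d12[OF z y] d12[of y z] z y by blast
    show "\<exists>u\<in>T1 z \<union> T2 (g z). \<exists>v\<in>T1 y \<union> T2 (g y). (u, v) \<in> E"
      using b(5)[OF gZ(1)[OF y(1)] gi[OF z y]] by blast
  qed
  then show ?thesis by blast
qed

text \<open>Merges \<open>v\<close> into \<open>u\<close>. Arcs at \<open>v\<close> stay and
  \<open>u\<close> may receive a loop: the deletion of \<open>v\<close> is recorded by the vertex
  set \<open>V - {v}\<close> alone.\<close>

definition contract :: "'a \<Rightarrow> 'a \<Rightarrow> 'a rel \<Rightarrow> 'a rel" where
  "contract u v E = E \<union> {(u, y) | y. (v, y) \<in> E} \<union> {(y, u) | y. (y, v) \<in> E}"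

lemma rooted_clique_model_uncontract:
  assumes T: "rooted_clique_model (V - {v}) (contract u v E) Z T"
    and uv: "u \<in> V" "v \<in> V" "u \<noteq> v" "(u, v) \<in> E" and E: "sym E" and Z: "Z \<subseteq> V - {v}"
  shows "\<exists>T. rooted_clique_model V E Z T"
proof -
  define \<pi> where "\<pi> = (\<lambda>x. if x = v then u else x)"
  note T = rooted_clique_modelD[OF T]
  have fib: "conn E {w \<in> V. \<pi> w = x}" if "x \<in> V - {v}" for x
  proof (cases "x = u")
    case True
    then have "{w \<in> V. \<pi> w = x} = insert v {u}" using uv by (auto simp: \<pi>_def)
    then show ?thesis using conn_insert[OF conn_singleton E _ uv(4)] by simp
  next
    case False
    then have "{w \<in> V. \<pi> w = x} = {x}" using that by (auto simp: \<pi>_def)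
    then show ?thesis by (simp add: conn_singleton)
  qed
  have edge: "\<exists>p\<in>V. \<exists>q\<in>V. \<pi> p = x \<and> \<pi> q = y \<and> (p, q) \<in> E"
    if x: "x \<in> V - {v}" and y: "y \<in> V - {v}" and e: "(x, y) \<in> contract u v E" for x y
  proof -
    consider "(x, y) \<in> E" | "x = u" "(v, y) \<in> E" | "y = u" "(x, v) \<in> E"
      using e by (auto simp: contract_def)
    then show ?thesis
    proof cases
      case 1
      then show ?thesis using x y by (intro bexI[of _ x] bexI[of _ y]) (auto simp: \<pi>_def)
    next
      case 2
      then show ?thesis using x y uv by (intro bexI[of _ v] bexI[of _ y]) (auto simp: \<pi>_def)
    next
      case 3
      then show ?thesis using x y uv by (intro bexI[of _ x] bexI[of _ v]) (auto simp: \<pi>_def)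
    qed
  qed
  have "rooted_clique_model V E Z (\<lambda>z. {w \<in> V. \<pi> w \<in> T z})"
    unfolding rooted_clique_model_def
  proof (intro conjI ballI impI)
    fix z assume z: "z \<in> Z"
    show "z \<in> {w \<in> V. \<pi> w \<in> T z}" using T(1)[OF z] z Z by (auto simp: \<pi>_def)
    show "conn E {w \<in> V. \<pi> w \<in> T z}"
      using T(2)[OF z] fib edge by (intro conn_vimage[OF T(3)[OF z]]) blast+
    fix y assume y: "y \<in> Z" "z \<noteq> y"
    show "{w \<in> V. \<pi> w \<in> T z} \<inter> {w \<in> V. \<pi> w \<in> T y} = {}" using T(4)[OF z y] by blast
    obtain p q where "p \<in> T z" "q \<in> T y" "(p, q) \<in> contract u v E" using T(5)[OF z y] by blast
    then obtain p' q' where "p' \<in> V" "q' \<in> V" "\<pi> p' = p" "\<pi> q' = q" "(p', q') \<in> E"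
      using edge[of p q] T(2)[OF z] T(2)[OF y(1)] by blast
    then show "\<exists>u\<in>{w \<in> V. \<pi> w \<in> T z}. \<exists>v\<in>{w \<in> V. \<pi> w \<in> T y}. (u, v) \<in> E"
      using \<open>p \<in> T z\<close> \<open>q \<in> T y\<close> by blast
  qed blast
  then show ?thesis by blast
qed

text \<open>Only the boundary condition is in danger, as merging \<open>u\<close> and
  \<open>v\<close> can shrink a boundary by one. If it fails for \<open>D\<close>, the boundary of
  the expanded set \<open>D'\<close> contains \<open>v\<close> and has exactly \<open>card Z\<close>
  elements. By \<open>nontight\<close> it covers \<open>V\<close> together with \<open>D'\<close>,
  so it contains \<open>Z\<close> and therefore equals \<open>Z\<close>, although \<open>v\<close>
  is not in \<open>Z\<close>.\<close>

lemma robust_model_contract: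
  assumes V: "finite V" and Z: "Z \<subseteq> V" and R: "robust_model V E Z I B"
    and i: "i \<in> I" "B i \<inter> Z = {}" "u \<in> B i" "v \<in> B i" "u \<noteq> v"
    and nontight: "\<And>D j. D \<subseteq> V - Z \<Longrightarrow> j \<in> I \<Longrightarrow> B j \<subseteq> D \<Longrightarrow> card (nb V E D) = card Z \<Longrightarrow>
      D \<union> nb V E D = V"
  shows "robust_model (V - {v}) (contract u v E) Z I (\<lambda>j. B j - {v})"
    (is "robust_model ?V ?E Z I ?B")
proof -
  note R = robust_modelD[OF R]
  have vB: "v \<notin> B j" "u \<notin> B j" if "j \<in> I" "j \<noteq> i" for j
    using R(4)[OF that(1) i(1) that(2)] i by blast+
  have vZ: "v \<notin> Z" "u \<in> V" "v \<in> V" using i R(1)[OF i(1)] by blast+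
  show ?thesis
    unfolding robust_model_def
  proof (intro conjI ballI allI impI)
    fix j assume j: "j \<in> I"
    show "?B j \<subseteq> ?V" using R(1)[OF j] by blast
    show "?B j \<noteq> {}" using R(2)[OF j] vB[OF j] i by (cases "j = i") auto
    fix C assume C: "C \<subseteq> ?B j - Z" "C \<noteq> {}" "C \<noteq> ?B j"
    define C' where "C' = (if j = i \<and> u \<in> C then insert v C else C)"
    have "C' \<subseteq> B j - Z" "C' \<noteq> {}" using C i vZ by (auto simp: C'_def)
    moreover have "C' \<noteq> B j"
    proof
      assume *: "C' = B j"
      show False
      proof (cases "j = i \<and> u \<in> C")
        case True
        then show False using * C by (auto simp: C'_def)
      next
        case False
        then show False using * C i(3) vB[OF j] by (cases "j = i") (auto simp: C'_def)
      qed
    qed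
    ultimately obtain p q where pq: "p \<in> C'" "q \<in> B j - C'" "(p, q) \<in> E"
      using R(3)[OF j] by blast
    show "\<exists>p\<in>C. \<exists>q\<in>?B j - C. (p, q) \<in> ?E"
    proof (cases "j = i")
      case False
      then show ?thesis using pq vB[OF j] by (auto simp: C'_def contract_def)
    next
      case True
      show ?thesis
      proof (cases "u \<in> C")
        case uC: True
        then have q: "q \<in> ?B j - C" using pq True by (auto simp: C'_def)
        show ?thesis
        proof (cases "p = v")
          case True
          then show ?thesis using pq q uC by (auto simp: contract_def)
        next
          case False
          then show ?thesis using pq q by (auto simp: contract_def C'_def split: if_splits)
        qed
      next
        case uC: False
        then have p: "p \<in> C" using pq by (simp add: C'_def)
        show ?thesis
        proof (cases "q = v")
          case True
          then show ?thesis using pq p uC i \<open>j = i\<close> by (auto simp: contract_def)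
        next
          case False
          then show ?thesis using pq p uC by (auto simp: contract_def C'_def)
        qed
      qed
    qed
  next
    fix j l assume j: "j \<in> I" and l: "l \<in> I" "j \<noteq> l"
    show "?B j \<inter> ?B l = {}" using R(4)[OF j l] by blast
    assume "?B j \<inter> Z = {}"
    then have "B j \<inter> Z = {}" using vZ by blast
    then obtain p q where pq: "p \<in> B j" "q \<in> B l" "(p, q) \<in> E" using R(5)[OF j l] by blast
    show "\<exists>u\<in>?B j. \<exists>v\<in>?B l. (u, v) \<in> ?E"
    proof (cases "p = v")
      case True
      then have "j = i" using vB[OF j] pq by blast
      then have "q \<noteq> v" using vB[OF l(1)] pq l by blast
      then show ?thesis using pq True i \<open>j = i\<close>
        by (intro bexI[of _ u] bexI[of _ q]) (auto simp: contract_def)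
    next
      case p: False
      show ?thesis
      proof (cases "q = v")
        case True
        then have "l = i" using vB[OF l(1)] pq by blast
        then show ?thesis using pq True i p
          by (intro bexI[of _ p] bexI[of _ u]) (auto simp: contract_def)
      next
        case False
        then show ?thesis using pq p by (intro bexI[of _ p] bexI[of _ q]) (auto simp: contract_def)
      qed
    qed
  next
    fix D assume D: "D \<subseteq> ?V - Z" "\<exists>j\<in>I. ?B j \<subseteq> D"
    then obtain j where j: "j \<in> I" "?B j \<subseteq> D" by blast
    define D' where "D' = (if u \<in> D then insert v D else D)"
    have D'V: "D' \<subseteq> V - Z" using D vZ by (auto simp: D'_def)
    have BD': "B j \<subseteq> D'"
    proof (cases "j = i")
      case True
      then have "u \<in> D" using i j by blast
      then show ?thesis using j by (auto simp: D'_def)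
    next
      case False
      then show ?thesis using vB[OF j(1)] j by (auto simp: D'_def)
    qed
    let ?N = "nb V E D'" and ?N' = "nb ?V ?E D"
    have sub: "?N \<subseteq> insert v ?N'"
    proof
      fix w assume "w \<in> ?N"
      then obtain p where w: "w \<in> V" "w \<notin> D'" "p \<in> D'" "(p, w) \<in> E" by (auto simp: nb_def)
      show "w \<in> insert v ?N'"
      proof (cases "p \<in> D")
        case True
        then show ?thesis using w by (auto simp: nb_def D'_def contract_def split: if_splits)
      next
        case False
        then have "p = v" "u \<in> D" using w by (auto simp: D'_def split: if_splits)
        then show ?thesis using w by (auto simp: nb_def D'_def contract_def split: if_splits)
      qed
    qed
    have finN: "finite ?N" "finite ?N'" using V by (simp_all add: nb_def)
    have ge: "card Z \<le> card ?N" by (rule R(6)[OF D'V j(1) BD'])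
    show "card Z \<le> card ?N'"
    proof (rule ccontr)
      assume lt: "\<not> ?thesis"
      have "v \<in> ?N"
      proof (rule ccontr)
        assume "v \<notin> ?N"
        then have "card ?N \<le> card ?N'" using sub finN by (intro card_mono) auto
        then show False using ge lt by simp
      qed
      have "card ?N \<le> card (insert v ?N')" using sub finN by (intro card_mono) auto
      also have "\<dots> \<le> Suc (card ?N')" using finN by (simp add: card_insert_if)
      finally have eq: "card ?N = card Z" using ge lt by simp
      then have "D' \<union> ?N = V" using nontight[OF D'V j(1) BD'] by blast
      then have "Z \<subseteq> ?N" using Z D'V by blast
      then have "Z = ?N" using finN eq by (simp add: card_subset_eq)
      then show False using \<open>v \<in> ?N\<close> vZ by blast
    qed
  qed
qed

text \<open>Induction on the number of vertices. A tight set that does not fill the graph together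
  with its boundary is cut off; the model in it is rooted at the boundary, and the roots are moved
  to \<open>Z\<close>. If there is none, edges inside branch sets that avoid \<open>Z\<close> can be
  contracted. In the end all these branch sets are single vertices. Since at most
  \<open>card Z\<close> branch sets meet \<open>Z\<close>, at least \<open>card Z\<close> of them
  remain, and they form a clique to which \<open>Z\<close> is linked by Menger's theorem.\<close>

lemma robust_model_imp_rooted_clique_model:
  assumes "finite V" "sym E" "Z \<subseteq> V" "finite I" "2 * card Z \<le> card I" "robust_model V E Z I B"
  shows "\<exists>T. rooted_clique_model V E Z T"
  using assms
proof (induction "card V" arbitrary: V E Z B rule: less_induct)
  case (less V E Z B)
  note R = robust_modelD[OF less.prems(6)]
  have finZ: "finite Z" using less.prems finite_subset by blast
  show ?case
  proof (cases "\<exists>D i. D \<subseteq> V - Z \<and> i \<in> I \<and> B i \<subseteq> D \<and> card (nb V E D) = card Z \<and> D \<union> nb V E D \<noteq> V")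
    case True
    then obtain D i where D: "D \<subseteq> V - Z" "i \<in> I" "B i \<subseteq> D" "card (nb V E D) = card Z"
      "D \<union> nb V E D \<noteq> V" by blast
    let ?Z = "nb V E D" and ?V = "D \<union> nb V E D"
    have VV: "?V \<subseteq> V" using D by (auto simp: nb_def)
    then have "card ?V < card V" using D(5) less.prems(1) by (intro psubset_card_mono) auto
    moreover have "finite ?V" using VV less.prems(1) finite_subset by blast
    ultimately obtain T2 where T2: "rooted_clique_model ?V E ?Z T2"
      using less.hyps[OF _ _ less.prems(2) _ less.prems(4), of ?V ?Z]
        robust_model_cut[OF less.prems(1,2,3,6) D(1-4)] D(4) less.prems(5) by auto
    obtain T1 where T1: "linked (V - D) E Z ?Z T1"
      using robust_model_link[OF less.prems(1,2,3,6) D(1-4)] by blast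
    have "(V - D) \<union> ?V = V" using VV by blast
    moreover have "(V - D) \<inter> ?V \<subseteq> ?Z" by blast
    ultimately show ?thesis
      using rooted_clique_model_glue[OF finite_nb[OF less.prems(1)] finZ D(4)[symmetric] less.prems(2) T1 T2]
      by simp
  next
    case False
    then have nontight: "\<And>D j. D \<subseteq> V - Z \<Longrightarrow> j \<in> I \<Longrightarrow> B j \<subseteq> D \<Longrightarrow> card (nb V E D) = card Z \<Longrightarrow>
      D \<union> nb V E D = V" by blast
    show ?thesis
    proof (cases "\<exists>i\<in>I. B i \<inter> Z = {} \<and> (\<nexists>x. B i = {x})")
      case True
      then obtain i where i: "i \<in> I" "B i \<inter> Z = {}" "\<nexists>x. B i = {x}" by blast
      obtain u where u: "u \<in> B i" using R(2)[OF i(1)] by blast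
      have "{u} \<subseteq> B i - Z" "{u} \<noteq> B i" using u i(2,3) by auto
      then have "\<exists>u'\<in>{u}. \<exists>v\<in>B i - {u}. (u', v) \<in> E"
        by (intro R(3)[OF i(1)]) auto
      then obtain v where v: "v \<in> B i" "v \<noteq> u" "(u, v) \<in> E" by auto
      note R' = robust_model_contract[OF less.prems(1,3,6) i(1,2) u v(1) v(2)[symmetric] nontight]
      have vV: "v \<in> V" "u \<in> V" "v \<notin> Z" using v(1) u i(2) R(1)[OF i(1)] by auto
      have lt: "card (V - {v}) < card V" using vV(1) less.prems(1) by (meson card_Diff1_less)
      have sy: "sym (contract u v E)"
        using less.prems(2) by (auto simp: contract_def sym_def)
      have ZV: "Z \<subseteq> V - {v}" using less.prems(3) vV(3) by blast
      have "\<exists>T. rooted_clique_model (V - {v}) (contract u v E) Z T"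
        by (rule less.hyps[OF lt _ sy ZV less.prems(4,5) R']) (rule finite_Diff[OF less.prems(1)])
      then obtain T where T: "rooted_clique_model (V - {v}) (contract u v E) Z T" by (rule exE)
      show ?thesis
        by (rule rooted_clique_model_uncontract[OF T vV(2,1) v(2)[symmetric] v(3) less.prems(2) ZV])
    next
      case singletons: False
      define J where "J = {i \<in> I. B i \<inter> Z = {}}"
      have "\<forall>i\<in>I - J. \<exists>z. z \<in> B i \<inter> Z" by (auto simp: J_def)
      then obtain w where w: "\<And>i. i \<in> I - J \<Longrightarrow> w i \<in> B i \<inter> Z" by metis
      have "inj_on w (I - J)"
      proof (rule inj_onI, rule ccontr)
        fix i j assume "i \<in> I - J" "j \<in> I - J" "w i = w j" "i \<noteq> j"
        then show False using w[of i] w[of j] R(4)[of i j] by auto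
      qed
      then have "card (I - J) \<le> card Z"
        using w finZ by (intro card_inj_on_le[of w]) auto
      moreover have "card I = card J + card (I - J)"
        using less.prems(4) by (simp add: J_def card_Diff_subset card_mono)
      ultimately have "card Z \<le> card J" using less.prems(5) by simp
      then obtain J' where J': "J' \<subseteq> J" "card J' = card Z" "finite J'"
        by (meson obtain_subset_with_card_n)
      have "\<forall>i\<in>J'. \<exists>x. B i = {x}" using singletons J' by (auto simp: J_def)
      then obtain b where b: "\<And>i. i \<in> J' \<Longrightarrow> B i = {b i}" by metis
      have JI: "i \<in> I" "B i \<inter> Z = {}" if "i \<in> J'" for i using that J' by (auto simp: J_def)
      have inj: "inj_on b J'"
      proof (rule inj_onI, rule ccontr)
        fix i j assume "i \<in> J'" "j \<in> J'" "b i = b j" "i \<noteq> j"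
        then show False using b[of i] b[of j] R(4)[OF JI(1) JI(1), of i j] by auto
      qed
      let ?B = "b ` J'"
      have cB: "card ?B = card Z" using inj J' by (simp add: card_image)
      have BV: "?B \<subseteq> V" using R(1)[OF JI(1)] b by blast
      have "\<exists>T. linked V E Z ?B T"
      proof (rule menger[OF less.prems(1,2,3) BV cB[symmetric]])
        fix P Q assume s: "separation V E P Q" and P: "Z \<subseteq> P" and Q: "?B \<subseteq> Q"
        have PQ: "P \<union> Q = V" "\<And>u v. u \<in> P - Q \<Longrightarrow> v \<in> Q - P \<Longrightarrow> (u, v) \<notin> E"
          using s by (auto simp: separation_def)
        have finPQ: "finite (P \<inter> Q)" using PQ(1) less.prems(1) by (metis finite_Int finite_Un)
        \<comment> \<open>If some clique vertex \<open>b i\<close> lies in \<open>Q - P\<close>,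
          robustness is applied to \<open>Q - P\<close>, whose boundary lies in
          \<open>P \<inter> Q\<close>; otherwise \<open>P \<inter> Q\<close> contains all of
          \<open>?B\<close>.\<close>
        show "card Z \<le> card (P \<inter> Q)"
        proof (cases "?B \<subseteq> P")
          case True
          then show ?thesis using card_mono[OF finPQ, of ?B] Q cB by simp
        next
          case False
          then obtain i where i: "i \<in> J'" "b i \<in> Q - P" using Q by blast
          have "nb V E (Q - P) \<subseteq> P \<inter> Q"
          proof
            fix v assume "v \<in> nb V E (Q - P)"
            then obtain u where "v \<in> V" "v \<notin> Q - P" "u \<in> Q - P" "(u, v) \<in> E" by (auto simp: nb_def)
            then show "v \<in> P \<inter> Q" using PQ(2)[of v u] PQ(1) less.prems(2) by (blast dest: symD)
          qed
          then have "card (nb V E (Q - P)) \<le> card (P \<inter> Q)" by (rule card_mono[OF finPQ])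
          moreover have "card Z \<le> card (nb V E (Q - P))"
          proof (rule R(6))
            show "Q - P \<subseteq> V - Z" using P PQ(1) by blast
            show "i \<in> I" by (rule JI(1)[OF i(1)])
            show "B i \<subseteq> Q - P" using b[OF i(1)] i(2) by simp
          qed
          ultimately show ?thesis by simp
        qed
      qed
      then obtain T where T: "linked V E Z ?B T" by blast
      note T = linkedD[OF T]
      obtain g where g: "bij_betw g Z ?B" "\<And>z. z \<in> Z \<Longrightarrow> T z \<inter> ?B = {g z}"
        using disjoint_hits_bij[of ?B Z T] T finZ cB J' by (metis finite_imageI)
      have "rooted_clique_model V E Z T"
        unfolding rooted_clique_model_def
      proof (intro conjI ballI impI)
        fix z assume z: "z \<in> Z"
        show "z \<in> T z" "T z \<subseteq> V" "conn E (T z)" by (rule T(1-3)[OF z])+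
        fix y assume y: "y \<in> Z" "z \<noteq> y"
        show "T z \<inter> T y = {}" by (rule T(5)[OF z y])
        have gz: "g z \<in> T z" "g y \<in> T y" "g z \<in> ?B" "g y \<in> ?B" using g(2) z y by blast+
        have "g z \<noteq> g y" using g(1) z y by (auto simp: bij_betw_def inj_on_def)
        moreover obtain i j where ij: "i \<in> J'" "j \<in> J'" "g z = b i" "g y = b j"
          using gz(3,4) by auto
        ultimately have "i \<noteq> j" by auto
        then have "(b i, b j) \<in> E"
          using R(5)[OF JI(1)[OF ij(1)] JI(1)[OF ij(2)] _ JI(2)[OF ij(1)]]
            b[OF ij(1)] b[OF ij(2)] by simp
        then show "\<exists>u\<in>T z. \<exists>v\<in>T y. (u, v) \<in> E" using gz(1,2) ij(3,4) by metis
      qed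
      then show ?thesis by blast
    qed
  qed
qed

section \<open>Choosing the branch vertices\<close>

definition degree_le :: "'a set \<Rightarrow> 'a rel \<Rightarrow> nat \<Rightarrow> bool" where
  "degree_le V E k \<longleftrightarrow> (\<forall>v\<in>V. card {w \<in> V. (v, w) \<in> E} \<le> k)"

text \<open>In terms of the tangle induced by the model, \<open>K\<close> is the small side of a
  separation of order at most \<open>k\<close>. A single branch set is enough as a witness: by
  \<open>branch_set_avoids_small_side\<close>, every branch set that misses the boundary then misses
  \<open>K\<close>.\<close>

definition small_side :: "'a set \<Rightarrow> 'a rel \<Rightarrow> nat \<Rightarrow> (nat \<Rightarrow> 'a set) \<Rightarrow> nat \<Rightarrow> 'a set \<Rightarrow> bool" where
  "small_side V E t B k K \<longleftrightarrow> K \<subseteq> V \<and> card (nb V E K) \<le> k \<and>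
     (\<exists>j<t. B j \<inter> (K \<union> nb V E K) = {})"

lemma nb_Un_subset: "nb V E (K \<union> L) \<subseteq> nb V E K \<union> nb V E L"
  by (auto simp: nb_def)

text \<open>The union of the two sets on the left is contained in the union of those on the right,
  and likewise for the intersections.\<close>

lemma nb_submodular:
  assumes "finite V"
  shows "card (nb V E (K \<inter> L)) + card (nb V E (K \<union> L)) \<le> card (nb V E K) + card (nb V E L)"
proof -
  let ?i = "nb V E (K \<inter> L)" and ?u = "nb V E (K \<union> L)"
  have "card ?i + card ?u = card (?i \<union> ?u) + card (?i \<inter> ?u)"
    by (intro card_Un_Int finite_nb assms)
  also have "\<dots> \<le> card (nb V E K \<union> nb V E L) + card (nb V E K \<inter> nb V E L)"
    by (intro add_mono card_mono finite_UnI finite_Int disjI1 finite_nb assms) (auto simp: nb_def)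
  also have "\<dots> = card (nb V E K) + card (nb V E L)"
    by (intro card_Un_Int[symmetric] finite_nb assms)
  finally show ?thesis .
qed

text \<open>A walk from \<open>x\<close> changes its membership in \<open>C\<close> on some arc, in
  one direction or the other; symmetry reverses the arc if necessary. For \<open>x\<close> outside
  \<open>R\<close> the set is \<open>{x}\<close>.\<close>

lemma conn_reachable:
  assumes "sym E"
  shows "conn E {y. (x, y) \<in> (E \<inter> R \<times> R)\<^sup>*}" (is "conn E ?S")
  unfolding conn_def
proof (intro conjI allI impI)
  show "?S \<noteq> {}" by auto
  fix C assume C: "C \<subseteq> ?S" "C \<noteq> {} \<and> C \<noteq> ?S"
  have cross: "\<exists>p q. p \<in> ?S \<and> q \<in> ?S \<and> (p, q) \<in> E \<and> Q p \<and> \<not> Q q"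
    if y: "(x, y) \<in> (E \<inter> R \<times> R)\<^sup>*" and Q: "Q x" "\<not> Q y" for y Q
    using y Q(2)
  proof (induction rule: rtrancl_induct)
    case base
    then show ?case using Q(1) by simp
  next
    case (step p q)
    then show ?case
    proof (cases "Q p")
      case True
      then show ?thesis using step by (auto intro: rtrancl_into_rtrancl)
    qed blast
  qed
  show "\<exists>u\<in>C. \<exists>v\<in>?S - C. (u, v) \<in> E"
  proof (cases "x \<in> C")
    case True
    obtain y where "y \<in> ?S" "y \<notin> C" using C by blast
    then show ?thesis using cross[of y "\<lambda>z. z \<in> C"] True by auto
  next
    case False
    obtain y where "y \<in> C" "y \<in> ?S" using C by blast
    then obtain p q where "p \<in> ?S" "q \<in> ?S" "(p, q) \<in> E" "p \<notin> C" "q \<in> C"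
      using cross[of y "\<lambda>z. z \<notin> C"] False by auto
    then show ?thesis using assms by (blast dest: symD)
  qed
qed

text \<open>Greedy choice: every chosen element excludes itself and at most \<open>b\<close>
  others.\<close>

lemma independent_selection:
  assumes "finite I" "\<And>i j. R i j \<Longrightarrow> R j i" "\<And>i. i \<in> I \<Longrightarrow> card {j \<in> I. R i j} \<le> b"
    and "h * Suc b \<le> card I"
  shows "\<exists>P\<subseteq>I. card P = h \<and> (\<forall>i\<in>P. \<forall>j\<in>P. i \<noteq> j \<longrightarrow> \<not> R i j)"
  using assms(1,3,4)
proof (induction h arbitrary: I)
  case 0
  then show ?case by (intro exI[of _ "{}"]) auto
next
  case (Suc h)
  then have "I \<noteq> {}" by auto
  then obtain i where i: "i \<in> I" by blast
  let ?X = "insert i {j \<in> I. R i j}"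
  have "card ?X \<le> Suc b"
    using Suc.prems(1) Suc.prems(2)[OF i] by (simp add: card_insert_if)
  moreover have "card I - card ?X \<le> card (I - ?X)" by (rule diff_card_le_card_Diff) (use Suc.prems in simp)
  ultimately have "h * Suc b \<le> card (I - ?X)" using Suc.prems(3) by simp
  moreover have "card {j \<in> I - ?X. R l j} \<le> b" if "l \<in> I - ?X" for l
    using Suc.prems(2)[of l] that card_mono[of "{j \<in> I. R l j}" "{j \<in> I - ?X. R l j}"] Suc.prems(1)
    by fastforce
  ultimately obtain P where P: "P \<subseteq> I - ?X" "card P = h" "\<forall>i\<in>P. \<forall>j\<in>P. i \<noteq> j \<longrightarrow> \<not> R i j"
    using Suc.IH[of "I - ?X"] Suc.prems(1) by blast
  have "finite P" "i \<notin> P" using P(1) Suc.prems(1) finite_subset by blast+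
  then have "card (insert i P) = Suc h" using P(2) by simp
  moreover have "\<not> R i j \<and> \<not> R j i" if "j \<in> P" for j using P(1) that assms(2) by blast
  ultimately show ?case using P i by (intro exI[of _ "insert i P"]) auto
qed

text \<open>Connectedness of \<open>K\<close> keeps this relation sparse: without it, any two
  vertices with few neighbours could be close, however far apart they are.\<close>

definition close :: "'a set \<Rightarrow> 'a rel \<Rightarrow> nat \<Rightarrow> (nat \<Rightarrow> 'a set) \<Rightarrow> nat \<Rightarrow> 'a \<Rightarrow> 'a \<Rightarrow> bool" where
  "close V E t B k p q \<longleftrightarrow> (\<exists>K. conn E K \<and> p \<in> K \<and> q \<in> K \<and> small_side V E t B k K)"

section \<open>Small sides of a clique model\<close>

context
  fixes V :: "'a set" and E :: "'a rel" and t :: nat and B :: "nat \<Rightarrow> 'a set"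
  assumes G: "simple_graph V E" and B: "clique_model V E t B"
begin

lemma clique_modelD:
  "\<And>i. i < t \<Longrightarrow> B i \<subseteq> V" "\<And>i. i < t \<Longrightarrow> conn E (B i)"
  "\<And>i j. i < t \<Longrightarrow> j < t \<Longrightarrow> i \<noteq> j \<Longrightarrow> B i \<inter> B j = {}"
  "\<And>i j. i < t \<Longrightarrow> j < t \<Longrightarrow> i \<noteq> j \<Longrightarrow> \<exists>u\<in>B i. \<exists>v\<in>B j. (u, v) \<in> E"
  using B by (auto simp: clique_model_def)

lemma finV: "finite V" and symE: "sym E"
  using simple_graphD[OF G] by auto

text \<open>A connected set that misses the boundary of \<open>K\<close> lies inside or outside
  \<open>K\<close>. Inside is impossible, since \<open>B j\<close> would be adjacent to
  \<open>B j0\<close>, which misses both \<open>K\<close> and its boundary.\<close>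

lemma branch_set_avoids_small_side:
  assumes "j0 < t" "B j0 \<inter> (K \<union> nb V E K) = {}" "j < t" "B j \<inter> nb V E K = {}"
  shows "B j \<inter> K = {}"
proof (rule ccontr)
  assume ne: "B j \<inter> K \<noteq> {}"
  have "B j \<subseteq> K"
  proof (rule ccontr)
    assume nsub: "\<not> B j \<subseteq> K"
    obtain u v where "u \<in> B j \<inter> K" "v \<in> B j - B j \<inter> K" "(u, v) \<in> E"
      by (rule connE[OF clique_modelD(2)[OF assms(3)], of "B j \<inter> K"]) (use ne nsub in auto)
    then have "v \<in> B j \<inter> nb V E K" using clique_modelD(1)[OF assms(3)] by (auto simp: nb_def)
    then show False using assms(4) by blast
  qed
  moreover have "j \<noteq> j0" using ne assms(2) by blast
  ultimately obtain u v where "u \<in> K" "v \<in> B j0" "(u, v) \<in> E"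
    using clique_modelD(4)[OF assms(3,1)] by blast
  then have "v \<in> K \<union> nb V E K" using clique_modelD(1)[OF assms(1)] by (auto simp: nb_def)
  then show False using assms(2) \<open>v \<in> B j0\<close> by blast
qed

lemma card_hit_branch_sets:
  assumes "finite S"
  shows "card {j. j < t \<and> B j \<inter> S \<noteq> {}} \<le> card S"
proof -
  let ?J = "{j. j < t \<and> B j \<inter> S \<noteq> {}}"
  have "\<forall>j\<in>?J. \<exists>s. s \<in> B j \<inter> S" by blast
  from bchoice[OF this] obtain s where s: "\<And>j. j \<in> ?J \<Longrightarrow> s j \<in> B j \<inter> S" by blast
  have "inj_on s ?J"
  proof (rule inj_onI, rule ccontr)
    fix i j assume "i \<in> ?J" "j \<in> ?J" "s i = s j" "i \<noteq> j"
    then show False using s[of i] s[of j] clique_modelD(3)[of i j] by auto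
  qed
  moreover have "s ` ?J \<subseteq> S" using s by blast
  ultimately show ?thesis by (rule card_inj_on_le) (rule assms)
qed

text \<open>Fewer than \<open>t\<close> branch sets are hit by the two boundaries and
  \<open>S\<close>; any other one also avoids \<open>K\<close> and \<open>L\<close>
  themselves.\<close>

lemma branch_set_avoiding_small_sides:
  assumes K: "small_side V E t B k K" and L: "small_side V E t B l L"
    and S: "finite S" "k + l + card S < t"
  obtains j where "j < t" "B j \<inter> (K \<union> nb V E K \<union> L \<union> nb V E L \<union> S) = {}"
proof -
  let ?X = "nb V E K \<union> nb V E L \<union> S"
  have fin: "finite ?X" using S finV by (simp add: finite_nb)
  have "card ?X \<le> card (nb V E K) + card (nb V E L) + card S"
    using card_Un_le[of "nb V E K \<union> nb V E L" S] card_Un_le[of "nb V E K" "nb V E L"] by linarith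
  also have "\<dots> < t" using K L S by (auto simp: small_side_def)
  finally have "card {j. j < t \<and> B j \<inter> ?X \<noteq> {}} < t" using card_hit_branch_sets[OF fin] by simp
  then have "{j. j < t \<and> B j \<inter> ?X \<noteq> {}} \<noteq> {..<t}" by (metis card_lessThan less_irrefl)
  then obtain j where j: "j < t" "B j \<inter> ?X = {}" by blast
  have avoid: "B j \<inter> M = {}" if M: "small_side V E t B m M" and "B j \<inter> nb V E M = {}" for m M
  proof -
    obtain i where "i < t" "B i \<inter> (M \<union> nb V E M) = {}" using M by (auto simp: small_side_def)
    then show ?thesis using branch_set_avoids_small_side[OF _ _ j(1)] that(2) by blast
  qed
  have "B j \<inter> K = {}" "B j \<inter> L = {}"
    using avoid[OF K] avoid[OF L] j(2) by blast+
  then show ?thesis using that[of j] j by blast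
qed

lemma small_side_Un:
  assumes "small_side V E t B k K" "small_side V E t B k L" "2 * k < t"
    and "card (nb V E (K \<union> L)) \<le> k"
  shows "small_side V E t B k (K \<union> L)"
proof -
  obtain j where "j < t" "B j \<inter> (K \<union> nb V E K \<union> L \<union> nb V E L \<union> {}) = {}"
    using branch_set_avoiding_small_sides[OF assms(1,2), of "{}"] assms(3) by auto
  then have "B j \<inter> (K \<union> L \<union> nb V E (K \<union> L)) = {}" using nb_Un_subset[of V E K L] by blast
  then show ?thesis using assms \<open>j < t\<close> by (auto simp: small_side_def)
qed

context
  fixes x :: "nat \<Rightarrow> 'a"
  assumes x: "\<And>i. i < t \<Longrightarrow> x i \<in> B i"
begin

text \<open>A branch set with its representative in \<open>K\<close> must meet the boundary of
  \<open>K\<close>, and disjoint branch sets meet it in different vertices.\<close>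

lemma card_representatives_small_side:
  assumes "small_side V E t B k K"
  shows "card {i. i < t \<and> x i \<in> K} \<le> k"
proof -
  obtain j where j: "j < t" "B j \<inter> (K \<union> nb V E K) = {}" using assms by (auto simp: small_side_def)
  have "B i \<inter> nb V E K \<noteq> {}" if "i < t" "x i \<in> K" for i
    using branch_set_avoids_small_side[OF j that(1)] x[OF that(1)] that(2) by blast
  then have "{i. i < t \<and> x i \<in> K} \<subseteq> {j. j < t \<and> B j \<inter> nb V E K \<noteq> {}}" by blast
  then have "card {i. i < t \<and> x i \<in> K} \<le> card {j. j < t \<and> B j \<inter> nb V E K \<noteq> {}}"
    by (intro card_mono) auto
  also have "\<dots> \<le> card (nb V E K)" by (intro card_hit_branch_sets finite_nb finV)
  finally show ?thesis using assms by (simp add: small_side_def)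
qed

text \<open>By submodularity there is a largest set \<open>K0\<close> of minimum boundary containing \<open>C\<close>. A connected
  set meeting \<open>C\<close> either stays inside \<open>K0\<close> or contains one of the few boundary vertices of \<open>K0\<close>;
  adding that vertex to \<open>K0\<close> increases the minimum boundary.\<close>

lemma card_close_representatives:
  assumes k: "2 * k < t"
    and m: "\<And>K. small_side V E t B k K \<Longrightarrow> C \<subseteq> K \<Longrightarrow> k < card (nb V E K) + m"
  shows "card {i. i < t \<and> (\<exists>K. conn E K \<and> K \<inter> C \<noteq> {} \<and> x i \<in> K \<and> small_side V E t B k (C \<union> K))}
    < Suc k ^ Suc m"
    (is "card (?cl C) < _")
  using m
proof (induction m arbitrary: C)
  case 0
  have "\<not> small_side V E t B k (C \<union> K)" for K
    using "0.prems"[of "C \<union> K"] by (auto simp: small_side_def)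
  then show ?case by simp
next
  case (Suc m C)
  let ?S = "\<lambda>K. small_side V E t B k K \<and> C \<subseteq> K"
  show ?case
  proof (cases "\<exists>K. ?S K")
    case False
    then have "\<not> small_side V E t B k (C \<union> K)" for K by (meson Un_upper1)
    then show ?thesis by simp
  next
    case True
    define l where "l = (LEAST l. \<exists>K. ?S K \<and> card (nb V E K) = l)"
    have ex: "\<exists>K. ?S K \<and> card (nb V E K) = l"
      unfolding l_def by (rule LeastI_ex) (use True in blast)
    have min: "l \<le> card (nb V E K)" if "?S K" for K
      unfolding l_def by (rule Least_le) (use that in blast)
    obtain K1 where K1: "?S K1 \<and> card (nb V E K1) = l" using ex ..
    have bd: "\<forall>K. ?S K \<and> card (nb V E K) = l \<longrightarrow> card K < Suc (card V)"
      using card_mono[OF finV] by (auto simp: small_side_def less_Suc_eq_le)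
    obtain K0 where K0': "?S K0 \<and> card (nb V E K0) = l"
      and max': "\<forall>K. ?S K \<and> card (nb V E K) = l \<longrightarrow> card K \<le> card K0"
      using ex_has_greatest_nat[OF K1 bd] by (elim exE conjE) (rule that, simp_all)
    have K0: "?S K0" "card (nb V E K0) = l" using K0' by simp_all
    have max: "card K \<le> card K0" if "?S K" "card (nb V E K) = l" for K
      using max' that by simp
    let ?N = "nb V E K0"
    have sub: "?cl C \<subseteq> {i. i < t \<and> x i \<in> K0} \<union> (\<Union>z\<in>?N. ?cl (insert z K0))"
    proof
      fix i assume "i \<in> ?cl C"
      then obtain K where K: "i < t" "conn E K" "K \<inter> C \<noteq> {}" "x i \<in> K"
        "small_side V E t B k (C \<union> K)" by blast
      show "i \<in> {i. i < t \<and> x i \<in> K0} \<union> (\<Union>z\<in>?N. ?cl (insert z K0))"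
      proof (cases "K \<subseteq> K0")
        case True
        then show ?thesis using K by blast
      next
        case False
        let ?L = "C \<union> K"
        obtain j where j: "j < t" "B j \<inter> (K0 \<union> ?N) = {}" using K0 by (auto simp: small_side_def)
        \<comment> \<open>\<open>?L \<inter> K0\<close> contains \<open>C\<close> and lies with its
          boundary in \<open>K0 \<union> ?N\<close>, so a boundary below \<open>l\<close> would
          contradict the choice of \<open>l\<close>. Submodularity turns this into a boundary of at
          most \<open>k\<close> for \<open>?L \<union> K0\<close>.\<close>
        have "l \<le> card (nb V E (?L \<inter> K0))"
        proof (rule ccontr)
          assume lt: "\<not> ?thesis"
          have "?L \<inter> K0 \<union> nb V E (?L \<inter> K0) \<subseteq> K0 \<union> ?N" by (auto simp: nb_def)
          then have "B j \<inter> (?L \<inter> K0 \<union> nb V E (?L \<inter> K0)) = {}" using j by blast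
          moreover have "l \<le> k" using K0 by (auto simp: small_side_def)
          ultimately have "?S (?L \<inter> K0)"
            using lt j(1) K0 by (auto simp: small_side_def)
          then show False using min lt by blast
        qed
        then have "card (nb V E (?L \<union> K0)) \<le> k"
          using nb_submodular[OF finV, of E ?L K0] K0(2) K(5) by (simp add: small_side_def)
        moreover have "?L \<union> K0 = K0 \<union> K" using K0 by blast
        ultimately have sm: "small_side V E t B k (K0 \<union> K)"
          using small_side_Un[OF K(5) conjunct1[OF K0(1)] k] by simp
        have "K \<inter> K0 \<noteq> {}" "K \<inter> K0 \<noteq> K" using K(3) K0 False by blast+
        then obtain u z where "u \<in> K \<inter> K0" "z \<in> K - K \<inter> K0" "(u, z) \<in> E"
          using connE[OF K(2) Int_lower1] by metis
        then have z: "z \<in> ?N" "z \<in> K" using sm by (auto simp: nb_def small_side_def)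
        then have "insert z K0 \<union> K = K0 \<union> K" by blast
        then have "i \<in> ?cl (insert z K0)" using K sm z(2) by auto
        then show ?thesis using z(1) by blast
      qed
    qed
    \<comment> \<open>A small side containing \<open>insert z K0\<close> is larger than
      \<open>K0\<close>, so by the choice of \<open>K0\<close> its boundary exceeds
      \<open>l\<close>; the budget \<open>m\<close> drops by one.\<close>
    have bound: "card (?cl (insert z K0)) \<le> Suc k ^ Suc m - 1" if z: "z \<in> ?N" for z
    proof -
      have "k < card (nb V E K) + m" if K: "small_side V E t B k K" "insert z K0 \<subseteq> K" for K
      proof -
        have SK: "?S K" using K K0 by blast
        have "z \<notin> K0" using z by (simp add: nb_def)
        moreover have "finite K" using K finV finite_subset by (auto simp: small_side_def)
        ultimately have "card K0 < card K" using K(2) by (intro psubset_card_mono) auto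
        then have "card (nb V E K) \<noteq> l" using max[OF SK] by auto
        then have "l < card (nb V E K)" using min[OF SK] by simp
        then show ?thesis using Suc.prems[of K0] K0 by simp
      qed
      then show ?thesis using Suc.IH[of "insert z K0"] by simp
    qed
    \<comment> \<open>At most \<open>k\<close> representatives lie in \<open>K0\<close>, and each of
      at most \<open>k\<close> boundary vertices contributes at most
      \<open>Suc k ^ Suc m - 1\<close>. The strictness of the inductive bound absorbs the first
      \<open>k\<close>.\<close>
    have "card (?cl C) \<le> card ({i. i < t \<and> x i \<in> K0} \<union> (\<Union>z\<in>?N. ?cl (insert z K0)))"
      using finite_nb[OF finV] by (intro card_mono sub) auto
    also have "\<dots> \<le> card {i. i < t \<and> x i \<in> K0} + card (\<Union>z\<in>?N. ?cl (insert z K0))"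
      by (rule card_Un_le)
    also have "\<dots> \<le> k + (\<Sum>z\<in>?N. card (?cl (insert z K0)))"
      using card_representatives_small_side K0 by (intro add_mono card_UN_le finite_nb finV) blast
    also have "\<dots> \<le> k + (\<Sum>z\<in>?N. Suc k ^ Suc m - 1)"
      by (intro add_left_mono sum_mono bound)
    also have "\<dots> \<le> k + k * (Suc k ^ Suc m - 1)"
      using K0 by (simp add: small_side_def)
    also have "\<dots> = k * Suc k ^ Suc m"
      by (simp add: diff_mult_distrib2 del: power_Suc)
    also have "\<dots> < Suc k ^ Suc (Suc m)" by simp
    finally show ?thesis .
  qed
qed

text \<open>For \<open>m = Suc k\<close> the budget condition of
  \<open>card_close_representatives\<close> holds trivially, hence the exponent
  \<open>k + 2\<close>.\<close>

lemma card_close: "2 * k < t \<Longrightarrow> card {j \<in> {..<t}. close V E t B k (x i) (x j)} \<le> Suc k ^ (k + 2)"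
proof -
  assume k: "2 * k < t"
  have "{j \<in> {..<t}. close V E t B k (x i) (x j)} =
    {j. j < t \<and> (\<exists>K. conn E K \<and> K \<inter> {x i} \<noteq> {} \<and> x j \<in> K \<and> small_side V E t B k ({x i} \<union> K))}"
    by (auto simp: close_def insert_absorb)
  then show ?thesis
    using card_close_representatives[OF k, of "{x i}" "Suc k"] by simp
qed

end

end

text \<open>This is where bounded degree enters: besides the two old boundaries, only the at most
  \<open>\<Delta>\<close> neighbours of \<open>z\<close> count. It explains the level
  \<open>2 * (d * h) + \<Delta>\<close> at which branch vertices must not be close.\<close>

lemma join_small_sides:
  assumes G: "simple_graph V E" and B: "clique_model V E t B" and deg: "degree_le V E \<Delta>"
    and K: "conn E K" "small_side V E t B k K" and L: "conn E L" "small_side V E t B k L"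
    and z: "z \<in> nb V E K" "z \<in> nb V E L" and t: "2 * k + \<Delta> + 1 < t"
  shows "conn E (insert z (K \<union> L))" "small_side V E t B (2 * k + \<Delta>) (insert z (K \<union> L))"
proof -
  note G' = simple_graphD[OF G]
  obtain u v where uv: "u \<in> K" "(u, z) \<in> E" "v \<in> L" "(v, z) \<in> E" "z \<in> V"
    using z by (auto simp: nb_def)
  have "conn E (insert z K)" by (rule conn_insert[OF K(1) G'(3) uv(1,2)])
  then have "conn E (insert z K \<union> L)"
    by (rule conn_Un[OF _ L(1) G'(3)]) (use uv G'(3) in \<open>blast dest: symD\<close>)
  then show "conn E (insert z (K \<union> L))" by simp
  let ?N = "{w \<in> V. (z, w) \<in> E}"
  have N: "finite ?N" "card ?N \<le> \<Delta>" using deg uv(5) G'(1) by (auto simp: degree_le_def)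
  then have c: "card (insert z ?N) \<le> Suc \<Delta>" by (simp add: card_insert_if)
  obtain j where j: "j < t" "B j \<inter> (K \<union> nb V E K \<union> L \<union> nb V E L \<union> insert z ?N) = {}"
    by (rule branch_set_avoiding_small_sides[OF G B K(2) L(2), of "insert z ?N"]) (use N(1) t c in auto)
  have sub: "nb V E (insert z (K \<union> L)) \<subseteq> nb V E K \<union> nb V E L \<union> ?N" by (auto simp: nb_def)
  then have "card (nb V E (insert z (K \<union> L))) \<le> card (nb V E K \<union> nb V E L \<union> ?N)"
    using N G'(1) by (intro card_mono) (auto simp: finite_nb)
  also have "\<dots> \<le> card (nb V E K) + card (nb V E L) + card ?N"
    using card_Un_le[of "nb V E K \<union> nb V E L" ?N] card_Un_le[of "nb V E K" "nb V E L"] by linarith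
  also have "\<dots> \<le> 2 * k + \<Delta>" using K(2) L(2) N by (simp add: small_side_def)
  finally have "card (nb V E (insert z (K \<union> L))) \<le> 2 * k + \<Delta>" .
  moreover have "B j \<inter> (insert z (K \<union> L) \<union> nb V E (insert z (K \<union> L))) = {}" using j sub by blast
  ultimately show "small_side V E t B (2 * k + \<Delta>) (insert z (K \<union> L))"
    using K(2) L(2) uv(5) j(1) by (auto simp: small_side_def)
qed

text \<open>A set \<open>D\<close> whose boundary is too small, where each vertex of \<open>P\<close> counts \<open>d\<close> times, leaves some
  vertices of \<open>P\<close> outside \<open>D \<union> nb V E D\<close>. Their components have, by \<open>d\<close>-connectivity, boundaries
  of size at least \<open>d\<close>, and these are disjoint because the vertices of \<open>P\<close> are pairwise not
  close.\<close>

lemma branch_vertices: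
  assumes G: "simple_graph V E" and B: "clique_model V E t B" and x: "\<And>i. i < t \<Longrightarrow> x i \<in> B i"
    and deg: "degree_le V E \<Delta>"
    and con: "\<And>X. X \<subseteq> V \<Longrightarrow> card X < d \<Longrightarrow> conn E (V - X)"
    and l: "l = 2 * (d * h) + \<Delta>" and t: "2 * l < t" "2 * (d * h) + \<Delta> + 1 < t" "h * Suc (Suc l ^ (l + 2)) \<le> t"
  shows "\<exists>I\<subseteq>{..<t}. card I = h \<and> (\<forall>D j. D \<subseteq> V - x ` I \<longrightarrow> j < t \<longrightarrow> B j \<subseteq> D \<longrightarrow>
    d * h \<le> card (nb V E D - x ` I) + d * card (nb V E D \<inter> x ` I))"
proof -
  note G' = simple_graphD[OF G] and m = clique_modelD[OF G B]
  let ?close = "\<lambda>i j. close V E t B l (x i) (x j)"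
  have sym: "?close i j \<Longrightarrow> ?close j i" for i j by (auto simp: close_def)
  obtain I where I: "I \<subseteq> {..<t}" "card I = h" "\<forall>i\<in>I. \<forall>j\<in>I. i \<noteq> j \<longrightarrow> \<not> ?close i j"
    using independent_selection[of "{..<t}" ?close "Suc l ^ (l + 2)" h] card_close[OF G B x t(1)] sym t(3)
    by auto
  let ?P = "x ` I"
  have finI: "finite I" using I(1) finite_subset by blast
  have xI: "x i \<in> V" "i < t" if "i \<in> I" for i using that I(1) x m(1) by blast+
  have inj: "inj_on x I"
  proof (rule inj_onI, rule ccontr)
    fix i j assume "i \<in> I" "j \<in> I" "x i = x j" "i \<noteq> j"
    then show False using x[of i] x[of j] m(3)[of i j] xI by auto
  qed
  have "d * h \<le> card (nb V E D - ?P) + d * card (nb V E D \<inter> ?P)"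
    if D: "D \<subseteq> V - ?P" and j: "j < t" "B j \<subseteq> D" for D j
  proof (rule ccontr)
    assume lt: "\<not> ?thesis"
    then have d: "0 < d" by (cases d) auto
    let ?N = "nb V E D"
    have finN: "finite ?N" by (rule finite_nb[OF G'(1)])
    have "card ?N = card (?N - ?P) + card (?N \<inter> ?P)"
      using card_Diff_subset_Int[of ?N ?P] finN by (metis add.commute card_Int_Diff)
    moreover have "card (?N \<inter> ?P) \<le> d * card (?N \<inter> ?P)" using d by simp
    ultimately have N: "card ?N \<le> d * h" using lt by linarith
    \<comment> \<open>\<open>R\<close> is the part beyond the boundary of \<open>D\<close>,
      \<open>J\<close> indexes the chosen vertices lying in it, and \<open>K i\<close> is the
      component of \<open>x i\<close> there.\<close>
    define R where "R = V - D - ?N"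
    define J where "J = {i \<in> I. x i \<notin> ?N}"
    define K where "K i = {y. (x i, y) \<in> (E \<inter> R \<times> R)\<^sup>*}" for i
    have xK: "x i \<in> K i" for i by (simp add: K_def)
    have conK: "conn E (K i)" for i unfolding K_def by (rule conn_reachable[OF G'(3)])
    have KR: "K i \<subseteq> R" if "i \<in> J" for i
    proof
      fix y assume "y \<in> K i"
      then have "(x i, y) \<in> (E \<inter> R \<times> R)\<^sup>*" by (simp add: K_def)
      then show "y \<in> R"
        by (induction rule: rtrancl_induct) (use that D xI in \<open>auto simp: J_def R_def\<close>)
    qed
    have nbK: "nb V E (K i) \<subseteq> ?N" if i: "i \<in> J" for i
    proof
      fix w assume "w \<in> nb V E (K i)"
      then obtain u where w: "w \<in> V" "w \<notin> K i" "u \<in> K i" "(u, w) \<in> E" by (auto simp: nb_def)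
      have u: "u \<in> R" using KR[OF i] w by blast
      have "w \<notin> R"
      proof
        assume "w \<in> R"
        then have "w \<in> K i" using w u by (auto simp: K_def intro: rtrancl_into_rtrancl)
        then show False using w by simp
      qed
      moreover have "w \<notin> D"
      proof
        assume "w \<in> D"
        then have "u \<in> D \<union> ?N" using u w(4) G'(3) by (auto simp: nb_def R_def dest: symD)
        then show False using u by (auto simp: R_def)
      qed
      ultimately show "w \<in> ?N" using w(1) by (simp add: R_def)
    qed
    have smK: "small_side V E t B (d * h) (K i)" if i: "i \<in> J" for i
    proof -
      have "card (nb V E (K i)) \<le> d * h"
        using card_mono[OF finN nbK[OF i]] N by simp
      moreover have "D \<inter> (K i \<union> nb V E (K i)) = {}"
        using KR[OF i] nbK[OF i] nb_subset[of V E D] by (auto simp: R_def)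
      then have "B j \<inter> (K i \<union> nb V E (K i)) = {}" using j(2) by blast
      moreover have "K i \<subseteq> V" using KR[OF i] by (auto simp: R_def)
      ultimately show ?thesis using j(1) by (auto simp: small_side_def)
    qed
    \<comment> \<open>The case \<open>i = i2\<close> covers a single component together with one of
      its boundary vertices.\<close>
    have join: "?close i i'"
      if "i \<in> J" "i2 \<in> J" "z \<in> nb V E (K i)" "z \<in> nb V E (K i2)" "x i' \<in> insert z (K i \<union> K i2)" for i i2 i' z
      unfolding close_def l
      using join_small_sides[OF G B deg conK smK[OF that(1)] conK smK[OF that(2)] that(3,4) t(2)] that(5) xK[of i]
      by blast
    have JI: "i \<in> I" if "i \<in> J" for i using that by (simp add: J_def)
    have avoidP: "nb V E (K i) \<inter> ?P = {}" if i: "i \<in> J" for i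
    proof (rule ccontr)
      assume "\<not> ?thesis"
      then obtain i' where i': "i' \<in> I" "x i' \<in> nb V E (K i)" by blast
      then have "?close i i'" using join[OF i i, of "x i'" i'] by blast
      moreover have "i \<noteq> i'" using i' xK[of i] by (auto simp: nb_def)
      ultimately show False using I(3) JI[OF i] i'(1) by blast
    qed
    have disj: "nb V E (K i) \<inter> nb V E (K i') = {}" if i: "i \<in> J" "i' \<in> J" "i \<noteq> i'" for i i'
    proof (rule ccontr)
      assume "\<not> ?thesis"
      then obtain z where "z \<in> nb V E (K i)" "z \<in> nb V E (K i')" by blast
      then have "?close i i'" using join[OF i(1,2)] xK[of i'] by blast
      then show False using I(3) JI i by blast
    qed
    \<comment> \<open>Otherwise deleting the boundary of \<open>K i\<close> would separate
      \<open>K i\<close> from \<open>B j\<close>, against \<open>d\<close>-connectivity.\<close>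
    have ge: "d \<le> card (nb V E (K i))" if i: "i \<in> J" for i
    proof (rule ccontr)
      assume "\<not> ?thesis"
      then have c: "conn E (V - nb V E (K i))" by (intro con) (auto simp: nb_def)
      have "K i \<subseteq> V - nb V E (K i)" using smK[OF i] by (auto simp: small_side_def nb_def)
      moreover have "K i \<noteq> {}" using xK by blast
      moreover obtain w where "w \<in> B j" using conn_nonempty[OF m(2)[OF j(1)]] by blast
      then have "w \<in> V - nb V E (K i)" "w \<notin> K i"
        using j D KR[OF i] nbK[OF i] nb_subset[of V E D] by (auto simp: R_def)
      then have "K i \<noteq> V - nb V E (K i)" by blast
      ultimately obtain u v where "u \<in> K i" "v \<in> V - nb V E (K i) - K i" "(u, v) \<in> E"
        by (rule connE[OF c])
      then show False by (auto simp: nb_def)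
    qed
    have finJ: "finite J" using finI by (simp add: J_def)
    have "card J * d \<le> (\<Sum>i\<in>J. card (nb V E (K i)))"
      using ge sum_bounded_below[of J d "\<lambda>i. card (nb V E (K i))"] by simp
    also have "\<dots> = card (\<Union>i\<in>J. nb V E (K i))"
      using finJ disj finite_nb[OF G'(1)] by (intro card_UN_disjoint[symmetric]) auto
    also have "\<dots> \<le> card (?N - ?P)"
      using finN nbK avoidP by (intro card_mono) blast+
    finally have 1: "card J * d \<le> card (?N - ?P)" .
    have "?N \<inter> ?P = x ` (I - J)" by (auto simp: J_def)
    then have "card (?N \<inter> ?P) = card (I - J)"
      using inj by (simp add: card_image inj_on_diff)
    moreover have "card (I - J) + card J = h"
    proof -
      have "J \<subseteq> I" by (auto simp: J_def)
      then show ?thesis using I(2) finI finJ card_Diff_subset[of J I] card_mono[of I J] by simp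
    qed
    ultimately have "card (?N \<inter> ?P) + card J = h" by simp
    \<comment> \<open>Chosen vertices on the boundary count \<open>d\<close> by their weight; those
      beyond it supply \<open>d\<close> each by their disjoint boundaries outside
      \<open>?P\<close>.\<close>
    then have "d * h = d * card (?N \<inter> ?P) + card J * d" by (metis add_mult_distrib2 mult.commute)
    then show False using 1 lt by simp
  qed
  then show ?thesis using I by blast
qed

section \<open>Duplicating the branch vertices\<close>

lemma conn_image:
  assumes S: "conn F S" and f: "\<And>u v. (u, v) \<in> F \<Longrightarrow> (f u, f v) \<in> E"
  shows "conn E (f ` S)"
  unfolding conn_def
proof (intro conjI allI impI)
  show "f ` S \<noteq> {}" using conn_nonempty[OF S] by simp
  fix C assume C: "C \<subseteq> f ` S" "C \<noteq> {} \<and> C \<noteq> f ` S"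
  let ?C = "{s \<in> S. f s \<in> C}"
  have "?C \<subseteq> S" "?C \<noteq> {}" "?C \<noteq> S" using C by auto
  then obtain u v where uv: "u \<in> ?C" "v \<in> S - ?C" "(u, v) \<in> F" by (rule connE[OF S])
  then have "f u \<in> C" "f v \<in> f ` S - C" by auto
  then show "\<exists>u\<in>C. \<exists>v\<in>f ` S - C. (u, v) \<in> E" using f[OF uv(3)] by blast
qed

text \<open>Each vertex of \<open>P\<close> is replaced by \<open>d\<close> copies with the same neighbours, so that a rooted clique
  model at the copies provides \<open>d\<close> otherwise disjoint connected sets at each vertex of \<open>P\<close>.\<close>

lemma fans_with_linkages:
  assumes G: "simple_graph V E" and B: "clique_model V E t B" and deg: "degree_le V E \<Delta>"
    and con: "\<And>X. X \<subseteq> V \<Longrightarrow> card X < d \<Longrightarrow> conn E (V - X)"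
    and l: "l = 2 * (d * h) + \<Delta>" and t: "2 * l < t" "2 * (d * h) + \<Delta> + 1 < t" "h * Suc (Suc l ^ (l + 2)) \<le> t"
      "h + 2 * (d * h) \<le> t"
  shows "\<exists>P T. P \<subseteq> V \<and> card P = h \<and>
    (\<forall>p\<in>P. \<forall>a<d. conn E (T p a) \<and> T p a \<subseteq> V \<and> T p a \<inter> P = {p}) \<and>
    (\<forall>p\<in>P. \<forall>a<d. \<forall>q\<in>P. \<forall>b<d. (p, a) \<noteq> (q, b) \<longrightarrow>
      T p a \<inter> T q b \<subseteq> P \<and> (\<exists>u\<in>T p a. \<exists>v\<in>T q b. (u, v) \<in> E))"
proof -
  note G' = simple_graphD[OF G] and m = clique_modelD[OF G B]
  have "\<forall>i\<in>{..<t}. \<exists>v. v \<in> B i" using m(2) conn_nonempty by blast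
  from bchoice[OF this] obtain x where x: "\<And>i. i < t \<Longrightarrow> x i \<in> B i" by auto
  obtain I where I: "I \<subseteq> {..<t}" "card I = h"
    and bd: "\<And>D j. D \<subseteq> V - x ` I \<Longrightarrow> j < t \<Longrightarrow> B j \<subseteq> D \<Longrightarrow>
      d * h \<le> card (nb V E D - x ` I) + d * card (nb V E D \<inter> x ` I)"
    using branch_vertices[OF G B x deg con l t(1-3)] by blast
  define P where "P = x ` I"
  have finI: "finite I" using I(1) finite_subset by blast
  have PV: "P \<subseteq> V" using I(1) x m(1) unfolding P_def by blast
  have "inj_on x I"
  proof (rule inj_onI, rule ccontr)
    fix i j assume "i \<in> I" "j \<in> I" "x i = x j" "i \<noteq> j"
    then show False using x[of i] x[of j] m(3)[of i j] I(1) by auto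
  qed
  then have cP: "card P = h" using I(2) by (simp add: P_def card_image)
  have finP: "finite P" using finI by (simp add: P_def)
  \<comment> \<open>Branch sets containing a vertex of \<open>P\<close> are given up, so that the
    others survive unchanged at copy number \<open>0\<close>; \<open>h + 2 * (d * h) \<le> t\<close>
    leaves enough of them.\<close>
  define J where "J = {..<t} - I"
  have BP: "B j \<inter> P = {}" if "j \<in> J" for j
  proof (rule ccontr)
    assume "B j \<inter> P \<noteq> {}"
    then obtain i where "i \<in> I" "x i \<in> B j" by (auto simp: P_def)
    moreover then have "i \<noteq> j" "i < t" "j < t" using that I(1) by (auto simp: J_def)
    ultimately show False using x[of i] m(3)[of i j] by blast
  qed
  define VV where "VV = (V - P) \<times> {0::nat} \<union> P \<times> {..<d}"
  \<comment> \<open>Arcs ignore the copy number; copies of the same vertex are not adjacent because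
    \<open>E\<close> is irreflexive.\<close>
  define EE where "EE = {((u, a :: nat), (v, b :: nat)) | u a v b. (u, v) \<in> E}"
  define Z where "Z = P \<times> {..<d}"
  have EE: "((u, a), (v, b)) \<in> EE \<longleftrightarrow> (u, v) \<in> E" for u a v b by (auto simp: EE_def)
  have cZ: "card Z = d * h" using cP by (simp add: Z_def card_cartesian_product)
  have "robust_model VV EE Z J (\<lambda>j. B j \<times> {0})"
    unfolding robust_model_def
  proof (intro conjI ballI allI impI)
    fix j assume j: "j \<in> J"
    then have jt: "j < t" by (simp add: J_def)
    show "B j \<times> {0} \<subseteq> VV" using m(1)[OF jt] BP[OF j] by (auto simp: VV_def)
    show "B j \<times> {0} \<noteq> {}" using x[OF jt] by auto
    fix C assume C: "C \<subseteq> B j \<times> {0} - Z" "C \<noteq> {}" "C \<noteq> B j \<times> {0}"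
    have eq: "(\<lambda>v. (v, 0)) ` B j = B j \<times> {0}" by auto
    have "conn EE (B j \<times> {0})"
      using conn_image[OF m(2)[OF jt], of "\<lambda>v. (v, 0)" EE] EE unfolding eq by blast
    then obtain u v where "u \<in> C" "v \<in> B j \<times> {0} - C" "(u, v) \<in> EE"
      by (rule connE[of _ _ C]) (use C in auto)
    then show "\<exists>u\<in>C. \<exists>v\<in>B j \<times> {0} - C. (u, v) \<in> EE" by blast
  next
    fix i j assume ij: "i \<in> J" "j \<in> J" "i \<noteq> j"
    then have t: "i < t" "j < t" by (auto simp: J_def)
    show "B i \<times> {0} \<inter> B j \<times> {0} = {}" using m(3)[OF t ij(3)] by blast
    obtain u v where "u \<in> B i" "v \<in> B j" "(u, v) \<in> E" using m(4)[OF t ij(3)] by blast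
    then show "\<exists>u\<in>B i \<times> {0}. \<exists>v\<in>B j \<times> {0}. (u, v) \<in> EE"
      by (intro bexI[of _ "(u, 0)"] bexI[of _ "(v, 0)"]) (auto simp: EE)
  next
    fix D assume D: "D \<subseteq> VV - Z" "\<exists>j\<in>J. B j \<times> {0} \<subseteq> D"
    then obtain j where j: "j \<in> J" "B j \<times> {0} \<subseteq> D" by blast
    let ?D = "fst ` D"
    have D0: "D = ?D \<times> {0}" using D(1) by (force simp: VV_def Z_def)
    have DV: "?D \<subseteq> V - x ` I" using D(1) by (auto simp: VV_def Z_def P_def[symmetric])
    have "B j \<subseteq> ?D" using j(2) by force
    \<comment> \<open>A boundary vertex in \<open>P\<close> has \<open>d\<close> copies, so the
      weighted count of \<open>branch_vertices\<close> is exactly the size of the boundary among the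
      copies.\<close>
    then have "d * h \<le> card (nb V E ?D - P) + d * card (nb V E ?D \<inter> P)"
      using bd[OF DV, of j] j(1) by (simp add: J_def P_def)
    also have "\<dots> = card ((nb V E ?D - P) \<times> {0::nat}) + card ((nb V E ?D \<inter> P) \<times> {..<d})"
      by (simp add: card_cartesian_product)
    also have "\<dots> = card ((nb V E ?D - P) \<times> {0::nat} \<union> (nb V E ?D \<inter> P) \<times> {..<d})"
      using finP finite_nb[OF G'(1)] by (intro card_Un_disjoint[symmetric]) auto
    also have "(nb V E ?D - P) \<times> {0::nat} \<union> (nb V E ?D \<inter> P) \<times> {..<d} = nb VV EE (?D \<times> {0})"
    proof (rule set_eqI)
      fix w :: "'a \<times> nat"
      obtain v a where w: "w = (v, a)" by (cases w)
      have "v \<notin> ?D" if "v \<in> P" using that DV by (auto simp: P_def)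
      then show "w \<in> (nb V E ?D - P) \<times> {0::nat} \<union> (nb V E ?D \<inter> P) \<times> {..<d} \<longleftrightarrow>
          w \<in> nb VV EE (?D \<times> {0})"
        unfolding w using PV by (auto simp: nb_def VV_def EE Bex_def)
    qed
    finally show "card Z \<le> card (nb VV EE D)" using cZ D0 by simp
  qed
  moreover have "finite VV" "Z \<subseteq> VV" "finite J"
    using G'(1) finP by (auto simp: VV_def Z_def J_def)
  moreover have "sym EE" using G'(3) by (auto simp: EE_def sym_def)
  moreover have "2 * card Z \<le> card J"
    using t(4) I finI by (simp add: cZ J_def card_Diff_subset)
  ultimately obtain T where T: "rooted_clique_model VV EE Z T"
    using robust_model_imp_rooted_clique_model by blast
  note T = rooted_clique_modelD[OF T]
  \<comment> \<open>Forgetting the copy number makes the disjoint sets overlap only in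
    \<open>P\<close>, since a vertex outside \<open>P\<close> has a single copy.\<close>
  define S where "S p a = fst ` T (p, a)" for p a
  have Z: "(p, a) \<in> Z \<longleftrightarrow> p \<in> P \<and> a < d" for p a by (auto simp: Z_def)
  have only: "p' = p \<and> a' = a" if "(p', a') \<in> T (p, a)" "p' \<in> P" "(p, a) \<in> Z" for p' a' p a
  proof (rule ccontr)
    assume *: "\<not> ?thesis"
    have z': "(p', a') \<in> Z" using T(2)[OF that(3)] that by (auto simp: VV_def Z)
    then show False using T(4)[OF that(3) z'] T(1)[OF z'] that(1) * by auto
  qed
  have SP: "S p a \<inter> P = {p}" if "p \<in> P" "a < d" for p a
  proof -
    have z: "(p, a) \<in> Z" using that Z by blast
    have "p \<in> S p a" using T(1)[OF z] by (force simp: S_def)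
    moreover have "y = p" if "y \<in> S p a" "y \<in> P" for y
      using that only[OF _ that(2) z] by (auto simp: S_def)
    ultimately show ?thesis using that by blast
  qed
  have S1: "conn E (S p a)" "S p a \<subseteq> V" if "p \<in> P" "a < d" for p a
  proof -
    have z: "(p, a) \<in> Z" using that Z by blast
    show "conn E (S p a)" unfolding S_def
      by (rule conn_image[OF T(3)[OF z]]) (auto simp: EE_def)
    have "fst ` VV \<subseteq> V" using PV by (auto simp: VV_def)
    then show "S p a \<subseteq> V" using image_mono[OF T(2)[OF z], of fst] by (simp add: S_def)
  qed
  have S2: "S p a \<inter> S q b \<subseteq> P \<and> (\<exists>u\<in>S p a. \<exists>v\<in>S q b. (u, v) \<in> E)"
    if pq: "p \<in> P" "a < d" "q \<in> P" "b < d" "(p, a) \<noteq> (q, b)" for p a q b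
  proof (intro conjI subsetI)
    have z: "(p, a) \<in> Z" "(q, b) \<in> Z" using pq Z by blast+
    fix y assume "y \<in> S p a \<inter> S q b"
    then obtain c c' where c: "(y, c) \<in> T (p, a)" "(y, c') \<in> T (q, b)" by (auto simp: S_def)
    show "y \<in> P"
    proof (rule ccontr)
      assume "y \<notin> P"
      then have "c = 0" "c' = 0" using c T(2)[OF z(1)] T(2)[OF z(2)] by (auto simp: VV_def)
      then show False using c T(4)[OF z pq(5)] by blast
    qed
  next
    have z: "(p, a) \<in> Z" "(q, b) \<in> Z" using pq Z by blast+
    obtain u v where uv: "u \<in> T (p, a)" "v \<in> T (q, b)" "(u, v) \<in> EE" using T(5)[OF z pq(5)] by blast
    then have "(fst u, fst v) \<in> E" by (auto simp: EE_def)
    then show "\<exists>u\<in>S p a. \<exists>v\<in>S q b. (u, v) \<in> E" using uv by (auto simp: S_def)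
  qed
  show ?thesis
    by (intro exI[of _ P] exI[of _ S] conjI ballI allI impI PV cP SP S1 S2[THEN conjunct1] S2[THEN conjunct2])
qed

section \<open>Subdivisions\<close>

text \<open>The list holds the inner vertices only, so \<open>[]\<close> stands for an edge that is
  not subdivided.\<close>

fun path_arcs :: "'a \<Rightarrow> 'a list \<Rightarrow> 'a \<Rightarrow> 'a rel" where
  "path_arcs u [] v = {(u, v)}"
| "path_arcs u (x # xs) v = insert (u, x) (path_arcs x xs v)"

lemma path_arcs_append:
  "path_arcs u (xs @ y # ys) v = path_arcs u xs y \<union> path_arcs y ys v"
  by (induction xs arbitrary: u) auto

lemma path_arcs_cases:
  "(a, b) \<in> path_arcs u xs v \<Longrightarrow> a \<in> set xs \<or> b \<in> set xs \<or> xs = [] \<and> a = u \<and> b = v"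
  by (induction xs arbitrary: u) auto

text \<open>A path is extended along a walk inside \<open>S\<close>; when the next vertex already
  lies on it, the path is cut off there.\<close>

lemma conn_path:
  assumes S: "conn E S" "u \<in> S" "v \<in> S" "u \<noteq> v"
  shows "\<exists>xs. path_arcs u xs v \<subseteq> E \<and> set xs \<subseteq> S \<and> distinct (u # xs @ [v])"
proof -
  let ?R = "{w \<in> S. (u, w) \<in> (E \<inter> S \<times> S)\<^sup>*}"
  have "?R = S"
  proof (rule ccontr)
    assume ne: "?R \<noteq> S"
    have sub: "?R \<subseteq> S" "?R \<noteq> {}" using S(2) by auto
    obtain p q where "p \<in> ?R" "q \<in> S - ?R" "(p, q) \<in> E"
      by (rule connE[OF S(1) sub ne])
    then show False by (auto intro: rtrancl_into_rtrancl)
  qed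
  then have "(u, v) \<in> (E \<inter> S \<times> S)\<^sup>*" using S(3) by blast
  then have "v = u \<or> (\<exists>xs. path_arcs u xs v \<subseteq> E \<and> set xs \<subseteq> S \<and> distinct (u # xs @ [v]))"
  proof (induction rule: rtrancl_induct)
    case (step y z)
    show ?case
    proof (cases "z = u \<or> y = u \<or> z = y")
      case True
      then show ?thesis using step by (auto intro: exI[of _ "[]"])
    next
      case False
      then obtain xs where xs: "path_arcs u xs y \<subseteq> E" "set xs \<subseteq> S" "distinct (u # xs @ [y])"
        using step.IH by blast
      show ?thesis
      proof (cases "z \<in> set xs")
        case True
        then obtain ys zs where "xs = ys @ z # zs" by (meson split_list)
        then show ?thesis using xs by (intro disjI2 exI[of _ ys]) (auto simp: path_arcs_append)
      next
        case z: False
        then show ?thesis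
          using xs step.hyps(2) False by (intro disjI2 exI[of _ "xs @ [y]"]) (auto simp: path_arcs_append)
      qed
    qed
  qed simp
  then show ?thesis using S(4) by blast
qed

text \<open>Subdividing \<open>(u, v)\<close> by \<open>x\<close> creates the arc
  \<open>(x, v)\<close>, which is then subdivided by the rest of the list.\<close>

lemma subdivision_pair_path:
  assumes "subdivision_pair K J" "(u, v) \<in> parcs J" "distinct xs" "set xs \<inter> pverts J = {}"
  shows "subdivision_pair K \<lparr>pverts = pverts J \<union> set xs,
    parcs = (parcs J - {(u, v), (v, u)}) \<union> path_arcs u xs v \<union> (path_arcs u xs v)\<inverse>\<rparr>"
  using assms
proof (induction xs arbitrary: J u)
  case Nil
  interpret J: pair_bidirected_digraph J by (rule bidirected_digraphI_subdivision[OF Nil.prems(1)])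
  have "parcs J = (parcs J - {(u, v), (v, u)}) \<union> path_arcs u [] v \<union> (path_arcs u [] v)\<inverse>"
    using Nil.prems(2) J.arcs_symmetric by auto
  then have "\<lparr>pverts = pverts J \<union> set [],
    parcs = (parcs J - {(u, v), (v, u)}) \<union> path_arcs u [] v \<union> (path_arcs u [] v)\<inverse>\<rparr> = J"
    by simp
  then show ?case using Nil.prems(1) by simp
next
  case (Cons x xs)
  interpret J: pair_bidirected_digraph J by (rule bidirected_digraphI_subdivision[OF Cons.prems(1)])
  let ?J = "subdivide J (u, v) x"
  have x: "x \<notin> pverts J" using Cons.prems(4) by auto
  have uv: "u \<noteq> v" "u \<in> pverts J" "v \<in> pverts J"
    using Cons.prems(2) J.no_loops' J.in_arcsD1 J.in_arcsD2 by blast+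
  have xJ: "(x, w) \<notin> parcs J" "(w, x) \<notin> parcs J" for w
    using x J.in_arcsD1 J.in_arcsD2 by blast+
  have "subdivision_pair K ?J"
    using Cons.prems(1,2) x by (intro subdivision_pair_divide)
  moreover have "(x, v) \<in> parcs ?J" by simp
  moreover have "distinct xs" "set xs \<inter> pverts ?J = {}" using Cons.prems by auto
  ultimately have "subdivision_pair K \<lparr>pverts = pverts ?J \<union> set xs,
    parcs = (parcs ?J - {(x, v), (v, x)}) \<union> path_arcs x xs v \<union> (path_arcs x xs v)\<inverse>\<rparr>"
    by (rule Cons.IH)
  moreover have "(parcs ?J - {(x, v), (v, x)}) = (parcs J - {(u, v), (v, u)}) \<union> {(u, x), (x, u)}"
    using xJ uv x by auto
  moreover have "pverts ?J \<union> set xs = pverts J \<union> set (x # xs)" by auto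
  moreover have "(parcs J - {(u, v), (v, u)}) \<union> {(u, x), (x, u)} \<union> path_arcs x xs v \<union> (path_arcs x xs v)\<inverse>
    = (parcs J - {(u, v), (v, u)}) \<union> path_arcs u (x # xs) v \<union> (path_arcs u (x # xs) v)\<inverse>"
    by auto
  ultimately show ?case by simp
qed

text \<open>\<open>F\<close> selects one orientation of each edge to be replaced, hence
  \<open>F \<inter> F\<inverse> = {}\<close>.\<close>

lemma subdivision_pair_paths:
  assumes K: "pair_graph K" and "finite F" "F \<subseteq> parcs K" "F \<inter> F\<inverse> = {}"
    and q: "\<And>e. e \<in> F \<Longrightarrow> distinct (q e) \<and> set (q e) \<inter> pverts K = {}"
    and disj: "\<And>e e'. e \<in> F \<Longrightarrow> e' \<in> F \<Longrightarrow> e \<noteq> e' \<Longrightarrow> set (q e) \<inter> set (q e') = {}"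
  shows "subdivision_pair K \<lparr>pverts = pverts K \<union> (\<Union>e\<in>F. set (q e)),
    parcs = (parcs K - F - F\<inverse>) \<union> (\<Union>e\<in>F. path_arcs (fst e) (q e) (snd e) \<union> (path_arcs (fst e) (q e) (snd e))\<inverse>)\<rparr>"
  using assms(2-)
proof (induction F rule: finite_induct)
  case empty
  interpret pair_graph K by (rule K)
  have "subdivision_pair K K" by (intro subdivision_pair_base) unfold_locales
  moreover have eq: "\<lparr>pverts = pverts K \<union> (\<Union>e\<in>{}. set (q e)),
      parcs = (parcs K - {} - {}\<inverse>) \<union> (\<Union>e\<in>{}. path_arcs (fst e) (q e) (snd e) \<union>
        (path_arcs (fst e) (q e) (snd e))\<inverse>)\<rparr> = K" by simp
  ultimately show ?case unfolding eq by simp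
next
  case (insert e F)
  interpret pair_graph K by (rule K)
  obtain u v where e: "e = (u, v)" by (cases e)
  let ?pa = "\<lambda>e. path_arcs (fst e) (q e) (snd e)"
  let ?U = "\<Union>e\<in>F. ?pa e \<union> (?pa e)\<inverse>"
  let ?J = "\<lparr>pverts = pverts K \<union> (\<Union>e\<in>F. set (q e)), parcs = (parcs K - F - F\<inverse>) \<union> ?U\<rparr>"
  have J: "subdivision_pair K ?J"
  proof (rule insert.IH)
    show "F \<subseteq> parcs K" "F \<inter> F\<inverse> = {}" using insert.prems(1,2) by blast+
  qed (use insert.prems(3,4) in simp_all)
  have uvK: "(u, v) \<in> parcs K" "u \<in> pverts K" "v \<in> pverts K"
    using insert.prems(1) in_arcsD1 in_arcsD2 by (auto simp: e)
  have vu: "(v, u) \<notin> F" using insert.prems(2) by (auto simp: e)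
  have "(u, v) \<in> parcs ?J" using uvK vu insert.hyps(2) by (simp add: e)
  moreover have "distinct (q e)" "set (q e) \<inter> pverts ?J = {}"
    using insert.prems(3)[of e] insert.prems(4)[of e] insert.hyps(2) by auto
  ultimately have *: "subdivision_pair K \<lparr>pverts = pverts ?J \<union> set (q e),
      parcs = (parcs ?J - {(u, v), (v, u)}) \<union> path_arcs u (q e) v \<union> (path_arcs u (q e) v)\<inverse>\<rparr>"
    by (intro subdivision_pair_path[OF J])
  \<comment> \<open>Removing the edge now treated does not damage earlier paths: each of their arcs
    has an end outside \<open>K\<close>, or belongs to an edge already in \<open>F\<close>.\<close>
  have U: "(a, b) \<notin> ?U" if ab: "(a, b) = (u, v) \<or> (a, b) = (v, u)" for a b
  proof
    assume "(a, b) \<in> ?U"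
    then obtain f where f: "f \<in> F" "(a, b) \<in> ?pa f \<or> (b, a) \<in> ?pa f" by blast
    have "a \<notin> set (q f)" "b \<notin> set (q f)" using insert.prems(3)[of f] f(1) ab uvK by auto
    then have "(a, b) = f \<or> (b, a) = f"
      using f(2) path_arcs_cases[of a b "fst f" "q f" "snd f"] path_arcs_cases[of b a "fst f" "q f" "snd f"]
      by auto
    then have "(u, v) \<in> F \<or> (v, u) \<in> F" using f(1) ab by auto
    then show False using vu insert.hyps(2) e by blast
  qed
  have "parcs ?J - {(u, v), (v, u)} = (parcs K - insert e F - (insert e F)\<inverse>) \<union> ?U"
    using U[of u v] U[of v u] by (auto simp: e)
  then have "(parcs ?J - {(u, v), (v, u)}) \<union> path_arcs u (q e) v \<union> (path_arcs u (q e) v)\<inverse> =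
      (parcs K - insert e F - (insert e F)\<inverse>) \<union> (\<Union>e\<in>insert e F. ?pa e \<union> (?pa e)\<inverse>)"
    by (simp add: e) blast
  moreover have "pverts ?J \<union> set (q e) = pverts K \<union> (\<Union>e\<in>insert e F. set (q e))" by auto
  ultimately show ?case using * by simp
qed

section \<open>Routing the edges through the fans\<close>

lemma card_out_neighbours:
  "card {w. (v, w) \<in> parcs G} = out_degree (with_proj G) v"
proof -
  have "out_arcs (with_proj G) v = Pair v ` {w. (v, w) \<in> parcs G}"
    by (auto simp: out_arcs_def)
  then show ?thesis by (simp add: out_degree_def card_image inj_on_def)
qed

lemma pair_graph_simple_graph:
  assumes "pair_graph G"
  shows "simple_graph (pverts G) (parcs G)"
proof -
  interpret pair_graph G by (rule assms)
  show ?thesis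
    using pair_finite_verts in_arcsD1 in_arcsD2 arcs_symmetric
    by (auto simp: simple_graph_def sym_def irrefl_def dest: no_loops')
qed

lemma connected_imp_conn:
  assumes "pair_graph G" "connected (with_proj G \<restriction> W)"
  shows "conn (parcs G) W"
  unfolding conn_def
proof (intro conjI allI impI)
  interpret pair_graph G by (rule assms)
  let ?A = "arcs_ends (with_proj G \<restriction> W)"
  show "W \<noteq> {}" using assms(2) by (simp add: connected_conv)
  fix C assume C: "C \<subseteq> W" "C \<noteq> {} \<and> C \<noteq> W"
  then obtain u v where uv: "u \<in> C" "v \<in> W" "v \<notin> C" by blast
  then have "(u, v) \<in> rtrancl_on W (?A\<^sup>s)"
    using assms(2) C by (auto simp: connected_conv)
  then have "v \<notin> C \<Longrightarrow> \<exists>u\<in>C. \<exists>v\<in>W - C. (u, v) \<in> parcs G"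
  proof (induction rule: rtrancl_on_induct)
    case base
    then show ?case using uv by simp
  next
    case (step y z)
    have "(y, z) \<in> parcs G"
      using step.hyps(2) arcs_symmetric by (auto simp: symcl_def arcs_ends_conv)
    then show ?case using step by blast
  qed
  then show "\<exists>u\<in>C. \<exists>v\<in>W - C. (u, v) \<in> parcs G" using uv by blast
qed

text \<open>Every vertex \<open>p\<close> of the copy \<open>K\<close> of \<open>H\<close> assigns
  distinct fan members \<open>s p q\<close> to its at most \<open>d\<close> neighbours
  \<open>q\<close>. The edge between \<open>p\<close> and \<open>q\<close> is routed inside the
  union of \<open>T p (s p q)\<close> and \<open>T q (s q p)\<close>, which is connected because the
  two sets are adjacent. The unions for different edges meet only in \<open>P\<close>, so the paths
  are internally disjoint.\<close>

lemma fans_imp_contains_subdivision: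
  fixes G :: "('a :: linorder) pair_pre_digraph"
  assumes G: "pair_graph G" and H: "pair_graph H" "max_degree_le H d"
    and P: "P \<subseteq> pverts G" "card P = card (pverts H)"
    and T: "\<And>p a. p \<in> P \<Longrightarrow> a < d \<Longrightarrow>
      conn (parcs G) (T p a) \<and> T p a \<subseteq> pverts G \<and> T p a \<inter> P = {p}"
    and TT: "\<And>p a q b. p \<in> P \<Longrightarrow> a < d \<Longrightarrow> q \<in> P \<Longrightarrow> b < d \<Longrightarrow> (p, a) \<noteq> (q, b) \<Longrightarrow>
      T p a \<inter> T q b \<subseteq> P \<and> (\<exists>u\<in>T p a. \<exists>v\<in>T q b. (u, v) \<in> parcs G)"
  shows "contains_subdivision G H"
proof -
  interpret G: pair_graph G by (rule G)
  interpret H: pair_graph H by (rule H)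
  have "finite P" using P(1) G.pair_finite_verts finite_subset by blast
  then obtain \<phi> where \<phi>: "bij_betw \<phi> (pverts H) P"
    using finite_same_card_bij[OF H.pair_finite_verts] P(2) by metis
  have \<phi>inj: "inj_on \<phi> (pverts H)" and \<phi>P: "\<phi> ` pverts H = P" using \<phi> by (auto simp: bij_betw_def)
  define K where "K = \<lparr>pverts = P, parcs = (\<lambda>(i, j). (\<phi> i, \<phi> j)) ` parcs H\<rparr>"
  have Kv: "pverts K = P" by (simp add: K_def)
  have arcsK: "(p, q) \<in> parcs K \<longleftrightarrow> (\<exists>i j. (i, j) \<in> parcs H \<and> p = \<phi> i \<and> q = \<phi> j)" for p q
    by (auto simp: K_def)
  have iso: "digraph_iso (with_proj H) (with_proj K)"
  proof -
    let ?f = "\<lparr>iso_verts = \<phi>, iso_arcs = (\<lambda>(i, j). (\<phi> i, \<phi> j)), iso_head = snd, iso_tail = fst\<rparr>"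
    have "inj_on (\<lambda>(i, j). (\<phi> i, \<phi> j)) (parcs H)"
      by (rule inj_onI) (auto dest: inj_onD[OF \<phi>inj] H.in_arcsD1 H.in_arcsD2)
    then have "pre_digraph.digraph_isomorphism (with_proj H) ?f"
      using \<phi>inj H.wf_digraph by (auto simp: pre_digraph.digraph_isomorphism_def)
    moreover have "with_proj K = app_iso ?f (with_proj H)"
      using \<phi>P by (simp add: app_iso_def with_proj_def K_def)
    ultimately show ?thesis unfolding digraph_iso_def by blast
  qed
  have K: "pair_graph K"
  proof unfold_locales
    show "fst e \<in> pverts K" "snd e \<in> pverts K" if "e \<in> parcs K" for e
      using that \<phi>P H.in_arcsD1 H.in_arcsD2 by (auto simp: K_def)
    show "finite (pverts K)" "finite (parcs K)"
      using \<open>finite P\<close> H.pair_finite_arcs by (simp_all add: K_def)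
    show "fst e \<noteq> snd e" if e: "e \<in> parcs K" for e
    proof
      assume "fst e = snd e"
      then obtain i j where "(i, j) \<in> parcs H" "\<phi> i = \<phi> j" using e by (auto simp: K_def)
      then show False
        using \<phi>inj H.in_arcsD1 H.in_arcsD2 H.no_loops' by (metis inj_on_def)
    qed
    show "symmetric (with_proj K)"
      using H.arcs_symmetric by (auto simp: symmetric_def sym_def arcsK)
  qed
  interpret K: pair_graph K by (rule K)
  have deg: "card {q. (p, q) \<in> parcs K} \<le> d" if p: "p \<in> P" for p
  proof -
    obtain i where i: "i \<in> pverts H" "p = \<phi> i" using p \<phi>P by blast
    have "{q. (p, q) \<in> parcs K} = \<phi> ` {j. (i, j) \<in> parcs H}"
      using i \<phi>inj H.in_arcsD1 by (auto simp: arcsK dest: inj_onD)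
    moreover have fin: "finite {j. (i, j) \<in> parcs H}"
      by (rule finite_subset[OF _ H.pair_finite_verts]) (use H.in_arcsD2 in auto)
    ultimately have "card {q. (p, q) \<in> parcs K} \<le> card {j. (i, j) \<in> parcs H}"
      by (simp add: card_image_le)
    also have "\<dots> \<le> d" using H(2) i(1) by (simp add: card_out_neighbours max_degree_le_def)
    finally show ?thesis .
  qed
  have "\<forall>p\<in>P. \<exists>s. inj_on s {q. (p, q) \<in> parcs K} \<and> s ` {q. (p, q) \<in> parcs K} \<subseteq> {..<d}"
  proof
    fix p assume p: "p \<in> P"
    have "finite {q. (p, q) \<in> parcs K}"
      by (rule finite_subset[OF _ K.pair_finite_verts]) (use K.in_arcsD2 in auto)
    then show "\<exists>s. inj_on s {q. (p, q) \<in> parcs K} \<and> s ` {q. (p, q) \<in> parcs K} \<subseteq> {..<d}"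
      using card_le_inj[of "{q. (p, q) \<in> parcs K}" "{..<d}"] deg[OF p] by auto
  qed
  from bchoice[OF this] obtain s where
    s: "\<And>p. p \<in> P \<Longrightarrow> inj_on (s p) {q. (p, q) \<in> parcs K}"
      "\<And>p. p \<in> P \<Longrightarrow> s p ` {q. (p, q) \<in> parcs K} \<subseteq> {..<d}" by blast
  \<comment> \<open>The linear order on the vertices picks one orientation of every edge.\<close>
  define F where "F = {(p, q) \<in> parcs K. p < q}"
  define S where "S e = T (fst e) (s (fst e) (snd e)) \<union> T (snd e) (s (snd e) (fst e))" for e
  have FK: "F \<subseteq> parcs K" "finite F" "F \<inter> F\<inverse> = {}"
    using K.pair_finite_arcs finite_subset[of F "parcs K"] by (auto simp: F_def)
  have F: "p \<in> P" "q \<in> P" "s p q < d" "s q p < d" "p < q" "(p, q) \<in> parcs K" "(q, p) \<in> parcs K"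
    if "(p, q) \<in> F" for p q
  proof -
    show e: "p < q" "(p, q) \<in> parcs K" and e': "(q, p) \<in> parcs K"
      using that K.arcs_symmetric by (auto simp: F_def)
    show pq: "p \<in> P" "q \<in> P" using K.in_arcsD1[OF e(2)] K.in_arcsD2[OF e(2)] Kv by auto
    show "s p q < d" "s q p < d" using s(2)[OF pq(1)] s(2)[OF pq(2)] e e' by auto
  qed
  have slots: "(p, s p q) \<noteq> (q, s q p)" if "(p, q) \<in> F" for p q
    using F(5)[OF that] by auto
  have S: "conn (parcs G) (S (p, q)) \<and> S (p, q) \<subseteq> pverts G \<and> S (p, q) \<inter> P = {p, q}"
    if "(p, q) \<in> F" for p q
  proof -
    note f = F[OF that]
    have "sym (parcs G)" using G.arcs_symmetric by (auto simp: sym_def)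
    then have "conn (parcs G) (S (p, q))"
      using T[OF f(1,3)] T[OF f(2,4)] TT[OF f(1,3,2,4) slots[OF that]]
      by (auto simp: S_def intro: conn_Un)
    moreover have "S (p, q) \<inter> P = (T p (s p q) \<inter> P) \<union> (T q (s q p) \<inter> P)" by (auto simp: S_def)
    ultimately show ?thesis using T[OF f(1,3)] T[OF f(2,4)] by (auto simp: S_def)
  qed
  have SS: "S e \<inter> S e' \<subseteq> P" if e: "e \<in> F" "e' \<in> F" "e \<noteq> e'" for e e'
  proof -
    obtain p q p' q' where pq: "e = (p, q)" "e' = (p', q')" by (cases e, cases e')
    have f: "(p, q) \<in> F" and f': "(p', q') \<in> F" using e pq by auto
    have *: "(a, s a b) \<noteq> (a', s a' b')"
      if "(a, b) \<in> parcs K" "(a', b') \<in> parcs K" "(a, b) \<noteq> (a', b')" for a b a' b'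
      using that s(1)[of a] K.in_arcsD1[of a b] Kv by (auto dest: inj_onD)
    note g = F[OF f] and g' = F[OF f']
    have "T a (s a b) \<inter> T a' (s a' b') \<subseteq> P"
      if ab: "(a, b) = (p, q) \<or> (a, b) = (q, p)" "(a', b') = (p', q') \<or> (a', b') = (q', p')" for a b a' b'
    proof -
      have "(a, b) \<noteq> (a', b')" using ab g(5) g'(5) e(3) pq by auto
      moreover have "(a, b) \<in> parcs K" "(a', b') \<in> parcs K" using ab g(6,7) g'(6,7) by auto
      ultimately have "(a, s a b) \<noteq> (a', s a' b')" by (intro *)
      moreover have "a \<in> P" "a' \<in> P" "s a b < d" "s a' b' < d" using ab g(1-4) g'(1-4) by auto
      ultimately show ?thesis using TT[of a "s a b" a' "s a' b'"] by blast
    qed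
    from this[of p q p' q'] this[of p q q' p'] this[of q p p' q'] this[of q p q' p']
    have "T p (s p q) \<inter> T p' (s p' q') \<subseteq> P" "T p (s p q) \<inter> T q' (s q' p') \<subseteq> P"
      "T q (s q p) \<inter> T p' (s p' q') \<subseteq> P" "T q (s q p) \<inter> T q' (s q' p') \<subseteq> P" by simp_all
    then show ?thesis by (auto simp: S_def pq)
  qed
  have "\<forall>e\<in>F. \<exists>xs. path_arcs (fst e) xs (snd e) \<subseteq> parcs G \<and> set xs \<subseteq> S e \<and> distinct (fst e # xs @ [snd e])"
  proof
    fix e assume "e \<in> F"
    then obtain p q where "e = (p, q)" "(p, q) \<in> F" by (cases e) auto
    moreover from this(2) have "p \<in> S (p, q)" "q \<in> S (p, q)" "p \<noteq> q" using S[of p q] F(5)[of p q] by auto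
    ultimately show "\<exists>xs. path_arcs (fst e) xs (snd e) \<subseteq> parcs G \<and> set xs \<subseteq> S e \<and> distinct (fst e # xs @ [snd e])"
      using conn_path[of "parcs G" "S (p, q)" p q] S[of p q] by simp
  qed
  from bchoice[OF this] obtain x where x: "\<And>e. e \<in> F \<Longrightarrow>
    path_arcs (fst e) (x e) (snd e) \<subseteq> parcs G \<and> set (x e) \<subseteq> S e \<and> distinct (fst e # x e @ [snd e])"
    by blast
  have xP: "set (x e) \<inter> P = {}" if "e \<in> F" for e
  proof -
    obtain p q where e: "e = (p, q)" by (cases e)
    have "set (x e) \<inter> P \<subseteq> {p, q}" using x[OF that] S[of p q] that e by auto
    then show ?thesis using x[OF that] e by auto
  qed
  define J where "J = \<lparr>pverts = pverts K \<union> (\<Union>e\<in>F. set (x e)),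
    parcs = (parcs K - F - F\<inverse>) \<union>
      (\<Union>e\<in>F. path_arcs (fst e) (x e) (snd e) \<union> (path_arcs (fst e) (x e) (snd e))\<inverse>)\<rparr>"
  have sub: "subdivision_pair K J"
    unfolding J_def
  proof (rule subdivision_pair_paths[OF K FK(2,1,3)])
    show "distinct (x e) \<and> set (x e) \<inter> pverts K = {}" if "e \<in> F" for e
      using x[OF that] xP[OF that] Kv by simp
    show "set (x e) \<inter> set (x e') = {}" if "e \<in> F" "e' \<in> F" "e \<noteq> e'" for e e'
      using SS[OF that] x[OF that(1)] x[OF that(2)] xP[OF that(1)] by blast
  qed
  interpret J: pair_bidirected_digraph J by (rule bidirected_digraphI_subdivision[OF sub])
  \<comment> \<open>All edges of \<open>K\<close> are replaced; a remaining one need not be an edge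
    of \<open>G\<close>.\<close>
  have e1: "parcs K - F - F\<inverse> = {}"
    using K.arcs_symmetric by (auto simp: F_def not_less dest: K.no_loops')
  have e2: "path_arcs (fst e) (x e) (snd e) \<union> (path_arcs (fst e) (x e) (snd e))\<inverse> \<subseteq> parcs G"
    if "e \<in> F" for e
  proof -
    have "path_arcs (fst e) (x e) (snd e) \<subseteq> parcs G" using x[OF that] by simp
    then show ?thesis using G.arcs_symmetric by blast
  qed
  have "parcs J \<subseteq> parcs G"
    unfolding J_def e1 using UN_least[OF e2] by simp
  moreover have "pverts J \<subseteq> pverts G"
  proof -
    have "set (x e) \<subseteq> pverts G" if "e \<in> F" for e
      using x[OF that] S[of "fst e" "snd e"] that by auto
    then show ?thesis using P(1) Kv by (auto simp: J_def)
  qed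
  ultimately have "subgraph (with_proj J) (with_proj G)"
    using J.wf_digraph G.wf_digraph by (auto simp: subgraph_def compatible_def)
  then show ?thesis
    using iso sub unfolding contains_subdivision_def by blast
qed

text \<open>The lower bound on \<open>t\<close> is a sum that dominates all four requirements of
  \<open>fans_with_linkages\<close>.\<close>

lemma clique_model_imp_contains_subdivision:
  fixes G :: "('a :: linorder) pair_pre_digraph"
  assumes G: "pair_graph G" "vertex_connected d G" "max_degree_le G \<Delta>"
    and H: "pair_graph H" "max_degree_le H d"
    and h: "h = card (pverts H)" and l: "l = 2 * (d * h) + \<Delta>"
    and t: "h * Suc (Suc l ^ (l + 2)) + h + 2 * l + 2 \<le> t"
    and B: "clique_model (pverts G) (parcs G) t B"
  shows "contains_subdivision G H"
proof -
  interpret G: pair_graph G by (rule G)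
  have sg: "simple_graph (pverts G) (parcs G)" by (rule pair_graph_simple_graph[OF G(1)])
  have deg: "degree_le (pverts G) (parcs G) \<Delta>"
  proof -
    have "{w \<in> pverts G. (v, w) \<in> parcs G} = {w. (v, w) \<in> parcs G}" for v
      using G.in_arcsD2 by auto
    then show ?thesis using G(3) by (simp add: degree_le_def card_out_neighbours max_degree_le_def)
  qed
  have con: "conn (parcs G) (pverts G - X)" if "X \<subseteq> pverts G" "card X < d" for X
    using G(2) that by (intro connected_imp_conn[OF G(1)]) (simp add: vertex_connected_def)
  obtain P T where "P \<subseteq> pverts G" "card P = h"
    "\<forall>p\<in>P. \<forall>a<d. conn (parcs G) (T p a) \<and> T p a \<subseteq> pverts G \<and> T p a \<inter> P = {p}"
    "\<forall>p\<in>P. \<forall>a<d. \<forall>q\<in>P. \<forall>b<d. (p, a) \<noteq> (q, b) \<longrightarrow>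
      T p a \<inter> T q b \<subseteq> P \<and> (\<exists>u\<in>T p a. \<exists>v\<in>T q b. (u, v) \<in> parcs G)"
    using fans_with_linkages[OF sg B deg con l] t l by auto
  then show ?thesis
    using h by (intro fans_imp_contains_subdivision[OF G(1) H, of P T]) auto
qed

section \<open>Encoding graphs without a clique minor\<close>

definition clique_minor_free :: "nat \<Rightarrow> 'a set \<Rightarrow> 'a rel \<Rightarrow> bool" where
  "clique_minor_free t V E \<longleftrightarrow> simple_graph V E \<and> (\<nexists>B. clique_model V E t B)"

lemma clique_minor_free_card_edges:
  assumes "clique_minor_free t V E"
  shows "card E \<le> 2 ^ t * card V"
proof (cases "V = {}")
  case True
  then have "E = {}" using assms simple_graphD(2) by (fastforce simp: clique_minor_free_def)
  then show ?thesis by simp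
next
  case False
  then show ?thesis
    using dense_imp_clique_model[of V E t] assms by (fastforce simp: clique_minor_free_def)
qed

lemma clique_minor_free_subgraph:
  assumes "clique_minor_free t V E" "simple_graph W F" "W \<subseteq> V" "F \<subseteq> E"
  shows "clique_minor_free t W F"
  using assms clique_model_mono[of W F t _ V E] by (auto simp: clique_minor_free_def)

text \<open>\<open>W\<close> accounts for the deletions and the fibres of \<open>\<pi>\<close> for
  the contractions.\<close>

lemma clique_minor_free_minor:
  assumes "clique_minor_free t V E" "simple_graph V' E'" "W \<subseteq> V"
    and "\<And>x. x \<in> V' \<Longrightarrow> conn E {v \<in> W. \<pi> v = x}"
    and "\<And>x y. x \<in> V' \<Longrightarrow> y \<in> V' \<Longrightarrow> x \<noteq> y \<Longrightarrow> (x, y) \<in> E' \<Longrightarrow>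
      \<exists>u\<in>W. \<exists>v\<in>W. \<pi> u = x \<and> \<pi> v = y \<and> (u, v) \<in> E"
  shows "clique_minor_free t V' E'"
  unfolding clique_minor_free_def
proof (intro conjI notI assms(2))
  assume "\<exists>B. clique_model V' E' t B"
  then obtain B where "clique_model V' E' t B" ..
  then have "clique_model W E t (\<lambda>i. {v \<in> W. \<pi> v \<in> B i})"
    using assms(4,5) by (rule clique_model_lift)
  then have "clique_model V E t (\<lambda>i. {v \<in> W. \<pi> v \<in> B i})"
    by (rule clique_model_mono[OF _ assms(3) subset_refl])
  then show False using assms(1) by (auto simp: clique_minor_free_def)
qed

section \<open>Neighbourhoods of vertices in an independent set\<close>

definition cliques :: "'a set \<Rightarrow> 'a rel \<Rightarrow> 'a set set" where
  "cliques X E = {Q. Q \<subseteq> X \<and> (\<forall>p\<in>Q. \<forall>q\<in>Q. p \<noteq> q \<longrightarrow> (p, q) \<in> E)}"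

text \<open>Sparsity yields a vertex \<open>v\<close> with at most \<open>C\<close> neighbours, and
  the cliques containing \<open>v\<close> correspond to subsets of its neighbourhood. The summand
  \<open>1\<close> is the empty clique.\<close>

lemma card_cliques:
  assumes "finite X" and "\<And>W. W \<subseteq> X \<Longrightarrow> card (E \<inter> W \<times> W) \<le> C * card W"
  shows "card (cliques X E) \<le> 2 ^ C * card X + 1"
  using assms
proof (induction "card X" arbitrary: X rule: less_induct)
  case (less X)
  show ?case
  proof (cases "X = {}")
    case True
    then have "cliques X E = {{}}" by (auto simp: cliques_def)
    then show ?thesis by simp
  next
    case False
    let ?N = "\<lambda>v. {w \<in> X. (v, w) \<in> E}"
    have "\<exists>v\<in>X. card (?N v) \<le> C"
    proof (rule ccontr)
      assume "\<not> ?thesis"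
      then have "(\<Sum>v\<in>X. Suc C) \<le> (\<Sum>v\<in>X. card (?N v))" by (intro sum_mono) (simp add: not_le Suc_le_eq)
      also have "\<dots> \<le> C * card X" using card_edges_sum[OF less.prems(1)] less.prems(2)[of X] by simp
      finally show False using False less.prems(1) by simp
    qed
    then obtain v where v: "v \<in> X" "card (?N v) \<le> C" by blast
    let ?X = "X - {v}"
    have cX: "card X = Suc (card ?X)" using v(1) less.prems(1) by (metis card_Suc_Diff1)
    have sub: "cliques X E \<subseteq> cliques ?X E \<union> insert v ` Pow (?N v)"
    proof
      fix Q assume Q: "Q \<in> cliques X E"
      show "Q \<in> cliques ?X E \<union> insert v ` Pow (?N v)"
      proof (cases "v \<in> Q")
        case True
        then have "Q = insert v (Q - {v})" "Q - {v} \<subseteq> ?N v" using Q by (auto simp: cliques_def)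
        then show ?thesis by blast
      qed (use Q in \<open>auto simp: cliques_def\<close>)
    qed
    have fin: "finite (cliques ?X E)" "finite (?N v)"
      using less.prems(1) by (auto simp: cliques_def)
    have "card (cliques X E) \<le> card (cliques ?X E \<union> insert v ` Pow (?N v))"
      using fin by (intro card_mono sub) auto
    also have "\<dots> \<le> card (cliques ?X E) + card (insert v ` Pow (?N v))" by (rule card_Un_le)
    also have "\<dots> \<le> (2 ^ C * card ?X + 1) + 2 ^ C"
    proof (rule add_mono)
      show "card (cliques ?X E) \<le> 2 ^ C * card ?X + 1"
        using less.prems cX by (intro less.hyps) auto
      have "card (insert v ` Pow (?N v)) \<le> card (Pow (?N v))" using fin(2) by (intro card_image_le) simp
      also have "\<dots> \<le> 2 ^ C" using v(2) fin(2) by (simp add: card_Pow)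
      finally show "card (insert v ` Pow (?N v)) \<le> 2 ^ C" .
    qed
    finally show ?thesis by (simp add: cX)
  qed
qed

text \<open>Contract as many vertices \<open>v\<close> of the independent set \<open>I\<close> as possible into neighbours
  \<open>f v\<close> in such a way that each contraction creates a new edge on \<open>X\<close>. There are few of them, since
  the resulting graph on \<open>X\<close> is sparse, and all other neighbourhoods are cliques in it.\<close>

lemma card_neighbourhoods_of_independent_set:
  assumes G: "clique_minor_free t V E" and I: "I \<subseteq> V" "E \<inter> I \<times> I = {}" and X: "X = V - I" and C: "C = 2 ^ t"
  shows "card ((\<lambda>v. E `` {v}) ` I) \<le> (C + 2 ^ C) * card X + 1"
proof -
  have sg: "simple_graph V E" using G by (simp add: clique_minor_free_def)
  note G' = simple_graphD[OF sg]
  have fin: "finite X" "finite I" using G'(1) I(1) X finite_subset by auto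
  have NX: "E `` {v} \<subseteq> X" if "v \<in> I" for v using that I G'(2) X by auto
  \<comment> \<open>The graph on \<open>X\<close> that results from contracting every
    \<open>v\<close> in \<open>A\<close> into \<open>f v\<close>.\<close>
  define J where "J A f = {(p, q). p \<in> X \<and> q \<in> X \<and> p \<noteq> q \<and> ((p, q) \<in> E \<or>
    (\<exists>v\<in>A. f v = p \<and> (v, q) \<in> E \<or> f v = q \<and> (v, p) \<in> E))}" for A :: "'a set" and f :: "'a \<Rightarrow> 'a"
  have free: "clique_minor_free t X (J A f)" if A: "A \<subseteq> I" "\<And>v. v \<in> A \<Longrightarrow> (v, f v) \<in> E" for A f
  proof (rule clique_minor_free_minor[OF G])
    define \<pi> where "\<pi> v = (if v \<in> A then f v else v)" for v
    show "simple_graph X (J A f)"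
      using fin(1) G'(3) by (auto simp: simple_graph_def J_def sym_def irrefl_def)
    show "X \<union> A \<subseteq> V" using A(1) I(1) X by blast
    have XA: "x \<notin> A" if "x \<in> X" for x using that A(1) X by blast
    show "conn E {v \<in> X \<union> A. \<pi> v = x}" if x: "x \<in> X" for x
    proof -
      have eq: "{v \<in> X \<union> A. \<pi> v = x} = insert x {v \<in> A. f v = x}"
        using XA x by (auto simp: \<pi>_def)
      have star: "(v, x) \<in> E" "(x, v) \<in> E" if "v \<in> A" "f v = x" for v
        using A(2) that G'(3) by (auto dest: symD)
      show ?thesis
        unfolding eq conn_def
      proof (intro conjI allI impI)
        fix D assume D: "D \<subseteq> insert x {v \<in> A. f v = x}" "D \<noteq> {} \<and> D \<noteq> insert x {v \<in> A. f v = x}"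
        show "\<exists>u\<in>D. \<exists>v\<in>insert x {v \<in> A. f v = x} - D. (u, v) \<in> E"
          using D star by (cases "x \<in> D") blast+
      qed simp
    qed
    show "\<exists>u\<in>X \<union> A. \<exists>v\<in>X \<union> A. \<pi> u = p \<and> \<pi> v = q \<and> (u, v) \<in> E"
      if pq: "p \<in> X" "q \<in> X" and e: "(p, q) \<in> J A f" for p q
    proof -
      consider "(p, q) \<in> E" | v where "v \<in> A" "f v = p" "(v, q) \<in> E" | v where "v \<in> A" "f v = q" "(v, p) \<in> E"
        using e by (auto simp: J_def)
      then show ?thesis
      proof cases
        case 1
        then show ?thesis using pq XA by (intro bexI[of _ p] bexI[of _ q]) (auto simp: \<pi>_def)
      next
        case (2 v)
        then show ?thesis using pq XA by (intro bexI[of _ v] bexI[of _ q]) (auto simp: \<pi>_def)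
      next
        case (3 v)
        then show ?thesis using pq XA G'(3)
          by (intro bexI[of _ p] bexI[of _ v]) (auto simp: \<pi>_def dest: symD)
      qed
    qed
  qed
  \<comment> \<open>That every contraction creates a new edge is remembered only as
    \<open>card A \<le> card (J A f)\<close>; the sparsity of the contracted graph then bounds
    \<open>card A\<close>.\<close>
  define Q where "Q A f \<longleftrightarrow> A \<subseteq> I \<and> (\<forall>v\<in>A. (v, f v) \<in> E) \<and> card A \<le> card (J A f)" for A f
  have finJ: "finite (J A f)" for A f
    by (rule finite_subset[of _ "X \<times> X"]) (use fin in \<open>auto simp: J_def\<close>)
  have Q0: "\<exists>f. Q {} f" by (simp add: Q_def)
  have bd: "\<forall>A. (\<exists>f. Q A f) \<longrightarrow> card A < Suc (card I)"
    using card_mono[OF fin(2)] by (auto simp: Q_def less_Suc_eq_le)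
  obtain A f where A: "Q A f" and max: "\<And>A' f'. Q A' f' \<Longrightarrow> card A' \<le> card A"
    using ex_has_greatest_nat[of "\<lambda>A. \<exists>f. Q A f", OF Q0 bd] by blast
  have AI: "A \<subseteq> I" "\<And>v. v \<in> A \<Longrightarrow> (v, f v) \<in> E" "card A \<le> card (J A f)" using A by (auto simp: Q_def)
  have finA: "finite A" using AI(1) fin(2) finite_subset by blast
  have fJ: "clique_minor_free t X (J A f)" by (rule free[OF AI(1,2)])
  \<comment> \<open>Two neighbours of \<open>v\<close> that are not yet adjacent would permit one
    more contraction, of \<open>v\<close> into one of them.\<close>
  have clique: "E `` {v} \<in> cliques X (J A f)" if v: "v \<in> I - A" for v
  proof (rule ccontr)
    assume "\<not> ?thesis"
    then obtain p q where pq: "(v, p) \<in> E" "(v, q) \<in> E" "p \<noteq> q" "(p, q) \<notin> J A f"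
      using NX[of v] v by (auto simp: cliques_def)
    let ?A = "insert v A" and ?f = "f(v := p)"
    have sub: "insert (p, q) (J A f) \<subseteq> J ?A ?f"
      using pq NX[of v] v by (auto simp: J_def)
    have "card ?A = Suc (card A)" using v finA by simp
    also have "\<dots> \<le> card (insert (p, q) (J A f))" using AI(3) pq(4) finJ by simp
    also have "\<dots> \<le> card (J ?A ?f)" by (intro card_mono finJ sub)
    finally have "Q ?A ?f" using AI v pq(1) by (auto simp: Q_def)
    then have "card ?A \<le> card A" by (rule max)
    then show False using v finA by simp
  qed
  have "card (cliques X (J A f)) \<le> 2 ^ C * card X + 1"
  proof (rule card_cliques[OF fin(1)])
    fix W assume W: "W \<subseteq> X"
    have "clique_minor_free t W (J A f \<inter> W \<times> W)"
      by (rule clique_minor_free_subgraph[OF fJ simple_graph_restrict[OF _ W] W])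
        (use fJ in \<open>auto simp: clique_minor_free_def\<close>)
    then show "card (J A f \<inter> W \<times> W) \<le> C * card W"
      using clique_minor_free_card_edges C by blast
  qed
  moreover have "card A \<le> C * card X"
    using AI(3) clique_minor_free_card_edges[OF fJ] C by simp
  moreover have "card ((\<lambda>v. E `` {v}) ` I) \<le> card A + card (cliques X (J A f))"
  proof -
    have "(\<lambda>v. E `` {v}) ` I \<subseteq> (\<lambda>v. E `` {v}) ` A \<union> cliques X (J A f)" using clique by blast
    moreover have "finite (cliques X (J A f))" using fin(1) by (simp add: cliques_def)
    ultimately have "card ((\<lambda>v. E `` {v}) ` I) \<le> card ((\<lambda>v. E `` {v}) ` A \<union> cliques X (J A f))"
      using finA by (intro card_mono) auto
    also have "\<dots> \<le> card ((\<lambda>v. E `` {v}) ` A) + card (cliques X (J A f))" by (rule card_Un_le)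
    also have "\<dots> \<le> card A + card (cliques X (J A f))" using finA by (simp add: card_image_le)
    finally show ?thesis .
  qed
  ultimately show ?thesis by (simp add: algebra_simps)
qed

text \<open>The ways in which a graph is encoded by a smaller one: as a blow-up by independent sets, in which
  case the vertex map determines the graph, or by splitting vertices into at most two, in which case
  few choices remain.\<close>

definition encodes :: "'a set \<Rightarrow> 'a rel \<Rightarrow> 'b rel \<Rightarrow> ('a \<Rightarrow> 'b) \<Rightarrow> bool" where
  "encodes V E E' \<pi> \<longleftrightarrow> (\<forall>x\<in>V. \<forall>y\<in>V. (x, y) \<in> E \<longleftrightarrow> (\<pi> x, \<pi> y) \<in> E') \<or>
     (\<forall>a. card {x \<in> V. \<pi> x = a} \<le> 2) \<and> (\<forall>x y. (x, y) \<in> E \<longrightarrow> \<pi> x = \<pi> y \<or> (\<pi> x, \<pi> y) \<in> E')"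

section \<open>Two ways of shrinking a graph\<close>

definition matching :: "'a set \<Rightarrow> 'a rel \<Rightarrow> 'a set \<Rightarrow> ('a \<Rightarrow> 'a) \<Rightarrow> bool" where
  "matching V E S m \<longleftrightarrow> S \<subseteq> V \<and> m ` S \<subseteq> V \<and> S \<inter> m ` S = {} \<and> inj_on m S \<and> (\<forall>s\<in>S. (s, m s) \<in> E)"

text \<open>Every matching edge is contracted onto its end in \<open>S\<close>, so exactly
  \<open>card S\<close> vertices disappear and fibres have at most two elements.\<close>

lemma contract_matching:
  fixes V :: "'a set"
  assumes G: "clique_minor_free t V E" and M: "matching V E S m"
  shows "\<exists>(V' :: 'a set) E' \<pi>. clique_minor_free t V' E' \<and> \<pi> ` V \<subseteq> V' \<and> card V' + card S = card V \<and>
    encodes V E E' \<pi>"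
proof -
  have sg: "simple_graph V E" using G by (simp add: clique_minor_free_def)
  note G' = simple_graphD[OF sg]
  have S: "S \<subseteq> V" "m ` S \<subseteq> V" "S \<inter> m ` S = {}" "inj_on m S" "\<And>s. s \<in> S \<Longrightarrow> (s, m s) \<in> E"
    using M by (auto simp: matching_def)
  define \<pi> where "\<pi> v = (if v \<in> m ` S then the_inv_into S m v else v)" for v
  have \<pi>m: "\<pi> (m s) = s" if "s \<in> S" for s
    using that S(4) by (simp add: \<pi>_def the_inv_into_f_f)
  have \<pi>id: "\<pi> v = v" if "v \<notin> m ` S" for v using that by (simp add: \<pi>_def)
  let ?V = "V - m ` S"
  define E' where "E' = {(\<pi> x, \<pi> y) | x y. (x, y) \<in> E \<and> \<pi> x \<noteq> \<pi> y}"
  have \<pi>V: "\<pi> v \<in> ?V" if "v \<in> V" for v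
  proof (cases "v \<in> m ` S")
    case True
    then obtain s where "s \<in> S" "v = m s" by blast
    then show ?thesis using \<pi>m S by auto
  qed (use that \<pi>id in auto)
  have fib: "{v \<in> V. \<pi> v = a} = (if a \<in> S then {a, m a} else {a})" if a: "a \<in> ?V" for a
  proof -
    have "v = a \<or> a \<in> S \<and> v = m a" if "\<pi> v = a" for v
    proof (cases "v \<in> m ` S")
      case True
      then obtain s where "s \<in> S" "v = m s" by blast
      then show ?thesis using \<pi>m that by auto
    qed (use that \<pi>id in auto)
    then show ?thesis using a S \<pi>m \<pi>id by auto
  qed
  have card2: "card {v \<in> V. \<pi> v = a} \<le> 2" for a
  proof (cases "a \<in> ?V")
    case True
    then show ?thesis by (simp add: fib card_insert_if)
  next
    case False
    then have "{v \<in> V. \<pi> v = a} = {}" using \<pi>V by auto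
    then show ?thesis by (metis card.empty zero_le)
  qed
  have "clique_minor_free t ?V E'"
  proof (rule clique_minor_free_minor[OF G _ subset_refl])
    show "simple_graph ?V E'"
      unfolding simple_graph_def
    proof (intro conjI)
      show "E' \<subseteq> ?V \<times> ?V" using \<pi>V G'(2) unfolding E'_def by blast
      show "sym E'" using G'(3) by (auto simp: E'_def sym_def) (metis symD[OF G'(3)])
    qed (use G'(1) in \<open>auto simp: E'_def irrefl_def\<close>)
    show "conn E {v \<in> V. \<pi> v = x}" if x: "x \<in> ?V" for x
    proof (cases "x \<in> S")
      case True
      then have "conn E (insert (m x) {x})"
        using S(5) by (intro conn_insert[OF conn_singleton G'(3)]) auto
      then show ?thesis using True fib[OF x] by (simp add: insert_commute)
    next
      case False
      then show ?thesis using fib[OF x] by (simp add: conn_singleton)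
    qed
    show "\<exists>u\<in>V. \<exists>v\<in>V. \<pi> u = x \<and> \<pi> v = y \<and> (u, v) \<in> E" if "(x, y) \<in> E'" for x y
      using that G'(2) unfolding E'_def by blast
  qed
  moreover have "card ?V + card S = card V"
  proof -
    have "card (m ` S) = card S" using S(4) by (rule card_image)
    moreover have "card (m ` S) \<le> card V" using S(2) G'(1) by (rule card_mono[rotated])
    ultimately show ?thesis using S(2) G'(1) by (simp add: card_Diff_subset finite_subset)
  qed
  moreover have "encodes V E E' \<pi>"
    unfolding encodes_def using card2 by (auto simp: E'_def)
  moreover have "\<pi> ` V \<subseteq> ?V" by (rule image_subsetI) (rule \<pi>V)
  ultimately show ?thesis by - (intro exI[of _ ?V] exI[of _ E'] exI[of _ \<pi>] conjI)
qed

text \<open>One vertex is kept from each class of vertices in \<open>I\<close> with equal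
  neighbourhoods. Replacing first one end of a pair and then the other by the kept twins does not
  change adjacency.\<close>

lemma identify_twins:
  fixes V :: "'a set"
  assumes G: "clique_minor_free t V E" and I: "I \<subseteq> V" "E \<inter> I \<times> I = {}"
  shows "\<exists>(V' :: 'a set) E' \<pi>. clique_minor_free t V' E' \<and> \<pi> ` V \<subseteq> V' \<and>
    card V' \<le> card (V - I) + card ((\<lambda>v. E `` {v}) ` I) \<and> encodes V E E' \<pi>"
proof -
  have sg: "simple_graph V E" using G by (simp add: clique_minor_free_def)
  note G' = simple_graphD[OF sg]
  have finI: "finite I" using I(1) G'(1) finite_subset by blast
  let ?N = "\<lambda>v. E `` {v}"
  define r where "r = inv_into I ?N"
  have r: "r (?N v) \<in> I" "?N (r (?N v)) = ?N v" if "v \<in> I" for v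
  proof -
    have "?N v \<in> ?N ` I" using that by blast
    then show "r (?N v) \<in> I" "?N (r (?N v)) = ?N v"
      unfolding r_def by (rule inv_into_into, rule f_inv_into_f)
  qed
  define \<pi> where "\<pi> v = (if v \<in> I then r (?N v) else v)" for v
  have N\<pi>: "(\<pi> x, y) \<in> E \<longleftrightarrow> (x, y) \<in> E" for x y
    using r(2)[of x] by (auto simp: \<pi>_def)
  let ?V = "(V - I) \<union> r ` ?N ` I"
  let ?E = "E \<inter> ?V \<times> ?V"
  have VV: "?V \<subseteq> V" using r(1) I(1) by auto
  have \<pi>V: "\<pi> v \<in> ?V" if "v \<in> V" for v using that by (auto simp: \<pi>_def)
  have free: "clique_minor_free t ?V ?E"
    by (rule clique_minor_free_subgraph[OF G simple_graph_restrict[OF sg VV] VV]) auto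
  have "card ?V \<le> card (V - I) + card (r ` ?N ` I)" by (rule card_Un_le)
  also have "\<dots> \<le> card (V - I) + card (?N ` I)" using finI by (simp add: card_image_le)
  finally have "card ?V \<le> card (V - I) + card (?N ` I)" .
  moreover have "encodes V E ?E \<pi>"
    unfolding encodes_def
  proof (intro disjI1 ballI)
    fix x y assume xy: "x \<in> V" "y \<in> V"
    have "(x, y) \<in> E \<longleftrightarrow> (\<pi> x, y) \<in> E" using N\<pi> by blast
    also have "\<dots> \<longleftrightarrow> (y, \<pi> x) \<in> E" using G'(3) by (auto dest: symD)
    also have "\<dots> \<longleftrightarrow> (\<pi> y, \<pi> x) \<in> E" using N\<pi> by blast
    also have "\<dots> \<longleftrightarrow> (\<pi> x, \<pi> y) \<in> E" using G'(3) by (auto dest: symD)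
    finally show "(x, y) \<in> E \<longleftrightarrow> (\<pi> x, \<pi> y) \<in> ?E" using \<pi>V[OF xy(1)] \<pi>V[OF xy(2)] by blast
  qed
  moreover have "\<pi> ` V \<subseteq> ?V" by (rule image_subsetI) (rule \<pi>V)
  ultimately show ?thesis using free by - (intro exI[of _ ?V] exI[of _ ?E] exI[of _ \<pi>] conjI)
qed

lemma maximal_matching:
  assumes sg: "simple_graph V E"
  obtains S m where "matching V E S m" "E \<inter> (V - S - m ` S) \<times> (V - S - m ` S) = {}"
proof -
  note G' = simple_graphD[OF sg]
  have M0: "\<exists>m. matching V E {} m" by (simp add: matching_def)
  have bd: "\<forall>S. (\<exists>m. matching V E S m) \<longrightarrow> card S < Suc (card V)"
    using card_mono[OF G'(1)] by (auto simp: matching_def less_Suc_eq_le)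
  obtain S m where M: "matching V E S m" and max: "\<And>S' m'. matching V E S' m' \<Longrightarrow> card S' \<le> card S"
    using ex_has_greatest_nat[of "\<lambda>S. \<exists>m. matching V E S m", OF M0 bd] by blast
  have "E \<inter> (V - S - m ` S) \<times> (V - S - m ` S) = {}"
  proof (rule ccontr)
    assume "\<not> ?thesis"
    then obtain u v where uv: "u \<in> V - S - m ` S" "v \<in> V - S - m ` S" "(u, v) \<in> E" by blast
    then have ne: "u \<noteq> v" using G'(4) by (auto simp: irrefl_def)
    have S: "S \<subseteq> V" "m ` S \<subseteq> V" "S \<inter> m ` S = {}" "inj_on m S" "\<And>s. s \<in> S \<Longrightarrow> (s, m s) \<in> E"
      using M by (auto simp: matching_def)
    have img: "(m(u := v)) ` insert u S = insert v (m ` S)" using uv(1) by auto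
    have "inj_on (m(u := v)) S" using S(4) uv(2) by (intro inj_on_fun_updI) auto
    moreover have "v \<notin> (m(u := v)) ` S" using uv by auto
    ultimately have "inj_on (m(u := v)) (insert u S)" using uv(1) by simp
    moreover have "insert u S \<inter> insert v (m ` S) = {}" using S(3) uv ne by auto
    ultimately have "matching V E (insert u S) (m(u := v))"
      unfolding matching_def img using S uv by auto
    then have "card (insert u S) \<le> card S" by (rule max)
    moreover have "finite S" using M G'(1) finite_subset by (auto simp: matching_def)
    ultimately show False using uv(1) by simp
  qed
  then show ?thesis using that M by blast
qed

text \<open>The inequality says \<open>card V' \<le> (1 - 1 / q) * card V\<close>. Contracting a
  matching of at least \<open>card V / q\<close> edges achieves this. Otherwise at most
  \<open>2 * card S\<close> vertices are matched, and identifying twins leaves at most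
  \<open>q * card S / 4 + 1\<close> vertices. By \<open>q * card S < card V\<close> and
  \<open>4 \<le> card V\<close> this is at most half of \<open>card V\<close>.\<close>

lemma clique_minor_free_encoded:
  fixes V :: "'a set"
  assumes G: "clique_minor_free t V E" and n: "4 \<le> card V" and C: "C = 2 ^ t" and q: "q = 8 * (1 + C + 2 ^ C)"
  shows "\<exists>(V' :: 'a set) E' \<pi>. clique_minor_free t V' E' \<and> \<pi> ` V \<subseteq> V' \<and>
    q * card V' + card V \<le> q * card V \<and> encodes V E E' \<pi>"
proof -
  have sg: "simple_graph V E" using G by (simp add: clique_minor_free_def)
  note G' = simple_graphD[OF sg]
  obtain S m where M: "matching V E S m" and indep: "E \<inter> (V - S - m ` S) \<times> (V - S - m ` S) = {}"
    by (rule maximal_matching[OF sg])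
  show ?thesis
  proof (cases "card V \<le> q * card S")
    case True
    obtain V' :: "'a set" and E' \<pi> where *: "clique_minor_free t V' E'" "\<pi> ` V \<subseteq> V'" "card V' + card S = card V"
      "encodes V E E' \<pi>" using contract_matching[OF G M] by blast
    have "q * card V' + q * card S = q * card V" using *(3) by (metis distrib_left)
    then have "q * card V' + card V \<le> q * card V" using True by linarith
    then show ?thesis using * by - (intro exI[of _ V'] exI[of _ E'] exI[of _ \<pi>] conjI)
  next
    case False
    let ?I = "V - S - m ` S"
    have SV: "S \<subseteq> V" "m ` S \<subseteq> V" using M by (auto simp: matching_def)
    have finS: "finite S" using SV(1) G'(1) finite_subset by blast
    have X: "V - ?I = S \<union> m ` S" using SV by blast
    have cX: "card (V - ?I) \<le> 2 * card S"
      unfolding X using card_Un_le[of S "m ` S"] card_image_le[OF finS, of m] by linarith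
    have I: "?I \<subseteq> V" by blast
    obtain V' :: "'a set" and E' \<pi> where *: "clique_minor_free t V' E'" "\<pi> ` V \<subseteq> V'"
      "card V' \<le> card (V - ?I) + card ((\<lambda>v. E `` {v}) ` ?I)" "encodes V E E' \<pi>"
      using identify_twins[OF G I indep] by blast
    have "card V' \<le> card (V - ?I) + ((C + 2 ^ C) * card (V - ?I) + 1)"
      using *(3) card_neighbourhoods_of_independent_set[OF G I indep refl C] by simp
    also have "\<dots> = (1 + C + 2 ^ C) * card (V - ?I) + 1" by (simp add: algebra_simps)
    also have "\<dots> \<le> (1 + C + 2 ^ C) * (2 * card S) + 1"
      using cX by (intro add_mono mult_le_mono) auto
    finally have "4 * card V' \<le> 4 * ((1 + C + 2 ^ C) * (2 * card S) + 1)" by (rule mult_le_mono2)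
    also have "\<dots> = q * card S + 4" by (simp add: q algebra_simps)
    finally have "2 * card V' \<le> card V" using False n by linarith
    then have "q * (2 * card V') \<le> q * card V" by (rule mult_le_mono2)
    moreover have "2 * card V \<le> q * card V" by (simp add: q)
    ultimately have "q * card V' + card V \<le> q * card V" by linarith
    then show ?thesis using * by - (intro exI[of _ V'] exI[of _ E'] exI[of _ \<pi>] conjI)
  qed
qed

section \<open>Counting\<close>

text \<open>Applied to the map onto the smaller graph: numbering the vertices in the order of their
  images makes that map monotone.\<close>

lemma order_enumeration:
  fixes f :: "'a \<Rightarrow> nat"
  assumes "finite V"
  shows "\<exists>h. bij_betw h V {..<card V} \<and> (\<forall>x\<in>V. \<forall>y\<in>V. f x < f y \<longrightarrow> h x < h y)"
  using assms
proof (induction V rule: finite_ranking_induct[where f = f])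
  case empty
  then show ?case by (simp add: bij_betw_def)
next
  case (insert x S)
  show ?case
  proof (cases "x \<in> S")
    case True
    then show ?thesis using insert.IH by (simp add: insert_absorb)
  next
    case False
    obtain h where h: "bij_betw h S {..<card S}" "\<And>a b. a \<in> S \<Longrightarrow> b \<in> S \<Longrightarrow> f a < f b \<Longrightarrow> h a < h b"
      using insert.IH by blast
    let ?h = "h(x := card S)"
    have "bij_betw ?h S {..<card S} \<longleftrightarrow> bij_betw h S {..<card S}"
      by (rule bij_betw_cong) (use False in auto)
    then have "bij_betw ?h S {..<card S}" using h(1) by simp
    then have "bij_betw ?h (insert x S) (insert (card S) {..<card S})"
      using bij_betw_combine[of ?h S "{..<card S}" "{x}" "{card S}"] by simp
    moreover have "insert (card S) {..<card S} = {..<card (insert x S)}"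
      using False insert.hyps(1) by (simp add: lessThan_Suc)
    ultimately have "bij_betw ?h (insert x S) {..<card (insert x S)}" by (simp only:)
    moreover have "?h a < ?h b" if "a \<in> insert x S" "b \<in> insert x S" "f a < f b" for a b
    proof -
      have "a \<noteq> x" using insert.hyps(2)[of b] that by auto
      then have "a \<in> S" using that by simp
      then have "h a < card S" using bij_betwE[OF h(1)] by simp
      then show ?thesis using h(2)[OF \<open>a \<in> S\<close>] that False \<open>a \<noteq> x\<close> by auto
    qed
    ultimately show ?thesis by blast
  qed
qed

definition monotone_maps :: "nat \<Rightarrow> nat \<Rightarrow> (nat \<Rightarrow> nat) set" where
  "monotone_maps n m = {p \<in> {..<n} \<rightarrow>\<^sub>E {..<m}. \<forall>i j. i < j \<longrightarrow> j < n \<longrightarrow> p i \<le> p j}"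

lemma finite_monotone_maps: "finite (monotone_maps n m)"
  by (rule finite_subset[OF _ finite_PiE[of "{..<n}" "\<lambda>_. {..<m}"]]) (auto simp: monotone_maps_def)

text \<open>A monotone map \<open>p\<close> is determined by the set of the numbers \<open>p i + i\<close>.\<close>

lemma card_monotone_maps: "card (monotone_maps n m) \<le> 2 ^ (n + m)"
proof -
  let ?f = "\<lambda>p. (\<lambda>i. p i + i) ` {..<n}"
  have sorted: "sorted (map (\<lambda>i. p i + i) [0..<n])" "distinct (map (\<lambda>i. p i + i) [0..<n])"
    if "p \<in> monotone_maps n m" for p
  proof -
    have lt: "p i + i < p j + j" if "i < j" "j < n" for i j
      using \<open>p \<in> monotone_maps n m\<close> that by (force simp: monotone_maps_def)
    show "sorted (map (\<lambda>i. p i + i) [0..<n])"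
      by (auto simp: sorted_iff_nth_mono_less intro: less_imp_le[OF lt])
    show "distinct (map (\<lambda>i. p i + i) [0..<n])"
      by (auto simp: distinct_map inj_on_def) (metis lt less_irrefl linorder_neqE_nat)
  qed
  have "inj_on ?f (monotone_maps n m)"
  proof (rule inj_onI)
    fix p q assume p: "p \<in> monotone_maps n m" and q: "q \<in> monotone_maps n m" and eq: "?f p = ?f q"
    have "map (\<lambda>i. p i + i) [0..<n] = map (\<lambda>i. q i + i) [0..<n]"
      using eq by (intro sorted_distinct_set_unique sorted p q) (simp add: atLeast0LessThan)
    then have "p i = q i" if "i < n" for i using that by (simp add: list_eq_iff_nth_eq)
    moreover have "p i = undefined" "q i = undefined" if "\<not> i < n" for i
      using p q that by (auto simp: monotone_maps_def PiE_def extensional_def)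
    ultimately show "p = q" by (metis ext)
  qed
  moreover have "?f ` monotone_maps n m \<subseteq> Pow {..<n + m}"
    by (force simp: monotone_maps_def PiE_def Pi_def)
  ultimately have "card (monotone_maps n m) \<le> card (Pow {..<n + m})"
    by (rule card_inj_on_le) simp
  then show ?thesis by (simp add: card_Pow)
qed

definition blow_up :: "nat \<Rightarrow> (nat \<Rightarrow> nat) \<Rightarrow> nat rel \<Rightarrow> nat rel" where
  "blow_up n p F = {(i, j). i < n \<and> j < n \<and> (p i, p j) \<in> F}"

text \<open>The two alternatives of \<open>encodes\<close> read backwards. \<open>Id\<close> admits
  edges between two vertices of the same fibre.\<close>

definition decodings :: "nat \<Rightarrow> nat rel \<Rightarrow> (nat \<Rightarrow> nat) \<Rightarrow> nat rel set" where
  "decodings n F p = insert (blow_up n p F)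
     (if \<forall>a. card {i. i < n \<and> p i = a} \<le> 2 then Pow (blow_up n p (Id \<union> F)) else {})"

text \<open>Each vertex and each arc of the smaller graph is blown up to at most
  \<open>2 * 2\<close> arcs, so there are subsets of at most \<open>4 * (1 + C) * n\<close> arcs to
  count. The summand \<open>1\<close> in the exponent pays for the inserted
  \<open>blow_up n p F\<close>.\<close>

lemma decodings_bound:
  assumes F: "F \<subseteq> {..<m} \<times> {..<m}" "card F \<le> C * m" and p: "p \<in> monotone_maps n m" and m: "m \<le> n"
  shows "finite (decodings n F p)" "card (decodings n F p) \<le> 2 ^ (1 + 4 * (1 + C) * n)"
proof -
  let ?A = "blow_up n p (Id \<union> F)"
  have finA: "finite ?A" by (rule finite_subset[of _ "{..<n} \<times> {..<n}"]) (auto simp: blow_up_def)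
  show "finite (decodings n F p)" using finA by (simp add: decodings_def)
  show "card (decodings n F p) \<le> 2 ^ (1 + 4 * (1 + C) * n)"
  proof (cases "\<forall>a. card {i. i < n \<and> p i = a} \<le> 2")
    case True
    let ?fib = "\<lambda>a. {i. i < n \<and> p i = a}"
    let ?D = "(\<lambda>a. (a, a)) ` {..<m} \<union> F"
    have finD: "finite ?D" using F(1) finite_subset by auto
    have "card ?D \<le> card ((\<lambda>a. (a, a)) ` {..<m}) + card F" by (rule card_Un_le)
    also have "\<dots> \<le> m + C * m" using card_image_le[of "{..<m}" "\<lambda>a. (a, a)"] F(2) by simp
    finally have cD: "card ?D \<le> m + C * m" .
    have "?A \<subseteq> (\<Union>(a, b)\<in>?D. ?fib a \<times> ?fib b)"
      using p by (force simp: blow_up_def monotone_maps_def PiE_def Pi_def)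
    then have "card ?A \<le> card (\<Union>(a, b)\<in>?D. ?fib a \<times> ?fib b)"
      using finD by (intro card_mono) auto
    also have "\<dots> \<le> (\<Sum>e\<in>?D. card (case e of (a, b) \<Rightarrow> ?fib a \<times> ?fib b))" by (rule card_UN_le[OF finD])
    also have "\<dots> \<le> (\<Sum>e\<in>?D. 4)"
    proof (rule sum_mono)
      fix e :: "nat \<times> nat"
      obtain a b where e: "e = (a, b)" by (cases e)
      have "card (?fib a) * card (?fib b) \<le> 2 * 2" using True by (intro mult_le_mono) auto
      then show "card (case e of (a, b) \<Rightarrow> ?fib a \<times> ?fib b) \<le> 4"
        by (simp add: e card_cartesian_product)
    qed
    also have "\<dots> \<le> 4 * (m + C * m)" using cD by simp
    also have "\<dots> \<le> 4 * (n + C * n)" using m by (intro mult_le_mono add_mono) auto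
    finally have "card ?A \<le> 4 * (1 + C) * n" by (simp add: algebra_simps)
    then have "card (Pow ?A) \<le> 2 ^ (4 * (1 + C) * n)"
      using finA by (simp add: card_Pow)
    moreover have "card (decodings n F p) \<le> Suc (card (Pow ?A))"
      using True finA by (simp add: decodings_def card_insert_if)
    moreover have "(1::nat) \<le> 2 ^ (4 * (1 + C) * n)" by simp
    ultimately have "card (decodings n F p) \<le> 2 * 2 ^ (4 * (1 + C) * n)" by linarith
    then show ?thesis by simp
  next
    case False
    then have "card (decodings n F p) = 1" by (auto simp: decodings_def)
    then show ?thesis by simp
  qed
qed

text \<open>A covering family is enough for an upper bound; it may contain isomorphic copies and
  graphs with the minor. \<open>V\<close> ranges over all finite sets of numbers because shrinking a
  graph leaves no initial segment in general.\<close>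

definition enumerates :: "nat \<Rightarrow> nat \<Rightarrow> nat rel set \<Rightarrow> bool" where
  "enumerates t n R \<longleftrightarrow> finite R \<and> (\<forall>F\<in>R. F \<subseteq> {..<n} \<times> {..<n}) \<and>
     (\<forall>(V :: nat set) E. clique_minor_free t V E \<longrightarrow> card V = n \<longrightarrow>
       (\<exists>h. bij_betw h V {..<n} \<and> map_prod h h ` E \<in> R))"

text \<open>\<open>h\<close> numbers the vertices in the order of \<open>g (\<pi> x)\<close>, and
  \<open>p\<close> is the map \<open>\<pi>\<close> transported along the two numberings.\<close>

lemma decoding_exists:
  fixes V V' :: "'a set"
  assumes sg: "simple_graph V E" "simple_graph V' E'" and n: "card V = n" and \<pi>: "\<pi> ` V \<subseteq> V'"
    and g: "bij_betw g V' {..<m}" and enc: "encodes V E E' \<pi>"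
  shows "\<exists>h p. bij_betw h V {..<n} \<and> p \<in> monotone_maps n m \<and>
    map_prod h h ` E \<in> decodings n (map_prod g g ` E') p"
proof -
  note G = simple_graphD[OF sg(1)] and G' = simple_graphD[OF sg(2)]
  obtain h where h: "bij_betw h V {..<n}"
    and mono: "\<And>x y. x \<in> V \<Longrightarrow> y \<in> V \<Longrightarrow> g (\<pi> x) < g (\<pi> y) \<Longrightarrow> h x < h y"
    using order_enumeration[OF G(1), of "\<lambda>x. g (\<pi> x)"] n by blast
  define k where "k = the_inv_into V h"
  have k: "k i \<in> V" "h (k i) = i" if "i < n" for i
    using h that by (auto simp: k_def bij_betw_def the_inv_into_into f_the_inv_into_f)
  have hk: "h x < n" "k (h x) = x" if "x \<in> V" for x
    using h that by (auto simp: k_def bij_betw_def the_inv_into_f_f)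
  define p where "p i = (if i < n then g (\<pi> (k i)) else undefined)" for i
  have gV: "g (\<pi> x) < m" if "x \<in> V" for x using g \<pi> that by (auto simp: bij_betw_def)
  have "p i \<le> p j" if "i < j" "j < n" for i j
  proof (rule ccontr)
    assume "\<not> p i \<le> p j"
    then have "g (\<pi> (k j)) < g (\<pi> (k i))" using that by (simp add: p_def)
    then have "j < i" using mono[of "k j" "k i"] k that by auto
    then show False using that by simp
  qed
  then have p: "p \<in> monotone_maps n m"
    using gV k by (auto simp: monotone_maps_def p_def PiE_def extensional_def)
  have ginj: "g a = g b \<longleftrightarrow> a = b" if "a \<in> V'" "b \<in> V'" for a b
    using g that by (auto simp: bij_betw_def inj_on_def)
  have E: "(i, j) \<in> map_prod h h ` E \<longleftrightarrow> i < n \<and> j < n \<and> (k i, k j) \<in> E" for i j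
  proof
    assume "(i, j) \<in> map_prod h h ` E"
    then obtain x y where "(x, y) \<in> E" "i = h x" "j = h y" by auto
    then show "i < n \<and> j < n \<and> (k i, k j) \<in> E" using hk[of x] hk[of y] G(2) by auto
  next
    assume "i < n \<and> j < n \<and> (k i, k j) \<in> E"
    then show "(i, j) \<in> map_prod h h ` E"
      using k[of i] k[of j] by (intro image_eqI[of _ _ "(k i, k j)"]) auto
  qed
  have E': "(g a, g b) \<in> map_prod g g ` E' \<longleftrightarrow> (a, b) \<in> E'" if "a \<in> V'" "b \<in> V'" for a b
  proof
    assume "(g a, g b) \<in> map_prod g g ` E'"
    then obtain c e where "(c, e) \<in> E'" "g a = g c" "g b = g e" by auto
    then show "(a, b) \<in> E'" using G'(2) ginj that by auto
  qed auto
  have \<pi>k: "\<pi> (k i) \<in> V'" if "i < n" for i using k(1)[OF that] \<pi> by blast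
  have "map_prod h h ` E \<in> decodings n (map_prod g g ` E') p"
  proof (cases "\<forall>x\<in>V. \<forall>y\<in>V. (x, y) \<in> E \<longleftrightarrow> (\<pi> x, \<pi> y) \<in> E'")
    case True
    have "map_prod h h ` E = blow_up n p (map_prod g g ` E')"
    proof (rule set_eqI)
      fix ij :: "nat \<times> nat"
      obtain i j where ij: "ij = (i, j)" by (cases ij)
      show "ij \<in> map_prod h h ` E \<longleftrightarrow> ij \<in> blow_up n p (map_prod g g ` E')"
        unfolding ij E blow_up_def using True k \<pi>k E' by (auto simp: p_def)
    qed
    then show ?thesis by (simp add: decodings_def)
  next
    case False
    then have two: "card {x \<in> V. \<pi> x = a} \<le> 2"
      and edge: "\<And>x y. (x, y) \<in> E \<Longrightarrow> \<pi> x = \<pi> y \<or> (\<pi> x, \<pi> y) \<in> E'" for a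
      using enc by (auto simp: encodes_def)
    have "card {i. i < n \<and> p i = a} \<le> 2" for a
    proof (cases "a \<in> g ` V'")
      case True
      then obtain b where b: "b \<in> V'" "a = g b" by blast
      have "inj_on k {i. i < n \<and> p i = a}" by (rule inj_on_inverseI[of _ h]) (simp add: k(2))
      moreover have "k ` {i. i < n \<and> p i = a} \<subseteq> {x \<in> V. \<pi> x = b}"
        using k \<pi>k ginj b by (auto simp: p_def)
      moreover have "finite {x \<in> V. \<pi> x = b}" using G(1) by simp
      ultimately have "card {i. i < n \<and> p i = a} \<le> card {x \<in> V. \<pi> x = b}" by (rule card_inj_on_le)
      then show ?thesis using two[of b] by simp
    next
      case False
      then have "{i. i < n \<and> p i = a} = {}" using \<pi>k by (auto simp: p_def)
      then show ?thesis by (metis card.empty zero_le)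
    qed
    moreover have "map_prod h h ` E \<subseteq> blow_up n p (Id \<union> map_prod g g ` E')"
    proof
      fix ij assume "ij \<in> map_prod h h ` E"
      moreover obtain i j where ij: "ij = (i, j)" by (cases ij)
      ultimately have *: "i < n" "j < n" "(k i, k j) \<in> E" using E by auto
      then show "ij \<in> blow_up n p (Id \<union> map_prod g g ` E')"
        using edge[OF *(3)] by (auto simp: ij blow_up_def p_def)
    qed
    ultimately show ?thesis by (simp add: decodings_def)
  qed
  then show ?thesis using h p by blast
qed

text \<open>The smaller graph has \<open>m\<close> vertices with
  \<open>q * m \<le> q * n - n\<close>, so it has at most \<open>b ^ (q * n - n)\<close> codes. The
  choices of \<open>m\<close>, of the monotone map and of the decoding number at most
  \<open>2 ^ n\<close>, \<open>2 ^ (2 * n)\<close> and \<open>2 ^ (1 + 4 * (1 + C) * n)\<close>. The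
  exponents sum to \<open>(7 + 4 * C) * n + 1\<close>, which for positive \<open>n\<close> is at
  most \<open>(8 + 4 * C) * n\<close>; this is the origin of \<open>b\<close>.\<close>

lemma clique_minor_free_small:
  assumes C: "C = 2 ^ t" and q: "q = 8 * (1 + C + 2 ^ C)" and b: "b = 2 ^ (8 + 4 * C)"
  shows "\<exists>R. enumerates t n R \<and> card R \<le> (b ^ q) ^ n"
proof (induction n rule: less_induct)
  case (less n)
  have q1: "1 \<le> q" by (simp add: q)
  show ?case
  proof (cases "n < 4")
    case True
    let ?R = "Pow ({..<n} \<times> {..<n})"
    have "enumerates t n ?R"
      unfolding enumerates_def
    proof (intro conjI allI impI)
      fix V :: "nat set" and E assume V: "clique_minor_free t V E" "card V = n"
      then have sg: "simple_graph V E" by (simp add: clique_minor_free_def)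
      then obtain h where "bij_betw h V {..<n}"
        using order_enumeration[of V id] simple_graphD(1) V(2) by blast
      moreover from this have "map_prod h h ` E \<in> ?R"
        using simple_graphD(2)[OF sg] by (auto simp: bij_betw_def)
      ultimately show "\<exists>h. bij_betw h V {..<n} \<and> map_prod h h ` E \<in> ?R" by blast
    qed auto
    moreover have "card ?R \<le> (b ^ q) ^ n"
    proof -
      have "card ?R = 2 ^ (n * n)" by (simp add: card_Pow card_cartesian_product)
      also have "\<dots> \<le> 2 ^ ((8 + 4 * C) * q * n)"
      proof (rule power_increasing)
        have "n \<le> (8 + 4 * C) * q" using True q1 by (simp add: algebra_simps)
        then show "n * n \<le> (8 + 4 * C) * q * n" by (rule mult_le_mono1)
      qed simp
      also have "\<dots> = (b ^ q) ^ n" by (simp add: b power_mult)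
      finally show ?thesis .
    qed
    ultimately show ?thesis by blast
  next
    case False
    have "\<forall>m\<in>{..<n}. \<exists>R. enumerates t m R \<and> card R \<le> (b ^ q) ^ m" using less.IH by blast
    from bchoice[OF this] obtain R where R: "\<And>m. m < n \<Longrightarrow> enumerates t m (R m)"
      "\<And>m. m < n \<Longrightarrow> card (R m) \<le> (b ^ q) ^ m" by blast
    define M where "M = {m. q * m + n \<le> q * n}"
    \<comment> \<open>A covering family may contain dense graphs, so only its sparse members are
      decoded; the codes that occur are sparse.\<close>
    define R' where "R' m = {F \<in> R m. card F \<le> C * m}" for m
    have Mn: "m < n" if "m \<in> M" for m
    proof (rule ccontr)
      assume "\<not> m < n"
      then have "q * n \<le> q * m" by (intro mult_le_mono2) simp
      moreover have "q * m + n \<le> q * n" using that by (simp add: M_def)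
      ultimately show False using False by linarith
    qed
    have R'F: "F \<subseteq> {..<m} \<times> {..<m}" "card F \<le> C * m" if "m < n" "F \<in> R' m" for m F
      using R(1)[OF that(1)] that(2) by (auto simp: enumerates_def R'_def)
    have finR': "finite (R' m)" if "m < n" for m
      using R(1)[OF that] by (simp add: enumerates_def R'_def)
    define Q where "Q = (\<Union>m\<in>M. \<Union>F\<in>R' m. \<Union>p\<in>monotone_maps n m. decodings n F p)"
    let ?d = "2 ^ (1 + 4 * (1 + C) * n) :: nat"
    have finM: "finite M" by (rule finite_subset[of _ "{..<n}"]) (use Mn in auto)
    have inner: "finite (\<Union>F\<in>R' m. \<Union>p\<in>monotone_maps n m. decodings n F p)"
      "card (\<Union>F\<in>R' m. \<Union>p\<in>monotone_maps n m. decodings n F p) \<le> (b ^ q) ^ m * (2 ^ (n + m) * ?d)"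
      if m: "m \<in> M" for m
    proof -
      have fin1: "finite (decodings n F p)" "card (decodings n F p) \<le> ?d"
        if "F \<in> R' m" "p \<in> monotone_maps n m" for F p
        using decodings_bound[OF R'F[OF Mn[OF m] that(1)] that(2)] Mn[OF m] by auto
      show "finite (\<Union>F\<in>R' m. \<Union>p\<in>monotone_maps n m. decodings n F p)"
        using fin1 finR'[OF Mn[OF m]] finite_monotone_maps by blast
      have c1: "card (\<Union>p\<in>monotone_maps n m. decodings n F p) \<le> 2 ^ (n + m) * ?d" if F: "F \<in> R' m" for F
      proof -
        have "card (\<Union>p\<in>monotone_maps n m. decodings n F p) \<le> (\<Sum>p\<in>monotone_maps n m. card (decodings n F p))"
          by (rule card_UN_le[OF finite_monotone_maps])
        also have "\<dots> \<le> (\<Sum>p\<in>monotone_maps n m. ?d)" using fin1(2)[OF F] by (rule sum_mono)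
        also have "\<dots> = card (monotone_maps n m) * ?d" by simp
        also have "\<dots> \<le> 2 ^ (n + m) * ?d" by (rule mult_le_mono1[OF card_monotone_maps])
        finally show ?thesis .
      qed
      have "card (\<Union>F\<in>R' m. \<Union>p\<in>monotone_maps n m. decodings n F p)
        \<le> (\<Sum>F\<in>R' m. card (\<Union>p\<in>monotone_maps n m. decodings n F p))"
        by (rule card_UN_le[OF finR'[OF Mn[OF m]]])
      also have "\<dots> \<le> (\<Sum>F\<in>R' m. 2 ^ (n + m) * ?d)" using c1 by (rule sum_mono)
      also have "\<dots> = card (R' m) * (2 ^ (n + m) * ?d)" by simp
      also have "\<dots> \<le> (b ^ q) ^ m * (2 ^ (n + m) * ?d)"
      proof (rule mult_le_mono1)
        have "card (R' m) \<le> card (R m)"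
          using R(1)[OF Mn[OF m]] by (intro card_mono) (auto simp: enumerates_def R'_def)
        then show "card (R' m) \<le> (b ^ q) ^ m" using R(2)[OF Mn[OF m]] by simp
      qed
      finally show "card (\<Union>F\<in>R' m. \<Union>p\<in>monotone_maps n m. decodings n F p)
        \<le> (b ^ q) ^ m * (2 ^ (n + m) * ?d)" .
    qed
    have "enumerates t n Q"
      unfolding enumerates_def
    proof (intro conjI ballI allI impI)
      show "finite Q" unfolding Q_def using finM inner(1) by blast
      show "F \<subseteq> {..<n} \<times> {..<n}" if "F \<in> Q" for F
        using that by (auto simp: Q_def decodings_def blow_up_def split: if_splits)
      fix V :: "nat set" and E assume V: "clique_minor_free t V E" "card V = n"
      obtain V' :: "nat set" and E' \<pi> where V': "clique_minor_free t V' E'" "\<pi> ` V \<subseteq> V'"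
        "q * card V' + card V \<le> q * card V" "encodes V E E' \<pi>"
        using clique_minor_free_encoded[OF V(1) _ C q] V(2) False by auto
      define m where "m = card V'"
      have m: "m \<in> M" using V'(3) V(2) by (simp add: M_def m_def)
      obtain g where g: "bij_betw g V' {..<m}" "map_prod g g ` E' \<in> R m"
        using R(1)[OF Mn[OF m]] V'(1) m_def unfolding enumerates_def by metis
      have sg: "simple_graph V E" "simple_graph V' E'"
        using V(1) V'(1) by (auto simp: clique_minor_free_def)
      have "card (map_prod g g ` E') \<le> card E'"
        by (rule card_image_le) (rule simple_graphD(5)[OF sg(2)])
      also have "\<dots> \<le> C * m" using clique_minor_free_card_edges[OF V'(1)] by (simp add: C m_def)
      finally have gR: "map_prod g g ` E' \<in> R' m" using g(2) by (simp add: R'_def)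
      obtain h p where "bij_betw h V {..<n}" "p \<in> monotone_maps n m"
        "map_prod h h ` E \<in> decodings n (map_prod g g ` E') p"
        using decoding_exists[OF sg V(2) V'(2) g(1) V'(4)] by blast
      then show "\<exists>h. bij_betw h V {..<n} \<and> map_prod h h ` E \<in> Q"
        unfolding Q_def using m gR by blast
    qed
    moreover have "card Q \<le> (b ^ q) ^ n"
    proof -
      have bn: "b ^ n = 2 ^ ((8 + 4 * C) * n)" by (simp add: b power_mult)
      have each: "(b ^ q) ^ m * (2 ^ (n + m) * ?d) \<le> b ^ (q * n - n) * (2 ^ (2 * n) * ?d)" if m: "m \<in> M" for m
      proof (intro mult_le_mono)
        have "b ^ (q * m) \<le> b ^ (q * n - n)"
          using m by (intro power_increasing) (auto simp: M_def b)
        then show "(b ^ q) ^ m \<le> b ^ (q * n - n)" by (simp add: power_mult)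
        show "(2::nat) ^ (n + m) \<le> 2 ^ (2 * n)" using Mn[OF m] by (intro power_increasing) auto
      qed simp
      have "card Q \<le> (\<Sum>m\<in>M. card (\<Union>F\<in>R' m. \<Union>p\<in>monotone_maps n m. decodings n F p))"
        unfolding Q_def by (rule card_UN_le[OF finM])
      also have "\<dots> \<le> (\<Sum>m\<in>M. b ^ (q * n - n) * (2 ^ (2 * n) * ?d))"
        using inner(2) each by (intro sum_mono) (meson order_trans)
      also have "\<dots> = card M * (b ^ (q * n - n) * (2 ^ (2 * n) * ?d))" by simp
      also have "\<dots> \<le> 2 ^ n * (b ^ (q * n - n) * (2 ^ (2 * n) * ?d))"
      proof (rule mult_le_mono1)
        have "card M \<le> card {..<n}" using Mn by (intro card_mono) auto
        then show "card M \<le> 2 ^ n" using less_exp[of n] unfolding card_lessThan by linarith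
      qed
      also have "\<dots> = b ^ (q * n - n) * 2 ^ (n + 2 * n + (1 + 4 * (1 + C) * n))"
        by (simp only: power_add mult_ac)
      also have "\<dots> \<le> b ^ (q * n - n) * b ^ n"
        unfolding bn using False by (intro mult_le_mono2 power_increasing) (auto simp: algebra_simps)
      also have "\<dots> = b ^ (q * n)" using q1 by (simp add: power_add[symmetric])
      finally show ?thesis by (simp add: power_mult)
    qed
    ultimately show ?thesis by blast
  qed
qed

section \<open>Passing to isomorphism classes\<close>

lemma digraph_iso_map_prod:
  assumes G: "pair_graph G" and g: "inj_on g (pverts G)" "g ` pverts G = pverts G'" "map_prod g g ` parcs G = parcs G'"
  shows "digraph_iso (with_proj G) (with_proj G')"
proof -
  interpret pair_graph G by (rule G)
  let ?f = "\<lparr>iso_verts = g, iso_arcs = map_prod g g, iso_head = snd, iso_tail = fst\<rparr>"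
  have "inj_on (map_prod g g) (parcs G)"
    by (rule inj_on_subset[OF map_prod_inj_on[OF g(1) g(1)]]) (auto dest: in_arcsD1 in_arcsD2)
  then have "pre_digraph.digraph_isomorphism (with_proj G) ?f"
    using g(1) wf_digraph by (auto simp: pre_digraph.digraph_isomorphism_def)
  moreover have "with_proj G' = app_iso ?f (with_proj G)"
    using g by (simp add: app_iso_def with_proj_def)
  ultimately show ?thesis unfolding digraph_iso_def by blast
qed

text \<open>Graphs with the same code are isomorphic to the same graph on \<open>{..<n}\<close>,
  hence to each other. So the code of a chosen representative distinguishes the classes.\<close>

lemma card_unlabelled_graphs_le:
  assumes R: "enumerates t n R"
    and P: "\<And>G. G \<in> graphs_on n P \<Longrightarrow> clique_minor_free t (pverts G) (parcs G)"
  shows "card (unlabelled_graphs n P) \<le> card R"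
proof -
  let ?S = "graphs_on n P" and ?r = "iso_rel (graphs_on n P)"
  have pg: "pair_graph G" if "G \<in> ?S" for G using that by (simp add: graphs_on_def)
  have eq: "equiv ?S ?r" by (rule equiv_iso_rel[OF pg])
  have "\<forall>G\<in>?S. \<exists>F. F \<in> R \<and> (\<exists>h. bij_betw h {..<n} {..<n} \<and> map_prod h h ` parcs G = F)"
  proof
    fix G assume G: "G \<in> ?S"
    then have V: "pverts G = {..<n}" by (simp add: graphs_on_def)
    have "clique_minor_free t {..<n} (parcs G)" using P[OF G] by (simp add: V)
    then have "\<exists>h. bij_betw h {..<n} {..<n} \<and> map_prod h h ` parcs G \<in> R"
      using R unfolding enumerates_def by (metis card_lessThan)
    then show "\<exists>F. F \<in> R \<and> (\<exists>h. bij_betw h {..<n} {..<n} \<and> map_prod h h ` parcs G = F)" by blast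
  qed
  from bchoice[OF this] obtain code where code: "\<And>G. G \<in> ?S \<Longrightarrow> code G \<in> R"
    "\<And>G. G \<in> ?S \<Longrightarrow> \<exists>h. bij_betw h {..<n} {..<n} \<and> map_prod h h ` parcs G = code G" by blast
  have same: "(G, G') \<in> ?r" if G: "G \<in> ?S" "G' \<in> ?S" "code G = code G'" for G G'
  proof -
    let ?K = "\<lparr>pverts = {..<n}, parcs = code G\<rparr>"
    have iso: "digraph_iso (with_proj A) (with_proj ?K)" if A: "A \<in> ?S" "code A = code G" for A
    proof -
      obtain h where h: "bij_betw h {..<n} {..<n}" "map_prod h h ` parcs A = code A" using code(2)[OF A(1)] by blast
      have "pverts A = {..<n}" using A(1) by (simp add: graphs_on_def)
      then show ?thesis
        using h A(2) by (intro digraph_iso_map_prod[OF pg[OF A(1)], of h]) (auto simp: bij_betw_def)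
    qed
    have wf: "wf_digraph (with_proj G')"
    proof -
      interpret pair_graph G' by (rule pg[OF G(2)])
      show ?thesis by (rule wf_digraph)
    qed
    have "digraph_iso (with_proj ?K) (with_proj G')"
      using iso[OF G(2) G(3)[symmetric]] wf by (rule digraph_iso_swap[rotated])
    then show ?thesis
      using iso[OF G(1) refl] G(1,2) by (auto simp: iso_rel_def intro: digraph_iso_trans)
  qed
  define rep where "rep X = (SOME G. G \<in> X)" for X :: "nat pair_pre_digraph set"
  have rep: "rep X \<in> X" "X \<subseteq> ?S" if X: "X \<in> ?S // ?r" for X
  proof -
    show "X \<subseteq> ?S" using X eq by (rule in_quotient_imp_subset[rotated])
    have "X \<noteq> {}" using X eq by (rule in_quotient_imp_non_empty[rotated])
    then show "rep X \<in> X" unfolding rep_def by (simp add: some_in_eq)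
  qed
  have "inj_on (\<lambda>X. code (rep X)) (?S // ?r)"
  proof (rule inj_onI)
    fix X Y assume X: "X \<in> ?S // ?r" and Y: "Y \<in> ?S // ?r" and c: "code (rep X) = code (rep Y)"
    have "(rep X, rep Y) \<in> ?r" using rep[OF X] rep[OF Y] c by (intro same) auto
    then show "X = Y" using quotient_eqI[OF eq X Y rep(1)[OF X] rep(1)[OF Y]] by blast
  qed
  moreover have "(\<lambda>X. code (rep X)) ` (?S // ?r) \<subseteq> R"
    using rep code(1) by blast
  ultimately show ?thesis
    unfolding unlabelled_graphs_def using R
    by (intro card_inj_on_le[of "\<lambda>X. code (rep X)"]) (auto simp: enumerates_def)
qed

theorem mainTheorem2:
  fixes d d' :: nat and H :: "'a pair_pre_digraph"
  assumes "pair_graph H" and "max_degree_le H d"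
  shows "\<exists>c::real. c > 0 \<and>
    (\<forall>n::nat. real (card (unlabelled_graphs n
        (\<lambda>G. vertex_connected d G \<and> max_degree_le G d' \<and> \<not> contains_subdivision G H))) \<le> c ^ n)"
proof -
  define h where "h = card (pverts H)"
  define l where "l = 2 * (d * h) + d'"
  define t where "t = h * Suc (Suc l ^ (l + 2)) + h + 2 * l + 2"
  define C q b :: nat where "C = 2 ^ t" and "q = 8 * (1 + C + 2 ^ C)" and "b = 2 ^ (8 + 4 * C)"
  let ?P = "\<lambda>G :: nat pair_pre_digraph.
    vertex_connected d G \<and> max_degree_le G d' \<and> \<not> contains_subdivision G H"
  have free: "clique_minor_free t (pverts G) (parcs G)" if "G \<in> graphs_on n ?P" for G n
  proof -
    have G: "pair_graph G" "vertex_connected d G" "max_degree_le G d'" "\<not> contains_subdivision G H"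
      using that by (auto simp: graphs_on_def)
    then show ?thesis
      using clique_model_imp_contains_subdivision[OF G(1-3) assms h_def l_def, of t]
        pair_graph_simple_graph[OF G(1)]
      by (auto simp: clique_minor_free_def t_def)
  qed
  have "card (unlabelled_graphs n ?P) \<le> (b ^ q) ^ n" for n
  proof -
    obtain R where "enumerates t n R" "card R \<le> (b ^ q) ^ n"
      using clique_minor_free_small[OF C_def q_def b_def] by blast
    then show ?thesis using card_unlabelled_graphs_le[of t n R ?P] free by fastforce
  qed
  then have "real (card (unlabelled_graphs n ?P)) \<le> real ((b ^ q) ^ n)" for n
    by (simp only: of_nat_le_iff)
  then have "real (card (unlabelled_graphs n ?P)) \<le> real (b ^ q) ^ n" for n
    by (simp only: of_nat_power)
  moreover have "0 < real (b ^ q)" by (simp add: b_def)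
  ultimately show ?thesis by blast
qed

end
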